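(* Let $\mathbf{k}$ be a field. Then 2-term $EL_\infty$-algebras over $\mathbf{k}$, with their morphisms, 2-morphisms and compositions, form a (strict) 2-category $\mathbf{2TermEL_\infty}$. Moreover, the Dold--Kan correspondence (the normalization $N$ and its quasi-inverse $\Gamma$) induces 2-functors $N:\mathbf{2Lie}\to\mathbf{2TermEL_\infty}$ and $\Gamma:\mathbf{2TermEL_\infty}\to\mathbf{2Lie}$ which form an equivalence of 2-categories between the 2-category $\mathbf{2Lie}$ of Lie 2-algebras and $\mathbf{2TermEL_\infty}$.
   Context: **Linear categories.** A linear category (2-vector space) $V$ is a category internal to $\mathbf{k}$-vector spaces: objects $V_0$ and arrows $V_1$ are vector spaces and source $s$, target $t$, identity $x\mapsto 1_x$ and composition are linear. Linear functors and linear natural transformations are those whose structure maps are linear. The tensor product is $(V\otimes W)_i=V_i\otimes W_i$; $\sigma$ denotes the transposition and $\sigma_{12}$ the transposition of the first two factors. Objects appearing in arrow expressions denote their identity arrows (e.g. $[x,\mathbf a]=[1_x,\mathbf a]$). A 2-term cochain complex is $C=(C^{-1}\xrightarrow{d}C^0)$. $N(V)$ is the complex $N(V)^0=V_0$, $N(V)^{-1}=\ker s$, $d=t|_{\ker s}$. $\Gamma(C)$ is the linear category with $\Gamma(C)_0=C^0$, $\Gamma(C)_1=C^0\oplus C^{-1}$, $s(x,a)=x$, $t(x,a)=x+da$, $1_x=(x,0)$, $(x+da,b)(x,a)=(x,a+b)$. Canonically $V\simeq\Gamma N(V)$, an arrow $\mathbf a:x\to y$ being written $(x,a)$ with $a=\mathbf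 a-1_x$. **The 2-category $\mathbf{2Lie}$.** A Lie 2-algebra is a linear category $L$ with a bilinear functor $[\cdot,\cdot]:L\otimes L\to L$, a bilinear natural transformation $S_{x,y}:[x,y]\to-[y,x]$ (alternator) and a trilinear natural transformation $J_{x,y,z}:[x,[y,z]]\to[[x,y],z]+[y,[x,z]]$ (Jacobiator), such that for all objects $x,y,z,w$, with $\hat J_{x,y,z}=J_{x,y,z}^{-1}-1_{[y,[x,z]]}:[[x,y],z]\to[x,[y,z]]-[y,[x,z]]$: (L1) $([J_{x,y,z},w]+1_{[[y,z],[x,w]]}+1_{[[x,z],[y,w]]}+[z,J_{x,y,w}])\circ(J_{x,[y,z],w}+J_{x,z,[y,w]})\circ[x,J_{y,z,w}]=(1_{[[[x,y],z],w]}+1_{[z,[[x,y],w]]}+J_{y,[x,z],w}+J_{y,z,[x,w]})\circ(J_{[x,y],z,w}+[y,J_{x,z,w}])\circ J_{x,y,[z,w]}$; (L2) $(-\hat J_{y,x,z})\circ[S_{x,y},z]=\hat J_{x,y,z}$; (L3) $(-J_{x,z,y})\circ[x,S_{y,z}]=(S_{[x,y],z}+S_{y,[x,z]})\circ J_{x,y,z}$; (L4) $(-S_{[y,z],x})\circ S_{x,[y,z]}=1_{[x,[y,z]]}$. A morphism $(F,F^2):L\to L'$ is a linear functor $F$ with a linear natural transformation $F^2_{x,y}:[F(x),F(y)]'\to F([x,y])$ such that $F(S_{x,y})\circ F^2_{x,y}=(-F^2_{y,x})\circ S'_{F(x),F(y)}$ and $F(J_{x,y,z})\circ F^2_{x,[y,z]}\circ[F(x),F^2_{y,z}]'=(F^2_{[x,y],z}+F^2_{y,[x,z]})\circ([F^2_{x,y},F(z)]'+[F(y),F^2_{x,z}]')\circ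 J'_{F(x),F(y),F(z)}$. The composite of $(F,F^2):L\to L'$ and $(G,G^2):L'\to L''$ is $(GF,(GF)^2)$ with $(GF)^2_{x,y}=G(F^2_{x,y})\circ G^2_{F(x),F(y)}$. A 2-morphism $\Theta:(F,F^2)\Rightarrow(G,G^2)$ is a linear natural transformation $\Theta:F\Rightarrow G$ with $\Theta_{[x,y]}\circ F^2_{x,y}=G^2_{x,y}\circ[\Theta_x,\Theta_y]'$. Horizontal and vertical composites of 2-morphisms are those of natural transformations. **2-term $EL_\infty$-algebras.** A 2-term $EL_\infty$-algebra is a 2-term complex $C$ with: - a chain map $[\cdot,\cdot]:C\otimes C\to C$, i.e. bilinear maps $C^0\times C^0\to C^0$, $C^0\times C^{-1}\to C^{-1}$, $C^{-1}\times C^0\to C^{-1}$ with $d[x,b]=[x,db]$, $d[a,y]=[da,y]$, $[da,b]=[a,db]$; - a bilinear $\langle\cdot,\cdot\rangle:C^0\otimes C^0\to C^{-1}$ with $[x,y]+[y,x]=d\langle x,y\rangle$, $[a,y]+[y,a]=\langle da,y\rangle$, $[x,b]+[b,x]=\langle x,db\rangle$; - a trilinear $\langle\cdot,\cdot,\cdot\rangle:(C^0)^{\otimes3}\to C^{-1}$ such that $[u,[v,w]]-[[u,v],w]-[v,[u,w]]$ equals $d\langle u,v,w\rangle$ if $u,v,w\in C^0$, and equals $\langle du,v,w\rangle$, $\langle u,dv,w\rangle$, $\langle u,v,dw\rangle$ respectively if exactly $u$, exactly $v$, exactly $w$ lies in $C^{-1}$ (the others in $C^0$); such that for all $x,y,z,w\in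 C^0$: (E1) $[x,\langle y,z,w\rangle]+\langle x,[y,z],w\rangle+\langle x,z,[y,w]\rangle+[\langle x,y,z\rangle,w]+[z,\langle x,y,w\rangle]=\langle x,y,[z,w]\rangle+\langle[x,y],z,w\rangle+[y,\langle x,z,w\rangle]+\langle y,[x,z],w\rangle+\langle y,z,[x,w]\rangle$; (E2) $\langle x,y,z\rangle+\langle y,x,z\rangle=-[\langle x,y\rangle,z]$; (E3) $\langle x,y,z\rangle+\langle x,z,y\rangle=[x,\langle y,z\rangle]-\langle[x,y],z\rangle-\langle y,[x,z]\rangle$; (E4) $\langle x,[y,z]\rangle=\langle[y,z],x\rangle$. For $a,b\in C^{-1}$ the derived bracket is $[a,b]:=[da,b]=[a,db]$. A morphism $(f,f^2):C\to C'$ is a chain map $f=(f^0,f^1)$ ($f^0$ in degree $0$, $f^1$ in degree $-1$) with a bilinear $f^2:C^0\otimes C^0\to C'^{-1}$ satisfying $[f^0(x),f^0(y)]'-f^0([x,y])=d'f^2(x,y)$, $[f^1(a),f^0(y)]'-f^1([a,y])=f^2(da,y)$, $[f^0(x),f^1(b)]'-f^1([x,b])=f^2(x,db)$, and $\langle f^0(x),f^0(y)\rangle'-f^1(\langle x,y\rangle)=f^2(x,y)+f^2(y,x)$, $\langle f^0(x),f^0(y),f^0(z)\rangle'-f^1(\langle x,y,z\rangle)=[f^0(x),f^2(y,z)]'-[f^0(y),f^2(x,z)]'-[f^2(x,y),f^0(z)]'-f^2([x,y],z)-f^2(y,[x,z])+f^2(x,[y,z])$. The composite of $(f,f^2)$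 and $(g,g^2)$ is $(gf,(g*f)^2)$ with $(g*f)^2(x,y)=g^2(f^0(x),f^0(y))+g^1(f^2(x,y))$. A 2-morphism $\theta:(f,f^2)\Rightarrow(g,g^2)$ is a chain homotopy, i.e. a linear $\theta:C^0\to C'^{-1}$ with $f^0-g^0=d'\theta$, $f^1-g^1=\theta d$, such that $f^2(x,y)-g^2(x,y)=[f^0(x),\theta(y)]'+[\theta(x),f^0(y)]'-\theta([x,y])-[\theta(x),\theta(y)]'$ (last term the derived bracket). Compositions of 2-morphisms are the usual ones of chain homotopies (vertical: addition; horizontal of $\theta:f\Rightarrow f'$ and $\psi:g\Rightarrow g'$: $g^1\theta+\psi f'^0$). **The induced 2-functors.** Given $(L,[\cdot,\cdot],S,J)$, $N(L)$ carries the bracket $[(x,a),(y,b)]=([x,y],[x,b]+[a,y])$, with $\langle\cdot,\cdot\rangle$ and $\langle\cdot,\cdot,\cdot\rangle$ defined by $S_{x,y}=([x,y],-\langle x,y\rangle)$ and $J_{x,y,z}=([x,[y,z]],-\langle x,y,z\rangle)$. A morphism $(F,F^2)$ goes to $f=N(F)$ (restriction of $F$ to objects and to $\ker s$) with $F^2_{x,y}=([F(x),F(y)]',-f^2(x,y))$, and $\Theta$ goes to $\theta$ with $\Theta_x=(F(x),-\theta(x))$. Conversely, $\Gamma(C)$ carries the bracket $[(x,a),(y,b)]=([x,y],[x,b]+[a,y]+[a,b])$ with $[a,b]$ the derived bracket, and $S,J$, and the images of morphisms and 2-morphisms, are given by the same formulas. *)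

theory Defs
  imports "HOL-Algebra.Module"
begin

section \<open>Strict 2-categories, 2-functors and equivalences\<close>

text \<open>\<open>Src\<close> and \<open>Trg\<close> are the source and target 1-cells of a 2-cell, \<open>Dom\<close> and \<open>Cod\<close> the source and
  target objects of a 1-cell. Composites are written in the order of functions: \<open>comp1 C g f\<close> is
  \<open>f\<close> followed by \<open>g\<close>, and likewise for \<open>vcomp\<close> and \<open>hcomp\<close>.\<close>

record ('o, 'm, 'c) two_cat =
  Ob :: "'o set"
  Mor :: "'m set"
  Cell :: "'c set"
  Dom :: "'m \<Rightarrow> 'o"
  Cod :: "'m \<Rightarrow> 'o"
  Src :: "'c \<Rightarrow> 'm"
  Trg :: "'c \<Rightarrow> 'm"
  id1 :: "'o \<Rightarrow> 'm"
  comp1 :: "'m \<Rightarrow> 'm \<Rightarrow> 'm"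
  id2 :: "'m \<Rightarrow> 'c"
  vcomp :: "'c \<Rightarrow> 'c \<Rightarrow> 'c"
  hcomp :: "'c \<Rightarrow> 'c \<Rightarrow> 'c"

locale two_category =
  fixes C :: "('o, 'm, 'c) two_cat"
  assumes Dom_Ob: "f \<in> Mor C \<Longrightarrow> Dom C f \<in> Ob C"
    and Cod_Ob: "f \<in> Mor C \<Longrightarrow> Cod C f \<in> Ob C"
    and id1_Mor: "A \<in> Ob C \<Longrightarrow> id1 C A \<in> Mor C"
    and Dom_id1: "A \<in> Ob C \<Longrightarrow> Dom C (id1 C A) = A"
    and Cod_id1: "A \<in> Ob C \<Longrightarrow> Cod C (id1 C A) = A"
    and comp1_Mor: "\<lbrakk>f \<in> Mor C; g \<in> Mor C; Cod C f = Dom C g\<rbrakk> \<Longrightarrow> comp1 C g f \<in> Mor C"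
    and Dom_comp1: "\<lbrakk>f \<in> Mor C; g \<in> Mor C; Cod C f = Dom C g\<rbrakk> \<Longrightarrow> Dom C (comp1 C g f) = Dom C f"
    and Cod_comp1: "\<lbrakk>f \<in> Mor C; g \<in> Mor C; Cod C f = Dom C g\<rbrakk> \<Longrightarrow> Cod C (comp1 C g f) = Cod C g"
    and comp1_id_right: "f \<in> Mor C \<Longrightarrow> comp1 C f (id1 C (Dom C f)) = f"
    and comp1_id_left: "f \<in> Mor C \<Longrightarrow> comp1 C (id1 C (Cod C f)) f = f"
    and comp1_assoc: "\<lbrakk>f \<in> Mor C; g \<in> Mor C; h \<in> Mor C; Cod C f = Dom C g; Cod C g = Dom C h\<rbrakk>
      \<Longrightarrow> comp1 C h (comp1 C g f) = comp1 C (comp1 C h g) f"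
    and Src_Mor: "\<alpha> \<in> Cell C \<Longrightarrow> Src C \<alpha> \<in> Mor C"
    and Trg_Mor: "\<alpha> \<in> Cell C \<Longrightarrow> Trg C \<alpha> \<in> Mor C"
    and Dom_parallel: "\<alpha> \<in> Cell C \<Longrightarrow> Dom C (Trg C \<alpha>) = Dom C (Src C \<alpha>)"
    and Cod_parallel: "\<alpha> \<in> Cell C \<Longrightarrow> Cod C (Trg C \<alpha>) = Cod C (Src C \<alpha>)"
    and id2_Cell: "f \<in> Mor C \<Longrightarrow> id2 C f \<in> Cell C"
    and Src_id2: "f \<in> Mor C \<Longrightarrow> Src C (id2 C f) = f"
    and Trg_id2: "f \<in> Mor C \<Longrightarrow> Trg C (id2 C f) = f"
    and vcomp_Cell: "\<lbrakk>\<alpha> \<in> Cell C; \<beta> \<in> Cell C; Trg C \<alpha> = Src C \<beta>\<rbrakk> \<Longrightarrow> vcomp C \<beta> \<alpha> \<in> Cell C"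
    and Src_vcomp: "\<lbrakk>\<alpha> \<in> Cell C; \<beta> \<in> Cell C; Trg C \<alpha> = Src C \<beta>\<rbrakk> \<Longrightarrow> Src C (vcomp C \<beta> \<alpha>) = Src C \<alpha>"
    and Trg_vcomp: "\<lbrakk>\<alpha> \<in> Cell C; \<beta> \<in> Cell C; Trg C \<alpha> = Src C \<beta>\<rbrakk> \<Longrightarrow> Trg C (vcomp C \<beta> \<alpha>) = Trg C \<beta>"
    and vcomp_id_right: "\<alpha> \<in> Cell C \<Longrightarrow> vcomp C \<alpha> (id2 C (Src C \<alpha>)) = \<alpha>"
    and vcomp_id_left: "\<alpha> \<in> Cell C \<Longrightarrow> vcomp C (id2 C (Trg C \<alpha>)) \<alpha> = \<alpha>"
    and vcomp_assoc: "\<lbrakk>\<alpha> \<in> Cell C; \<beta> \<in> Cell C; \<gamma> \<in> Cell C; Trg C \<alpha> = Src C \<beta>; Trg C \<beta> = Src C \<gamma>\<rbrakk>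
      \<Longrightarrow> vcomp C \<gamma> (vcomp C \<beta> \<alpha>) = vcomp C (vcomp C \<gamma> \<beta>) \<alpha>"
    and hcomp_Cell: "\<lbrakk>\<alpha> \<in> Cell C; \<beta> \<in> Cell C; Cod C (Src C \<alpha>) = Dom C (Src C \<beta>)\<rbrakk>
      \<Longrightarrow> hcomp C \<beta> \<alpha> \<in> Cell C"
    and Src_hcomp: "\<lbrakk>\<alpha> \<in> Cell C; \<beta> \<in> Cell C; Cod C (Src C \<alpha>) = Dom C (Src C \<beta>)\<rbrakk>
      \<Longrightarrow> Src C (hcomp C \<beta> \<alpha>) = comp1 C (Src C \<beta>) (Src C \<alpha>)"
    and Trg_hcomp: "\<lbrakk>\<alpha> \<in> Cell C; \<beta> \<in> Cell C; Cod C (Src C \<alpha>) = Dom C (Src C \<beta>)\<rbrakk>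
      \<Longrightarrow> Trg C (hcomp C \<beta> \<alpha>) = comp1 C (Trg C \<beta>) (Trg C \<alpha>)"
    and hcomp_id_right: "\<alpha> \<in> Cell C \<Longrightarrow> hcomp C \<alpha> (id2 C (id1 C (Dom C (Src C \<alpha>)))) = \<alpha>"
    and hcomp_id_left: "\<alpha> \<in> Cell C \<Longrightarrow> hcomp C (id2 C (id1 C (Cod C (Src C \<alpha>)))) \<alpha> = \<alpha>"
    and hcomp_assoc: "\<lbrakk>\<alpha> \<in> Cell C; \<beta> \<in> Cell C; \<gamma> \<in> Cell C;
        Cod C (Src C \<alpha>) = Dom C (Src C \<beta>); Cod C (Src C \<beta>) = Dom C (Src C \<gamma>)\<rbrakk>
      \<Longrightarrow> hcomp C \<gamma> (hcomp C \<beta> \<alpha>) = hcomp C (hcomp C \<gamma> \<beta>) \<alpha>"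
    and hcomp_id2: "\<lbrakk>f \<in> Mor C; g \<in> Mor C; Cod C f = Dom C g\<rbrakk>
      \<Longrightarrow> hcomp C (id2 C g) (id2 C f) = id2 C (comp1 C g f)"
    and interchange: "\<lbrakk>\<alpha> \<in> Cell C; \<alpha>' \<in> Cell C; \<beta> \<in> Cell C; \<beta>' \<in> Cell C;
        Trg C \<alpha> = Src C \<alpha>'; Trg C \<beta> = Src C \<beta>'; Cod C (Src C \<alpha>) = Dom C (Src C \<beta>)\<rbrakk>
      \<Longrightarrow> hcomp C (vcomp C \<beta>' \<beta>) (vcomp C \<alpha>' \<alpha>) = vcomp C (hcomp C \<beta>' \<alpha>') (hcomp C \<beta> \<alpha>)"

record ('o, 'm, 'c, 'p, 'n, 'd) two_fun =
  on_ob :: "'o \<Rightarrow> 'p"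
  on_mor :: "'m \<Rightarrow> 'n"
  on_cell :: "'c \<Rightarrow> 'd"

locale two_functor = C: two_category C + D: two_category D
  for C :: "('o, 'm, 'c) two_cat" and D :: "('p, 'n, 'd) two_cat" +
  fixes F :: "('o, 'm, 'c, 'p, 'n, 'd) two_fun"
  assumes on_ob: "A \<in> Ob C \<Longrightarrow> on_ob F A \<in> Ob D"
    and on_mor: "f \<in> Mor C \<Longrightarrow> on_mor F f \<in> Mor D"
    and on_cell: "\<alpha> \<in> Cell C \<Longrightarrow> on_cell F \<alpha> \<in> Cell D"
    and Dom_on_mor: "f \<in> Mor C \<Longrightarrow> Dom D (on_mor F f) = on_ob F (Dom C f)"
    and Cod_on_mor: "f \<in> Mor C \<Longrightarrow> Cod D (on_mor F f) = on_ob F (Cod C f)"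
    and Src_on_cell: "\<alpha> \<in> Cell C \<Longrightarrow> Src D (on_cell F \<alpha>) = on_mor F (Src C \<alpha>)"
    and Trg_on_cell: "\<alpha> \<in> Cell C \<Longrightarrow> Trg D (on_cell F \<alpha>) = on_mor F (Trg C \<alpha>)"
    and on_id1: "A \<in> Ob C \<Longrightarrow> on_mor F (id1 C A) = id1 D (on_ob F A)"
    and on_comp1: "\<lbrakk>f \<in> Mor C; g \<in> Mor C; Cod C f = Dom C g\<rbrakk>
      \<Longrightarrow> on_mor F (comp1 C g f) = comp1 D (on_mor F g) (on_mor F f)"
    and on_id2: "f \<in> Mor C \<Longrightarrow> on_cell F (id2 C f) = id2 D (on_mor F f)"
    and on_vcomp: "\<lbrakk>\<alpha> \<in> Cell C; \<beta> \<in> Cell C; Trg C \<alpha> = Src C \<beta>\<rbrakk>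
      \<Longrightarrow> on_cell F (vcomp C \<beta> \<alpha>) = vcomp D (on_cell F \<beta>) (on_cell F \<alpha>)"
    and on_hcomp: "\<lbrakk>\<alpha> \<in> Cell C; \<beta> \<in> Cell C; Cod C (Src C \<alpha>) = Dom C (Src C \<beta>)\<rbrakk>
      \<Longrightarrow> on_cell F (hcomp C \<beta> \<alpha>) = hcomp D (on_cell F \<beta>) (on_cell F \<alpha>)"

definition two_fun_id :: "('o, 'm, 'c, 'o, 'm, 'c) two_fun" where
  "two_fun_id = \<lparr>on_ob = (\<lambda>A. A), on_mor = (\<lambda>f. f), on_cell = (\<lambda>\<alpha>. \<alpha>)\<rparr>"

definition two_fun_comp ::
  "('p, 'n, 'd, 'q, 'l, 'e) two_fun \<Rightarrow> ('o, 'm, 'c, 'p, 'n, 'd) two_fun \<Rightarrow> ('o, 'm, 'c, 'q, 'l, 'e) two_fun"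
  where
  "two_fun_comp G F = \<lparr>on_ob = (\<lambda>A. on_ob G (on_ob F A)), on_mor = (\<lambda>f. on_mor G (on_mor F f)),
     on_cell = (\<lambda>\<alpha>. on_cell G (on_cell F \<alpha>))\<rparr>"

locale two_natural = F: two_functor C D F + G: two_functor C D G
  for C :: "('o, 'm, 'c) two_cat" and D :: "('p, 'n, 'd) two_cat"
    and F G :: "('o, 'm, 'c, 'p, 'n, 'd) two_fun" +
  fixes \<eta> :: "'o \<Rightarrow> 'n"
  assumes component: "A \<in> Ob C \<Longrightarrow> \<eta> A \<in> Mor D"
    and Dom_component: "A \<in> Ob C \<Longrightarrow> Dom D (\<eta> A) = on_ob F A"
    and Cod_component: "A \<in> Ob C \<Longrightarrow> Cod D (\<eta> A) = on_ob G A"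
    and natural1: "f \<in> Mor C
      \<Longrightarrow> comp1 D (\<eta> (Cod C f)) (on_mor F f) = comp1 D (on_mor G f) (\<eta> (Dom C f))"
    and natural2: "\<alpha> \<in> Cell C
      \<Longrightarrow> hcomp D (id2 D (\<eta> (Cod C (Src C \<alpha>)))) (on_cell F \<alpha>)
        = hcomp D (on_cell G \<alpha>) (id2 D (\<eta> (Dom C (Src C \<alpha>))))"

definition iso1 :: "('o, 'm, 'c) two_cat \<Rightarrow> 'm \<Rightarrow> bool" where
  "iso1 C f \<longleftrightarrow> f \<in> Mor C \<and> (\<exists>g \<in> Mor C. Dom C g = Cod C f \<and> Cod C g = Dom C f
     \<and> comp1 C g f = id1 C (Dom C f) \<and> comp1 C f g = id1 C (Cod C f))"

definition two_natural_iso ::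
  "('o, 'm, 'c) two_cat \<Rightarrow> ('p, 'n, 'd) two_cat \<Rightarrow> ('o, 'm, 'c, 'p, 'n, 'd) two_fun
    \<Rightarrow> ('o, 'm, 'c, 'p, 'n, 'd) two_fun \<Rightarrow> ('o \<Rightarrow> 'n) \<Rightarrow> bool" where
  "two_natural_iso C D F G \<eta> \<longleftrightarrow> two_natural C D F G \<eta> \<and> (\<forall>A \<in> Ob C. iso1 D (\<eta> A))"

text \<open>The strict (hence strongest) notion of equivalence of 2-categories: mutually quasi-inverse
  2-functors, with the unit and counit 2-natural isomorphisms.\<close>

definition two_equivalence ::
  "('o, 'm, 'c) two_cat \<Rightarrow> ('p, 'n, 'd) two_cat \<Rightarrow> ('o, 'm, 'c, 'p, 'n, 'd) two_fun
    \<Rightarrow> ('p, 'n, 'd, 'o, 'm, 'c) two_fun \<Rightarrow> bool" where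
  "two_equivalence C D F G \<longleftrightarrow> two_functor C D F \<and> two_functor D C G
     \<and> (\<exists>\<eta>. two_natural_iso C C two_fun_id (two_fun_comp G F) \<eta>)
     \<and> (\<exists>\<epsilon>. two_natural_iso D D (two_fun_comp F G) two_fun_id \<epsilon>)"


section \<open>Multilinear maps\<close>

definition linear_map ::
  "('k, 'r) ring_scheme \<Rightarrow> ('k, 'a) module \<Rightarrow> ('k, 'b) module \<Rightarrow> ('a \<Rightarrow> 'b) \<Rightarrow> bool" where
  "linear_map K V W f \<longleftrightarrow> f \<in> carrier V \<rightarrow> carrier W
     \<and> (\<forall>x \<in> carrier V. \<forall>y \<in> carrier V. f (x \<oplus>\<^bsub>V\<^esub> y) = f x \<oplus>\<^bsub>W\<^esub> f y)
     \<and> (\<forall>c \<in> carrier K. \<forall>x \<in> carrier V. f (c \<odot>\<^bsub>V\<^esub> x) = c \<odot>\<^bsub>W\<^esub> f x)"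

definition bilinear_map ::
  "('k, 'r) ring_scheme \<Rightarrow> ('k, 'a) module \<Rightarrow> ('k, 'b) module \<Rightarrow> ('k, 'c) module
    \<Rightarrow> ('a \<Rightarrow> 'b \<Rightarrow> 'c) \<Rightarrow> bool" where
  "bilinear_map K U V W f \<longleftrightarrow> (\<forall>x \<in> carrier U. linear_map K V W (f x))
     \<and> (\<forall>y \<in> carrier V. linear_map K U W (\<lambda>x. f x y))"

definition trilinear_map ::
  "('k, 'r) ring_scheme \<Rightarrow> ('k, 'a) module \<Rightarrow> ('k, 'b) module \<Rightarrow> ('k, 'c) module \<Rightarrow> ('k, 'd) module
    \<Rightarrow> ('a \<Rightarrow> 'b \<Rightarrow> 'c \<Rightarrow> 'd) \<Rightarrow> bool" where
  "trilinear_map K T U V W f \<longleftrightarrow> (\<forall>x \<in> carrier T. bilinear_map K U V W (f x))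
     \<and> (\<forall>y \<in> carrier U. \<forall>z \<in> carrier V. linear_map K T W (\<lambda>x. f x y z))"

text \<open>1- and 2-cells are compared by equality, so the functions they consist of are normalised to
  \<^const>\<open>undefined\<close> outside their domains, as in \<^const>\<open>extensional\<close> and \<^const>\<open>restrict\<close>.\<close>

definition extensional2 :: "'a set \<Rightarrow> ('a \<Rightarrow> 'a \<Rightarrow> 'b) set" where
  "extensional2 A = {f. \<forall>x y. \<not> (x \<in> A \<and> y \<in> A) \<longrightarrow> f x y = undefined}"

definition restrict2 :: "('a \<Rightarrow> 'a \<Rightarrow> 'b) \<Rightarrow> 'a set \<Rightarrow> 'a \<Rightarrow> 'a \<Rightarrow> 'b" where
  "restrict2 f A = (\<lambda>x y. if x \<in> A \<and> y \<in> A then f x y else undefined)"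


section \<open>Linear categories\<close>

text \<open>A vector space is a \<^const>\<open>module\<close> over a field; the multiplicative fields of the record are
  not used. \<open>ob V\<close> and \<open>ar V\<close> are the spaces of objects and of arrows, \<open>src\<close>, \<open>tgt\<close>, \<open>\<iota>\<close>
  are source, target and identity, and \<open>g \<bullet> f\<close> is \<open>f\<close> followed by \<open>g\<close>.\<close>

record ('k, 'v) lincat =
  ob :: "('k, 'v) module"
  ar :: "('k, 'v) module"
  src :: "'v \<Rightarrow> 'v"
  tgt :: "'v \<Rightarrow> 'v"
  ident :: "'v \<Rightarrow> 'v" (\<open>\<iota>\<index>\<close>)
  cmp :: "'v \<Rightarrow> 'v \<Rightarrow> 'v" (infixl \<open>\<bullet>\<index>\<close> 68)

definition is_arrow :: "('k, 'v, 'z) lincat_scheme \<Rightarrow> 'v \<Rightarrow> 'v \<Rightarrow> 'v \<Rightarrow> bool" where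
  "is_arrow V f x y \<longleftrightarrow> f \<in> carrier (ar V) \<and> src V f = x \<and> tgt V f = y"

locale linear_category = K: field K + O: module K "ob V" + A: module K "ar V"
  for K :: "('k, 'r) ring_scheme" (structure) and V :: "('k, 'v, 'z) lincat_scheme" (structure) +
  assumes src_linear: "linear_map K (ar V) (ob V) (src V)"
    and tgt_linear: "linear_map K (ar V) (ob V) (tgt V)"
    and ident_linear: "linear_map K (ob V) (ar V) (ident V)"
    and ident_arrow: "x \<in> carrier (ob V) \<Longrightarrow> is_arrow V (\<iota>\<^bsub>V\<^esub> x) x x"
    and cmp_arrow: "\<lbrakk>is_arrow V f x y; is_arrow V g y z\<rbrakk> \<Longrightarrow> is_arrow V (g \<bullet>\<^bsub>V\<^esub> f) x z"
    and cmp_add: "\<lbrakk>is_arrow V f x y; is_arrow V g y z; is_arrow V f' x' y'; is_arrow V g' y' z'\<rbrakk>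
      \<Longrightarrow> (g \<oplus>\<^bsub>ar V\<^esub> g') \<bullet>\<^bsub>V\<^esub> (f \<oplus>\<^bsub>ar V\<^esub> f') = (g \<bullet>\<^bsub>V\<^esub> f) \<oplus>\<^bsub>ar V\<^esub> (g' \<bullet>\<^bsub>V\<^esub> f')"
    and cmp_smult: "\<lbrakk>c \<in> carrier K; is_arrow V f x y; is_arrow V g y z\<rbrakk>
      \<Longrightarrow> (c \<odot>\<^bsub>ar V\<^esub> g) \<bullet>\<^bsub>V\<^esub> (c \<odot>\<^bsub>ar V\<^esub> f) = c \<odot>\<^bsub>ar V\<^esub> (g \<bullet>\<^bsub>V\<^esub> f)"
    and cmp_ident_right: "is_arrow V f x y \<Longrightarrow> f \<bullet>\<^bsub>V\<^esub> \<iota>\<^bsub>V\<^esub> x = f"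
    and cmp_ident_left: "is_arrow V f x y \<Longrightarrow> \<iota>\<^bsub>V\<^esub> y \<bullet>\<^bsub>V\<^esub> f = f"
    and cmp_assoc: "\<lbrakk>is_arrow V f x y; is_arrow V g y z; is_arrow V h z w\<rbrakk>
      \<Longrightarrow> h \<bullet>\<^bsub>V\<^esub> (g \<bullet>\<^bsub>V\<^esub> f) = (h \<bullet>\<^bsub>V\<^esub> g) \<bullet>\<^bsub>V\<^esub> f"

definition arrow_inverse :: "('k, 'v, 'z) lincat_scheme \<Rightarrow> 'v \<Rightarrow> 'v" where
  "arrow_inverse V f = (THE g. is_arrow V g (tgt V f) (src V f)
     \<and> g \<bullet>\<^bsub>V\<^esub> f = \<iota>\<^bsub>V\<^esub> (src V f) \<and> f \<bullet>\<^bsub>V\<^esub> g = \<iota>\<^bsub>V\<^esub> (tgt V f))"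

definition linear_functor ::
  "('k, 'r) ring_scheme \<Rightarrow> ('k, 'v, 'z) lincat_scheme \<Rightarrow> ('k, 'v, 'z) lincat_scheme
    \<Rightarrow> ('v \<Rightarrow> 'v) \<Rightarrow> ('v \<Rightarrow> 'v) \<Rightarrow> bool" where
  "linear_functor K V W F0 F1 \<longleftrightarrow>
     linear_map K (ob V) (ob W) F0 \<and> linear_map K (ar V) (ar W) F1
     \<and> (\<forall>f x y. is_arrow V f x y \<longrightarrow> is_arrow W (F1 f) (F0 x) (F0 y))
     \<and> (\<forall>x \<in> carrier (ob V). F1 (\<iota>\<^bsub>V\<^esub> x) = \<iota>\<^bsub>W\<^esub> (F0 x))
     \<and> (\<forall>f g x y z. is_arrow V f x y \<and> is_arrow V g y z \<longrightarrow> F1 (g \<bullet>\<^bsub>V\<^esub> f) = F1 g \<bullet>\<^bsub>W\<^esub> F1 f)"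

text \<open>A bilinear functor is functorial in pairs of arrows, composed componentwise. This is what gives
  the derived bracket: \<open>[a, b] = [da, b] = [a, db]\<close> for \<open>a\<close>, \<open>b\<close> in the kernel of the source map.\<close>

definition bilinear_functor ::
  "('k, 'r) ring_scheme \<Rightarrow> ('k, 'v, 'z) lincat_scheme \<Rightarrow> ('k, 'v, 'z) lincat_scheme
    \<Rightarrow> ('k, 'v, 'z) lincat_scheme \<Rightarrow> ('v \<Rightarrow> 'v \<Rightarrow> 'v) \<Rightarrow> ('v \<Rightarrow> 'v \<Rightarrow> 'v) \<Rightarrow> bool" where
  "bilinear_functor K U V W B0 B1 \<longleftrightarrow>
     bilinear_map K (ob U) (ob V) (ob W) B0 \<and> bilinear_map K (ar U) (ar V) (ar W) B1
     \<and> (\<forall>f x x' g y y'. is_arrow U f x x' \<and> is_arrow V g y y'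
          \<longrightarrow> is_arrow W (B1 f g) (B0 x y) (B0 x' y'))
     \<and> (\<forall>x \<in> carrier (ob U). \<forall>y \<in> carrier (ob V). B1 (\<iota>\<^bsub>U\<^esub> x) (\<iota>\<^bsub>V\<^esub> y) = \<iota>\<^bsub>W\<^esub> (B0 x y))
     \<and> (\<forall>f x x' f' x'' g y y' g' y''.
          is_arrow U f x x' \<and> is_arrow U f' x' x'' \<and> is_arrow V g y y' \<and> is_arrow V g' y' y''
          \<longrightarrow> B1 (f' \<bullet>\<^bsub>U\<^esub> f) (g' \<bullet>\<^bsub>V\<^esub> g) = B1 f' g' \<bullet>\<^bsub>W\<^esub> B1 f g)"

text \<open>Linear, bilinear and trilinear natural transformations \<open>\<theta>\<close> from a functor with object part
  \<open>F0\<close> and arrow part \<open>F1\<close> to one with object part \<open>G0\<close> and arrow part \<open>G1\<close>.\<close>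

definition linear_transformation ::
  "('k, 'r) ring_scheme \<Rightarrow> ('k, 'v, 'z) lincat_scheme \<Rightarrow> ('k, 'v, 'z) lincat_scheme
    \<Rightarrow> ('v \<Rightarrow> 'v) \<Rightarrow> ('v \<Rightarrow> 'v) \<Rightarrow> ('v \<Rightarrow> 'v) \<Rightarrow> ('v \<Rightarrow> 'v) \<Rightarrow> ('v \<Rightarrow> 'v) \<Rightarrow> bool" where
  "linear_transformation K V W F0 F1 G0 G1 \<theta> \<longleftrightarrow>
     linear_map K (ob V) (ar W) \<theta>
     \<and> (\<forall>x \<in> carrier (ob V). is_arrow W (\<theta> x) (F0 x) (G0 x))
     \<and> (\<forall>f x x'. is_arrow V f x x' \<longrightarrow> G1 f \<bullet>\<^bsub>W\<^esub> \<theta> x = \<theta> x' \<bullet>\<^bsub>W\<^esub> F1 f)"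

definition bilinear_transformation ::
  "('k, 'r) ring_scheme \<Rightarrow> ('k, 'v, 'z) lincat_scheme \<Rightarrow> ('k, 'v, 'z) lincat_scheme
    \<Rightarrow> ('v \<Rightarrow> 'v \<Rightarrow> 'v) \<Rightarrow> ('v \<Rightarrow> 'v \<Rightarrow> 'v) \<Rightarrow> ('v \<Rightarrow> 'v \<Rightarrow> 'v) \<Rightarrow> ('v \<Rightarrow> 'v \<Rightarrow> 'v)
    \<Rightarrow> ('v \<Rightarrow> 'v \<Rightarrow> 'v) \<Rightarrow> bool" where
  "bilinear_transformation K V W F0 F1 G0 G1 \<theta> \<longleftrightarrow>
     bilinear_map K (ob V) (ob V) (ar W) \<theta>
     \<and> (\<forall>x \<in> carrier (ob V). \<forall>y \<in> carrier (ob V). is_arrow W (\<theta> x y) (F0 x y) (G0 x y))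
     \<and> (\<forall>f x x' g y y'. is_arrow V f x x' \<and> is_arrow V g y y'
          \<longrightarrow> G1 f g \<bullet>\<^bsub>W\<^esub> \<theta> x y = \<theta> x' y' \<bullet>\<^bsub>W\<^esub> F1 f g)"

definition trilinear_transformation ::
  "('k, 'r) ring_scheme \<Rightarrow> ('k, 'v, 'z) lincat_scheme \<Rightarrow> ('k, 'v, 'z) lincat_scheme
    \<Rightarrow> ('v \<Rightarrow> 'v \<Rightarrow> 'v \<Rightarrow> 'v) \<Rightarrow> ('v \<Rightarrow> 'v \<Rightarrow> 'v \<Rightarrow> 'v) \<Rightarrow> ('v \<Rightarrow> 'v \<Rightarrow> 'v \<Rightarrow> 'v)
    \<Rightarrow> ('v \<Rightarrow> 'v \<Rightarrow> 'v \<Rightarrow> 'v) \<Rightarrow> ('v \<Rightarrow> 'v \<Rightarrow> 'v \<Rightarrow> 'v) \<Rightarrow> bool" where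
  "trilinear_transformation K V W F0 F1 G0 G1 \<theta> \<longleftrightarrow>
     trilinear_map K (ob V) (ob V) (ob V) (ar W) \<theta>
     \<and> (\<forall>x \<in> carrier (ob V). \<forall>y \<in> carrier (ob V). \<forall>z \<in> carrier (ob V).
          is_arrow W (\<theta> x y z) (F0 x y z) (G0 x y z))
     \<and> (\<forall>f x x' g y y' h z z'. is_arrow V f x x' \<and> is_arrow V g y y' \<and> is_arrow V h z z'
          \<longrightarrow> G1 f g h \<bullet>\<^bsub>W\<^esub> \<theta> x y z = \<theta> x' y' z' \<bullet>\<^bsub>W\<^esub> F1 f g h)"


section \<open>Lie 2-algebras\<close>

text \<open>The bracket functor is \<open>\<lbrace>x, y\<rbrace>\<close> on objects and \<open>\<lbrace>f, g\<rbrace>\<^sub>1\<close> on arrows; \<open>\<S>\<close> is the alternator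
  and \<open>\<J>\<close> the Jacobiator.\<close>

record ('k, 'v) lie2 = "('k, 'v) lincat" +
  br0 :: "'v \<Rightarrow> 'v \<Rightarrow> 'v" (\<open>\<lbrace>_,/ _\<rbrace>\<index>\<close>)
  br1 :: "'v \<Rightarrow> 'v \<Rightarrow> 'v" (\<open>\<lbrace>_,/ _\<rbrace>\<^sub>1\<index>\<close>)
  alternator :: "'v \<Rightarrow> 'v \<Rightarrow> 'v" (\<open>\<S>\<index>\<close>)
  jacobiator :: "'v \<Rightarrow> 'v \<Rightarrow> 'v \<Rightarrow> 'v" (\<open>\<J>\<index>\<close>)

definition jacobiator_hat :: "('k, 'v) lie2 \<Rightarrow> 'v \<Rightarrow> 'v \<Rightarrow> 'v \<Rightarrow> 'v" where
  "jacobiator_hat L x y z =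
     arrow_inverse L (\<J>\<^bsub>L\<^esub> x y z) \<ominus>\<^bsub>ar L\<^esub> \<iota>\<^bsub>L\<^esub> \<lbrace>y, \<lbrace>x, z\<rbrace>\<^bsub>L\<^esub>\<rbrace>\<^bsub>L\<^esub>"

locale lie2_algebra = linear_category K L
  for K :: "('k, 'r) ring_scheme" and L :: "('k, 'v) lie2" (structure) +
  assumes bracket: "bilinear_functor K L L L (br0 L) (br1 L)"
    and alternator: "bilinear_transformation K L L
      (\<lambda>x y. \<lbrace>x, y\<rbrace>) (\<lambda>f g. \<lbrace>f, g\<rbrace>\<^sub>1)
      (\<lambda>x y. \<ominus>\<^bsub>ob L\<^esub> \<lbrace>y, x\<rbrace>) (\<lambda>f g. \<ominus>\<^bsub>ar L\<^esub> \<lbrace>g, f\<rbrace>\<^sub>1) \<S>"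
    and jacobiator: "trilinear_transformation K L L
      (\<lambda>x y z. \<lbrace>x, \<lbrace>y, z\<rbrace>\<rbrace>) (\<lambda>f g h. \<lbrace>f, \<lbrace>g, h\<rbrace>\<^sub>1\<rbrace>\<^sub>1)
      (\<lambda>x y z. \<lbrace>\<lbrace>x, y\<rbrace>, z\<rbrace> \<oplus>\<^bsub>ob L\<^esub> \<lbrace>y, \<lbrace>x, z\<rbrace>\<rbrace>)
      (\<lambda>f g h. \<lbrace>\<lbrace>f, g\<rbrace>\<^sub>1, h\<rbrace>\<^sub>1 \<oplus>\<^bsub>ar L\<^esub> \<lbrace>g, \<lbrace>f, h\<rbrace>\<^sub>1\<rbrace>\<^sub>1) \<J>"
    and L1: "\<lbrakk>x \<in> carrier (ob L); y \<in> carrier (ob L); z \<in> carrier (ob L); w \<in> carrier (ob L)\<rbrakk> \<Longrightarrow>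
      (\<lbrace>\<J> x y z, \<iota> w\<rbrace>\<^sub>1 \<oplus>\<^bsub>ar L\<^esub> \<iota> \<lbrace>\<lbrace>y, z\<rbrace>, \<lbrace>x, w\<rbrace>\<rbrace> \<oplus>\<^bsub>ar L\<^esub> \<iota> \<lbrace>\<lbrace>x, z\<rbrace>, \<lbrace>y, w\<rbrace>\<rbrace>
          \<oplus>\<^bsub>ar L\<^esub> \<lbrace>\<iota> z, \<J> x y w\<rbrace>\<^sub>1)
        \<bullet> (\<J> x \<lbrace>y, z\<rbrace> w \<oplus>\<^bsub>ar L\<^esub> \<J> x z \<lbrace>y, w\<rbrace>)
        \<bullet> \<lbrace>\<iota> x, \<J> y z w\<rbrace>\<^sub>1
      = (\<iota> \<lbrace>\<lbrace>\<lbrace>x, y\<rbrace>, z\<rbrace>, w\<rbrace> \<oplus>\<^bsub>ar L\<^esub> \<iota> \<lbrace>z, \<lbrace>\<lbrace>x, y\<rbrace>, w\<rbrace>\<rbrace> \<oplus>\<^bsub>ar L\<^esub> \<J> y \<lbrace>x, z\<rbrace> w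
          \<oplus>\<^bsub>ar L\<^esub> \<J> y z \<lbrace>x, w\<rbrace>)
        \<bullet> (\<J> \<lbrace>x, y\<rbrace> z w \<oplus>\<^bsub>ar L\<^esub> \<lbrace>\<iota> y, \<J> x z w\<rbrace>\<^sub>1)
        \<bullet> \<J> x y \<lbrace>z, w\<rbrace>"
    and L2: "\<lbrakk>x \<in> carrier (ob L); y \<in> carrier (ob L); z \<in> carrier (ob L)\<rbrakk> \<Longrightarrow>
      (\<ominus>\<^bsub>ar L\<^esub> (jacobiator_hat L y x z)) \<bullet> \<lbrace>\<S> x y, \<iota> z\<rbrace>\<^sub>1 = jacobiator_hat L x y z"
    and L3: "\<lbrakk>x \<in> carrier (ob L); y \<in> carrier (ob L); z \<in> carrier (ob L)\<rbrakk> \<Longrightarrow>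
      (\<ominus>\<^bsub>ar L\<^esub> (\<J> x z y)) \<bullet> \<lbrace>\<iota> x, \<S> y z\<rbrace>\<^sub>1 = (\<S> \<lbrace>x, y\<rbrace> z \<oplus>\<^bsub>ar L\<^esub> \<S> y \<lbrace>x, z\<rbrace>) \<bullet> \<J> x y z"
    and L4: "\<lbrakk>x \<in> carrier (ob L); y \<in> carrier (ob L); z \<in> carrier (ob L)\<rbrakk> \<Longrightarrow>
      (\<ominus>\<^bsub>ar L\<^esub> (\<S> \<lbrace>y, z\<rbrace> x)) \<bullet> \<S> x \<lbrace>y, z\<rbrace> = \<iota> \<lbrace>x, \<lbrace>y, z\<rbrace>\<rbrace>"

locale lie2_hom = dom: lie2_algebra K L + cod: lie2_algebra K L'
  for K :: "('k, 'r) ring_scheme" and L L' :: "('k, 'v) lie2" +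
  fixes F0 F1 :: "'v \<Rightarrow> 'v" and F2 :: "'v \<Rightarrow> 'v \<Rightarrow> 'v"
  assumes extensional:
      "F0 \<in> extensional (carrier (ob L))" "F1 \<in> extensional (carrier (ar L))"
      "F2 \<in> extensional2 (carrier (ob L))"
    and linear_functor: "linear_functor K L L' F0 F1"
    and transformation: "bilinear_transformation K L L'
      (\<lambda>x y. \<lbrace>F0 x, F0 y\<rbrace>\<^bsub>L'\<^esub>) (\<lambda>f g. \<lbrace>F1 f, F1 g\<rbrace>\<^sub>1\<^bsub>L'\<^esub>)
      (\<lambda>x y. F0 \<lbrace>x, y\<rbrace>\<^bsub>L\<^esub>) (\<lambda>f g. F1 \<lbrace>f, g\<rbrace>\<^sub>1\<^bsub>L\<^esub>) F2"
    and alternator: "\<lbrakk>x \<in> carrier (ob L); y \<in> carrier (ob L)\<rbrakk> \<Longrightarrow>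
      F1 (\<S>\<^bsub>L\<^esub> x y) \<bullet>\<^bsub>L'\<^esub> F2 x y = (\<ominus>\<^bsub>ar L'\<^esub> (F2 y x)) \<bullet>\<^bsub>L'\<^esub> \<S>\<^bsub>L'\<^esub> (F0 x) (F0 y)"
    and jacobiator: "\<lbrakk>x \<in> carrier (ob L); y \<in> carrier (ob L); z \<in> carrier (ob L)\<rbrakk> \<Longrightarrow>
      F1 (\<J>\<^bsub>L\<^esub> x y z) \<bullet>\<^bsub>L'\<^esub> F2 x \<lbrace>y, z\<rbrace>\<^bsub>L\<^esub> \<bullet>\<^bsub>L'\<^esub> \<lbrace>\<iota>\<^bsub>L'\<^esub> (F0 x), F2 y z\<rbrace>\<^sub>1\<^bsub>L'\<^esub>
      = (F2 \<lbrace>x, y\<rbrace>\<^bsub>L\<^esub> z \<oplus>\<^bsub>ar L'\<^esub> F2 y \<lbrace>x, z\<rbrace>\<^bsub>L\<^esub>)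
        \<bullet>\<^bsub>L'\<^esub> (\<lbrace>F2 x y, \<iota>\<^bsub>L'\<^esub> (F0 z)\<rbrace>\<^sub>1\<^bsub>L'\<^esub> \<oplus>\<^bsub>ar L'\<^esub> \<lbrace>\<iota>\<^bsub>L'\<^esub> (F0 y), F2 x z\<rbrace>\<^sub>1\<^bsub>L'\<^esub>)
        \<bullet>\<^bsub>L'\<^esub> \<J>\<^bsub>L'\<^esub> (F0 x) (F0 y) (F0 z)"

text \<open>1- and 2-cells, used for both of the 2-categories below. For a morphism of Lie 2-algebras
  \<open>m0\<close>, \<open>m1\<close>, \<open>m2\<close> are \<open>F\<close> on objects, \<open>F\<close> on arrows and \<open>F\<^sup>2\<close>; for a morphism of 2-term
  \<open>EL\<^sub>\<infinity>\<close>-algebras they are \<open>f\<^sup>0\<close>, \<open>f\<^sup>1\<close> and \<open>f\<^sup>2\<close>.\<close>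

record ('o, 'v) mor =
  mdom :: 'o
  mcod :: 'o
  m0 :: "'v \<Rightarrow> 'v"
  m1 :: "'v \<Rightarrow> 'v"
  m2 :: "'v \<Rightarrow> 'v \<Rightarrow> 'v"

record ('o, 'v) cell =
  csrc :: "('o, 'v) mor"
  ctrg :: "('o, 'v) mor"
  cmap :: "'v \<Rightarrow> 'v"

type_synonym ('k, 'v) lie2_mor = "(('k, 'v) lie2, 'v) mor"
type_synonym ('k, 'v) lie2_cell = "(('k, 'v) lie2, 'v) cell"

definition lie2_morphism :: "('k, 'r) ring_scheme \<Rightarrow> ('k, 'v) lie2_mor \<Rightarrow> bool" where
  "lie2_morphism K F \<longleftrightarrow> lie2_hom K (mdom F) (mcod F) (m0 F) (m1 F) (m2 F)"

definition lie2_id :: "('k, 'v) lie2 \<Rightarrow> ('k, 'v) lie2_mor" where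
  "lie2_id L = \<lparr>mdom = L, mcod = L,
     m0 = restrict (\<lambda>x. x) (carrier (ob L)),
     m1 = restrict (\<lambda>f. f) (carrier (ar L)),
     m2 = restrict2 (\<lambda>x y. \<iota>\<^bsub>L\<^esub> \<lbrace>x, y\<rbrace>\<^bsub>L\<^esub>) (carrier (ob L))\<rparr>"

definition lie2_comp :: "('k, 'v) lie2_mor \<Rightarrow> ('k, 'v) lie2_mor \<Rightarrow> ('k, 'v) lie2_mor" where
  "lie2_comp G F = \<lparr>mdom = mdom F, mcod = mcod G,
     m0 = compose (carrier (ob (mdom F))) (m0 G) (m0 F),
     m1 = compose (carrier (ar (mdom F))) (m1 G) (m1 F),
     m2 = restrict2 (\<lambda>x y. m1 G (m2 F x y) \<bullet>\<^bsub>mcod G\<^esub> m2 G (m0 F x) (m0 F y))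
       (carrier (ob (mdom F)))\<rparr>"

locale lie2_two_hom =
  fixes K :: "('k, 'r) ring_scheme" and F G :: "('k, 'v) lie2_mor" and \<Theta> :: "'v \<Rightarrow> 'v"
  assumes cells1: "lie2_morphism K F" "lie2_morphism K G"
    and parallel: "mdom G = mdom F" "mcod G = mcod F"
    and extensional: "\<Theta> \<in> extensional (carrier (ob (mdom F)))"
    and transformation:
      "linear_transformation K (mdom F) (mcod F) (m0 F) (m1 F) (m0 G) (m1 G) \<Theta>"
    and bracket: "\<lbrakk>x \<in> carrier (ob (mdom F)); y \<in> carrier (ob (mdom F))\<rbrakk> \<Longrightarrow>
      \<Theta> \<lbrace>x, y\<rbrace>\<^bsub>mdom F\<^esub> \<bullet>\<^bsub>mcod F\<^esub> m2 F x y = m2 G x y \<bullet>\<^bsub>mcod F\<^esub> \<lbrace>\<Theta> x, \<Theta> y\<rbrace>\<^sub>1\<^bsub>mcod F\<^esub>"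

definition lie2_id2 :: "('k, 'v) lie2_mor \<Rightarrow> ('k, 'v) lie2_cell" where
  "lie2_id2 F = \<lparr>csrc = F, ctrg = F,
     cmap = restrict (\<lambda>x. \<iota>\<^bsub>mcod F\<^esub> (m0 F x)) (carrier (ob (mdom F)))\<rparr>"

definition lie2_vcomp :: "('k, 'v) lie2_cell \<Rightarrow> ('k, 'v) lie2_cell \<Rightarrow> ('k, 'v) lie2_cell" where
  "lie2_vcomp \<Psi> \<Theta> = \<lparr>csrc = csrc \<Theta>, ctrg = ctrg \<Psi>,
     cmap = restrict (\<lambda>x. cmap \<Psi> x \<bullet>\<^bsub>mcod (csrc \<Theta>)\<^esub> cmap \<Theta> x) (carrier (ob (mdom (csrc \<Theta>))))\<rparr>"

definition lie2_hcomp :: "('k, 'v) lie2_cell \<Rightarrow> ('k, 'v) lie2_cell \<Rightarrow> ('k, 'v) lie2_cell" where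
  "lie2_hcomp \<Psi> \<Theta> = \<lparr>csrc = lie2_comp (csrc \<Psi>) (csrc \<Theta>), ctrg = lie2_comp (ctrg \<Psi>) (ctrg \<Theta>),
     cmap = restrict
       (\<lambda>x. cmap \<Psi> (m0 (ctrg \<Theta>) x) \<bullet>\<^bsub>mcod (csrc \<Psi>)\<^esub> m1 (csrc \<Psi>) (cmap \<Theta> x))
       (carrier (ob (mdom (csrc \<Theta>))))\<rparr>"

type_synonym ('k, 'v) lie2_cat =
  "(('k, 'v) lie2, ('k, 'v) lie2_mor, ('k, 'v) lie2_cell) two_cat"

definition TwoLie :: "('k, 'r) ring_scheme \<Rightarrow> ('k, 'v) lie2_cat" where
  "TwoLie K = \<lparr>
     Ob = {L. lie2_algebra K L},
     Mor = {F. lie2_morphism K F},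
     Cell = {\<Theta>. lie2_two_hom K (csrc \<Theta>) (ctrg \<Theta>) (cmap \<Theta>)},
     Dom = mdom, Cod = mcod, Src = csrc, Trg = ctrg,
     id1 = lie2_id, comp1 = lie2_comp,
     id2 = lie2_id2, vcomp = lie2_vcomp, hcomp = lie2_hcomp\<rparr>"


section \<open>2-term \<open>EL\<^sub>\<infinity>\<close>-algebras\<close>

record ('k, 'v) cplx =
  deg0 :: "('k, 'v) module"
  degm1 :: "('k, 'v) module"
  diff :: "'v \<Rightarrow> 'v" (\<open>\<delta>\<index>\<close>)

locale two_term_complex = K: field K + C0: module K "deg0 C" + C1: module K "degm1 C"
  for K :: "('k, 'r) ring_scheme" and C :: "('k, 'v, 'z) cplx_scheme" (structure) +
  assumes diff_linear: "linear_map K (degm1 C) (deg0 C) \<delta>\<^bsub>C\<^esub>"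

text \<open>The components of the bracket on \<open>C\<^sup>0 \<times> C\<^sup>0\<close>, \<open>C\<^sup>0 \<times> C\<^sup>-\<^sup>1\<close> and \<open>C\<^sup>-\<^sup>1 \<times> C\<^sup>0\<close> need
  separate names, since the two carriers may overlap.\<close>

record ('k, 'v) el2 = "('k, 'v) cplx" +
  b00 :: "'v \<Rightarrow> 'v \<Rightarrow> 'v" (\<open>[_,/ _]\<^sub>0\<^sub>0\<index>\<close>)
  b01 :: "'v \<Rightarrow> 'v \<Rightarrow> 'v" (\<open>[_,/ _]\<^sub>0\<^sub>1\<index>\<close>)
  b10 :: "'v \<Rightarrow> 'v \<Rightarrow> 'v" (\<open>[_,/ _]\<^sub>1\<^sub>0\<index>\<close>)
  pairing :: "'v \<Rightarrow> 'v \<Rightarrow> 'v" (\<open>\<langle>_,/ _\<rangle>\<index>\<close>)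
  ternary :: "'v \<Rightarrow> 'v \<Rightarrow> 'v \<Rightarrow> 'v" (\<open>\<langle>_,/ _,/ _\<rangle>\<index>\<close>)

text \<open>The derived bracket on \<open>C\<^sup>-\<^sup>1\<close>.\<close>

definition derived :: "('k, 'v) el2 \<Rightarrow> 'v \<Rightarrow> 'v \<Rightarrow> 'v" (\<open>[_,/ _]\<^sub>1\<^sub>1\<index>\<close>) where
  "[a, b]\<^sub>1\<^sub>1\<^bsub>C\<^esub> = [\<delta>\<^bsub>C\<^esub> a, b]\<^sub>0\<^sub>1\<^bsub>C\<^esub>"

locale el2_algebra = two_term_complex K C
  for K :: "('k, 'r) ring_scheme" and C :: "('k, 'v) el2" (structure) +
  assumes b00_bilinear: "bilinear_map K (deg0 C) (deg0 C) (deg0 C) (b00 C)"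
    and b01_bilinear: "bilinear_map K (deg0 C) (degm1 C) (degm1 C) (b01 C)"
    and b10_bilinear: "bilinear_map K (degm1 C) (deg0 C) (degm1 C) (b10 C)"
    and pairing_bilinear: "bilinear_map K (deg0 C) (deg0 C) (degm1 C) (pairing C)"
    and ternary_trilinear: "trilinear_map K (deg0 C) (deg0 C) (deg0 C) (degm1 C) (ternary C)"
    and diff_b01: "\<lbrakk>x \<in> carrier (deg0 C); b \<in> carrier (degm1 C)\<rbrakk> \<Longrightarrow> \<delta> [x, b]\<^sub>0\<^sub>1 = [x, \<delta> b]\<^sub>0\<^sub>0"
    and diff_b10: "\<lbrakk>a \<in> carrier (degm1 C); y \<in> carrier (deg0 C)\<rbrakk> \<Longrightarrow> \<delta> [a, y]\<^sub>1\<^sub>0 = [\<delta> a, y]\<^sub>0\<^sub>0"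
    and b01_b10: "\<lbrakk>a \<in> carrier (degm1 C); b \<in> carrier (degm1 C)\<rbrakk>
      \<Longrightarrow> [\<delta> a, b]\<^sub>0\<^sub>1 = [a, \<delta> b]\<^sub>1\<^sub>0"
    and skew00: "\<lbrakk>x \<in> carrier (deg0 C); y \<in> carrier (deg0 C)\<rbrakk>
      \<Longrightarrow> [x, y]\<^sub>0\<^sub>0 \<oplus>\<^bsub>deg0 C\<^esub> [y, x]\<^sub>0\<^sub>0 = \<delta> \<langle>x, y\<rangle>"
    and skew10: "\<lbrakk>a \<in> carrier (degm1 C); y \<in> carrier (deg0 C)\<rbrakk>
      \<Longrightarrow> [a, y]\<^sub>1\<^sub>0 \<oplus>\<^bsub>degm1 C\<^esub> [y, a]\<^sub>0\<^sub>1 = \<langle>\<delta> a, y\<rangle>"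
    and skew01: "\<lbrakk>x \<in> carrier (deg0 C); b \<in> carrier (degm1 C)\<rbrakk>
      \<Longrightarrow> [x, b]\<^sub>0\<^sub>1 \<oplus>\<^bsub>degm1 C\<^esub> [b, x]\<^sub>1\<^sub>0 = \<langle>x, \<delta> b\<rangle>"
    and jacobi000: "\<lbrakk>u \<in> carrier (deg0 C); v \<in> carrier (deg0 C); w \<in> carrier (deg0 C)\<rbrakk>
      \<Longrightarrow> [u, [v, w]\<^sub>0\<^sub>0]\<^sub>0\<^sub>0 \<ominus>\<^bsub>deg0 C\<^esub> [[u, v]\<^sub>0\<^sub>0, w]\<^sub>0\<^sub>0 \<ominus>\<^bsub>deg0 C\<^esub> [v, [u, w]\<^sub>0\<^sub>0]\<^sub>0\<^sub>0
        = \<delta> \<langle>u, v, w\<rangle>"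
    and jacobi100: "\<lbrakk>u \<in> carrier (degm1 C); v \<in> carrier (deg0 C); w \<in> carrier (deg0 C)\<rbrakk>
      \<Longrightarrow> [u, [v, w]\<^sub>0\<^sub>0]\<^sub>1\<^sub>0 \<ominus>\<^bsub>degm1 C\<^esub> [[u, v]\<^sub>1\<^sub>0, w]\<^sub>1\<^sub>0 \<ominus>\<^bsub>degm1 C\<^esub> [v, [u, w]\<^sub>1\<^sub>0]\<^sub>0\<^sub>1
        = \<langle>\<delta> u, v, w\<rangle>"
    and jacobi010: "\<lbrakk>u \<in> carrier (deg0 C); v \<in> carrier (degm1 C); w \<in> carrier (deg0 C)\<rbrakk>
      \<Longrightarrow> [u, [v, w]\<^sub>1\<^sub>0]\<^sub>0\<^sub>1 \<ominus>\<^bsub>degm1 C\<^esub> [[u, v]\<^sub>0\<^sub>1, w]\<^sub>1\<^sub>0 \<ominus>\<^bsub>degm1 C\<^esub> [v, [u, w]\<^sub>0\<^sub>0]\<^sub>1\<^sub>0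
        = \<langle>u, \<delta> v, w\<rangle>"
    and jacobi001: "\<lbrakk>u \<in> carrier (deg0 C); v \<in> carrier (deg0 C); w \<in> carrier (degm1 C)\<rbrakk>
      \<Longrightarrow> [u, [v, w]\<^sub>0\<^sub>1]\<^sub>0\<^sub>1 \<ominus>\<^bsub>degm1 C\<^esub> [[u, v]\<^sub>0\<^sub>0, w]\<^sub>0\<^sub>1 \<ominus>\<^bsub>degm1 C\<^esub> [v, [u, w]\<^sub>0\<^sub>1]\<^sub>0\<^sub>1
        = \<langle>u, v, \<delta> w\<rangle>"
    and E1: "\<lbrakk>x \<in> carrier (deg0 C); y \<in> carrier (deg0 C); z \<in> carrier (deg0 C);
        w \<in> carrier (deg0 C)\<rbrakk> \<Longrightarrow>
      [x, \<langle>y, z, w\<rangle>]\<^sub>0\<^sub>1 \<oplus>\<^bsub>degm1 C\<^esub> \<langle>x, [y, z]\<^sub>0\<^sub>0, w\<rangle> \<oplus>\<^bsub>degm1 C\<^esub> \<langle>x, z, [y, w]\<^sub>0\<^sub>0\<rangle>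
        \<oplus>\<^bsub>degm1 C\<^esub> [\<langle>x, y, z\<rangle>, w]\<^sub>1\<^sub>0 \<oplus>\<^bsub>degm1 C\<^esub> [z, \<langle>x, y, w\<rangle>]\<^sub>0\<^sub>1
      = \<langle>x, y, [z, w]\<^sub>0\<^sub>0\<rangle> \<oplus>\<^bsub>degm1 C\<^esub> \<langle>[x, y]\<^sub>0\<^sub>0, z, w\<rangle> \<oplus>\<^bsub>degm1 C\<^esub> [y, \<langle>x, z, w\<rangle>]\<^sub>0\<^sub>1
        \<oplus>\<^bsub>degm1 C\<^esub> \<langle>y, [x, z]\<^sub>0\<^sub>0, w\<rangle> \<oplus>\<^bsub>degm1 C\<^esub> \<langle>y, z, [x, w]\<^sub>0\<^sub>0\<rangle>"
    and E2: "\<lbrakk>x \<in> carrier (deg0 C); y \<in> carrier (deg0 C); z \<in> carrier (deg0 C)\<rbrakk> \<Longrightarrow>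
      \<langle>x, y, z\<rangle> \<oplus>\<^bsub>degm1 C\<^esub> \<langle>y, x, z\<rangle> = \<ominus>\<^bsub>degm1 C\<^esub> [\<langle>x, y\<rangle>, z]\<^sub>1\<^sub>0"
    and E3: "\<lbrakk>x \<in> carrier (deg0 C); y \<in> carrier (deg0 C); z \<in> carrier (deg0 C)\<rbrakk> \<Longrightarrow>
      \<langle>x, y, z\<rangle> \<oplus>\<^bsub>degm1 C\<^esub> \<langle>x, z, y\<rangle>
      = [x, \<langle>y, z\<rangle>]\<^sub>0\<^sub>1 \<ominus>\<^bsub>degm1 C\<^esub> \<langle>[x, y]\<^sub>0\<^sub>0, z\<rangle> \<ominus>\<^bsub>degm1 C\<^esub> \<langle>y, [x, z]\<^sub>0\<^sub>0\<rangle>"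
    and E4: "\<lbrakk>x \<in> carrier (deg0 C); y \<in> carrier (deg0 C); z \<in> carrier (deg0 C)\<rbrakk> \<Longrightarrow>
      \<langle>x, [y, z]\<^sub>0\<^sub>0\<rangle> = \<langle>[y, z]\<^sub>0\<^sub>0, x\<rangle>"

definition chain_map ::
  "('k, 'r) ring_scheme \<Rightarrow> ('k, 'v, 'z) cplx_scheme \<Rightarrow> ('k, 'v, 'z) cplx_scheme
    \<Rightarrow> ('v \<Rightarrow> 'v) \<Rightarrow> ('v \<Rightarrow> 'v) \<Rightarrow> bool" where
  "chain_map K C C' f0 f1 \<longleftrightarrow>
     linear_map K (deg0 C) (deg0 C') f0 \<and> linear_map K (degm1 C) (degm1 C') f1
     \<and> (\<forall>a \<in> carrier (degm1 C). f0 (\<delta>\<^bsub>C\<^esub> a) = \<delta>\<^bsub>C'\<^esub> (f1 a))"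

locale el2_hom = dom: el2_algebra K C + cod: el2_algebra K C'
  for K :: "('k, 'r) ring_scheme" and C C' :: "('k, 'v) el2" +
  fixes f0 f1 :: "'v \<Rightarrow> 'v" and f2 :: "'v \<Rightarrow> 'v \<Rightarrow> 'v"
  assumes extensional:
      "f0 \<in> extensional (carrier (deg0 C))" "f1 \<in> extensional (carrier (degm1 C))"
      "f2 \<in> extensional2 (carrier (deg0 C))"
    and chain_map: "chain_map K C C' f0 f1"
    and f2_bilinear: "bilinear_map K (deg0 C) (deg0 C) (degm1 C') f2"
    and bracket00: "\<lbrakk>x \<in> carrier (deg0 C); y \<in> carrier (deg0 C)\<rbrakk> \<Longrightarrow>
      [f0 x, f0 y]\<^sub>0\<^sub>0\<^bsub>C'\<^esub> \<ominus>\<^bsub>deg0 C'\<^esub> f0 [x, y]\<^sub>0\<^sub>0\<^bsub>C\<^esub> = \<delta>\<^bsub>C'\<^esub> (f2 x y)"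
    and bracket10: "\<lbrakk>a \<in> carrier (degm1 C); y \<in> carrier (deg0 C)\<rbrakk> \<Longrightarrow>
      [f1 a, f0 y]\<^sub>1\<^sub>0\<^bsub>C'\<^esub> \<ominus>\<^bsub>degm1 C'\<^esub> f1 [a, y]\<^sub>1\<^sub>0\<^bsub>C\<^esub> = f2 (\<delta>\<^bsub>C\<^esub> a) y"
    and bracket01: "\<lbrakk>x \<in> carrier (deg0 C); b \<in> carrier (degm1 C)\<rbrakk> \<Longrightarrow>
      [f0 x, f1 b]\<^sub>0\<^sub>1\<^bsub>C'\<^esub> \<ominus>\<^bsub>degm1 C'\<^esub> f1 [x, b]\<^sub>0\<^sub>1\<^bsub>C\<^esub> = f2 x (\<delta>\<^bsub>C\<^esub> b)"
    and pairing: "\<lbrakk>x \<in> carrier (deg0 C); y \<in> carrier (deg0 C)\<rbrakk> \<Longrightarrow>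
      \<langle>f0 x, f0 y\<rangle>\<^bsub>C'\<^esub> \<ominus>\<^bsub>degm1 C'\<^esub> f1 \<langle>x, y\<rangle>\<^bsub>C\<^esub> = f2 x y \<oplus>\<^bsub>degm1 C'\<^esub> f2 y x"
    and ternary: "\<lbrakk>x \<in> carrier (deg0 C); y \<in> carrier (deg0 C); z \<in> carrier (deg0 C)\<rbrakk> \<Longrightarrow>
      \<langle>f0 x, f0 y, f0 z\<rangle>\<^bsub>C'\<^esub> \<ominus>\<^bsub>degm1 C'\<^esub> f1 \<langle>x, y, z\<rangle>\<^bsub>C\<^esub>
      = [f0 x, f2 y z]\<^sub>0\<^sub>1\<^bsub>C'\<^esub> \<ominus>\<^bsub>degm1 C'\<^esub> [f0 y, f2 x z]\<^sub>0\<^sub>1\<^bsub>C'\<^esub> \<ominus>\<^bsub>degm1 C'\<^esub> [f2 x y, f0 z]\<^sub>1\<^sub>0\<^bsub>C'\<^esub>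
        \<ominus>\<^bsub>degm1 C'\<^esub> f2 [x, y]\<^sub>0\<^sub>0\<^bsub>C\<^esub> z \<ominus>\<^bsub>degm1 C'\<^esub> f2 y [x, z]\<^sub>0\<^sub>0\<^bsub>C\<^esub> \<oplus>\<^bsub>degm1 C'\<^esub> f2 x [y, z]\<^sub>0\<^sub>0\<^bsub>C\<^esub>"

type_synonym ('k, 'v) el2_mor = "(('k, 'v) el2, 'v) mor"
type_synonym ('k, 'v) el2_cell = "(('k, 'v) el2, 'v) cell"

definition el2_morphism :: "('k, 'r) ring_scheme \<Rightarrow> ('k, 'v) el2_mor \<Rightarrow> bool" where
  "el2_morphism K f \<longleftrightarrow> el2_hom K (mdom f) (mcod f) (m0 f) (m1 f) (m2 f)"

definition el2_id :: "('k, 'v) el2 \<Rightarrow> ('k, 'v) el2_mor" where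
  "el2_id C = \<lparr>mdom = C, mcod = C,
     m0 = restrict (\<lambda>x. x) (carrier (deg0 C)),
     m1 = restrict (\<lambda>a. a) (carrier (degm1 C)),
     m2 = restrict2 (\<lambda>x y. \<zero>\<^bsub>degm1 C\<^esub>) (carrier (deg0 C))\<rparr>"

definition el2_comp :: "('k, 'v) el2_mor \<Rightarrow> ('k, 'v) el2_mor \<Rightarrow> ('k, 'v) el2_mor" where
  "el2_comp g f = \<lparr>mdom = mdom f, mcod = mcod g,
     m0 = compose (carrier (deg0 (mdom f))) (m0 g) (m0 f),
     m1 = compose (carrier (degm1 (mdom f))) (m1 g) (m1 f),
     m2 = restrict2 (\<lambda>x y. m2 g (m0 f x) (m0 f y) \<oplus>\<^bsub>degm1 (mcod g)\<^esub> m1 g (m2 f x y))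
       (carrier (deg0 (mdom f)))\<rparr>"

locale el2_two_hom =
  fixes K :: "('k, 'r) ring_scheme" and f g :: "('k, 'v) el2_mor" and \<theta> :: "'v \<Rightarrow> 'v"
  assumes cells1: "el2_morphism K f" "el2_morphism K g"
    and parallel: "mdom g = mdom f" "mcod g = mcod f"
    and extensional: "\<theta> \<in> extensional (carrier (deg0 (mdom f)))"
    and linear: "linear_map K (deg0 (mdom f)) (degm1 (mcod f)) \<theta>"
    and homotopy0: "x \<in> carrier (deg0 (mdom f)) \<Longrightarrow>
      m0 f x \<ominus>\<^bsub>deg0 (mcod f)\<^esub> m0 g x = \<delta>\<^bsub>mcod f\<^esub> (\<theta> x)"
    and homotopy1: "a \<in> carrier (degm1 (mdom f)) \<Longrightarrow>
      m1 f a \<ominus>\<^bsub>degm1 (mcod f)\<^esub> m1 g a = \<theta> (\<delta>\<^bsub>mdom f\<^esub> a)"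
    and bracket: "\<lbrakk>x \<in> carrier (deg0 (mdom f)); y \<in> carrier (deg0 (mdom f))\<rbrakk> \<Longrightarrow>
      m2 f x y \<ominus>\<^bsub>degm1 (mcod f)\<^esub> m2 g x y
      = [m0 f x, \<theta> y]\<^sub>0\<^sub>1\<^bsub>mcod f\<^esub> \<oplus>\<^bsub>degm1 (mcod f)\<^esub> [\<theta> x, m0 f y]\<^sub>1\<^sub>0\<^bsub>mcod f\<^esub>
        \<ominus>\<^bsub>degm1 (mcod f)\<^esub> \<theta> [x, y]\<^sub>0\<^sub>0\<^bsub>mdom f\<^esub> \<ominus>\<^bsub>degm1 (mcod f)\<^esub> [\<theta> x, \<theta> y]\<^sub>1\<^sub>1\<^bsub>mcod f\<^esub>"

definition el2_id2 :: "('k, 'v) el2_mor \<Rightarrow> ('k, 'v) el2_cell" where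
  "el2_id2 f = \<lparr>csrc = f, ctrg = f,
     cmap = restrict (\<lambda>x. \<zero>\<^bsub>degm1 (mcod f)\<^esub>) (carrier (deg0 (mdom f)))\<rparr>"

definition el2_vcomp :: "('k, 'v) el2_cell \<Rightarrow> ('k, 'v) el2_cell \<Rightarrow> ('k, 'v) el2_cell" where
  "el2_vcomp \<psi> \<theta> = \<lparr>csrc = csrc \<theta>, ctrg = ctrg \<psi>,
     cmap = restrict (\<lambda>x. cmap \<psi> x \<oplus>\<^bsub>degm1 (mcod (csrc \<theta>))\<^esub> cmap \<theta> x)
       (carrier (deg0 (mdom (csrc \<theta>))))\<rparr>"

definition el2_hcomp :: "('k, 'v) el2_cell \<Rightarrow> ('k, 'v) el2_cell \<Rightarrow> ('k, 'v) el2_cell" where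
  "el2_hcomp \<psi> \<theta> = \<lparr>csrc = el2_comp (csrc \<psi>) (csrc \<theta>), ctrg = el2_comp (ctrg \<psi>) (ctrg \<theta>),
     cmap = restrict
       (\<lambda>x. m1 (csrc \<psi>) (cmap \<theta> x) \<oplus>\<^bsub>degm1 (mcod (csrc \<psi>))\<^esub> cmap \<psi> (m0 (ctrg \<theta>) x))
       (carrier (deg0 (mdom (csrc \<theta>))))\<rparr>"

type_synonym ('k, 'v) el2_cat =
  "(('k, 'v) el2, ('k, 'v) el2_mor, ('k, 'v) el2_cell) two_cat"

definition TwoTermEL :: "('k, 'r) ring_scheme \<Rightarrow> ('k, 'v) el2_cat" where
  "TwoTermEL K = \<lparr>
     Ob = {C. el2_algebra K C},
     Mor = {f. el2_morphism K f},
     Cell = {\<theta>. el2_two_hom K (csrc \<theta>) (ctrg \<theta>) (cmap \<theta>)},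
     Dom = mdom, Cod = mcod, Src = csrc, Trg = ctrg,
     id1 = el2_id, comp1 = el2_comp,
     id2 = el2_id2, vcomp = el2_vcomp, hcomp = el2_hcomp\<rparr>"


section \<open>The normalization 2-functor\<close>

definition source_kernel :: "('k, 'v, 'z) lincat_scheme \<Rightarrow> ('k, 'v) module" where
  "source_kernel V = (ar V)\<lparr>carrier := {a \<in> carrier (ar V). src V a = \<zero>\<^bsub>ob V\<^esub>}\<rparr>"

definition normalization :: "('k, 'v, 'z) lincat_scheme \<Rightarrow> ('k, 'v) cplx" where
  "normalization V = \<lparr>deg0 = ob V, degm1 = source_kernel V, diff = tgt V\<rparr>"

text \<open>Under \<open>V \<simeq> \<Gamma> N(V)\<close> an arrow \<open>f : x \<rightarrow> y\<close> is \<open>(x, a)\<close> with \<open>a\<close> the following element.\<close>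

definition kernel_part :: "('k, 'v, 'z) lincat_scheme \<Rightarrow> 'v \<Rightarrow> 'v" where
  "kernel_part V f = f \<ominus>\<^bsub>ar V\<^esub> \<iota>\<^bsub>V\<^esub> (src V f)"

definition N_ob :: "('k, 'v) lie2 \<Rightarrow> ('k, 'v) el2" where
  "N_ob L = cplx.extend (normalization L) (el2.fields
     (br0 L)
     (\<lambda>x b. \<lbrace>\<iota>\<^bsub>L\<^esub> x, b\<rbrace>\<^sub>1\<^bsub>L\<^esub>)
     (\<lambda>a y. \<lbrace>a, \<iota>\<^bsub>L\<^esub> y\<rbrace>\<^sub>1\<^bsub>L\<^esub>)
     (\<lambda>x y. \<ominus>\<^bsub>ar L\<^esub> (kernel_part L (\<S>\<^bsub>L\<^esub> x y)))
     (\<lambda>x y z. \<ominus>\<^bsub>ar L\<^esub> (kernel_part L (\<J>\<^bsub>L\<^esub> x y z))))"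

definition N_mor :: "('k, 'v) lie2_mor \<Rightarrow> ('k, 'v) el2_mor" where
  "N_mor F = \<lparr>mdom = N_ob (mdom F), mcod = N_ob (mcod F),
     m0 = m0 F,
     m1 = restrict (m1 F) (carrier (source_kernel (mdom F))),
     m2 = restrict2 (\<lambda>x y. \<ominus>\<^bsub>ar (mcod F)\<^esub> (kernel_part (mcod F) (m2 F x y)))
       (carrier (ob (mdom F)))\<rparr>"

definition N_cell :: "('k, 'v) lie2_cell \<Rightarrow> ('k, 'v) el2_cell" where
  "N_cell \<Theta> = \<lparr>csrc = N_mor (csrc \<Theta>), ctrg = N_mor (ctrg \<Theta>),
     cmap = restrict
       (\<lambda>x. \<ominus>\<^bsub>ar (mcod (csrc \<Theta>))\<^esub> (kernel_part (mcod (csrc \<Theta>)) (cmap \<Theta> x)))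
       (carrier (ob (mdom (csrc \<Theta>))))\<rparr>"

definition N_functor ::
  "(('k, 'v) lie2, ('k, 'v) lie2_mor, ('k, 'v) lie2_cell,
    ('k, 'v) el2, ('k, 'v) el2_mor, ('k, 'v) el2_cell) two_fun" where
  "N_functor = \<lparr>on_ob = N_ob, on_mor = N_mor, on_cell = N_cell\<rparr>"


section \<open>The 2-functor \<open>\<Gamma>\<close>\<close>

text \<open>Since all vector spaces of a 2-category have their elements in one type, that type has to be
  closed under pairs for direct sums to exist. This one is, and contains an arbitrary type \<open>'u\<close>.\<close>

datatype 'u univ = Elem 'u | Pair (first: "'u univ") (second: "'u univ")

definition direct_sum ::
  "('k, 'u univ) module \<Rightarrow> ('k, 'u univ) module \<Rightarrow> ('k, 'u univ) module" where
  "direct_sum V W = \<lparr>carrier = {Pair x a | x a. x \<in> carrier V \<and> a \<in> carrier W},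
     mult = undefined, one = undefined,
     zero = Pair \<zero>\<^bsub>V\<^esub> \<zero>\<^bsub>W\<^esub>,
     add = (\<lambda>p q. Pair (first p \<oplus>\<^bsub>V\<^esub> first q) (second p \<oplus>\<^bsub>W\<^esub> second q)),
     smult = (\<lambda>c p. Pair (c \<odot>\<^bsub>V\<^esub> first p) (c \<odot>\<^bsub>W\<^esub> second p))\<rparr>"

definition Gamma :: "('k, 'u univ, 'z) cplx_scheme \<Rightarrow> ('k, 'u univ) lincat" where
  "Gamma C = \<lparr>ob = deg0 C, ar = direct_sum (deg0 C) (degm1 C),
     src = first,
     tgt = (\<lambda>p. first p \<oplus>\<^bsub>deg0 C\<^esub> \<delta>\<^bsub>C\<^esub> (second p)),
     ident = (\<lambda>x. Pair x \<zero>\<^bsub>degm1 C\<^esub>),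
     cmp = (\<lambda>q p. Pair (first p) (second p \<oplus>\<^bsub>degm1 C\<^esub> second q))\<rparr>"

definition Gamma_ob :: "('k, 'u univ) el2 \<Rightarrow> ('k, 'u univ) lie2" where
  "Gamma_ob C = lincat.extend (Gamma C) (lie2.fields
     (b00 C)
     (\<lambda>p q. Pair [first p, first q]\<^sub>0\<^sub>0\<^bsub>C\<^esub>
        ([first p, second q]\<^sub>0\<^sub>1\<^bsub>C\<^esub> \<oplus>\<^bsub>degm1 C\<^esub> [second p, first q]\<^sub>1\<^sub>0\<^bsub>C\<^esub>
          \<oplus>\<^bsub>degm1 C\<^esub> [second p, second q]\<^sub>1\<^sub>1\<^bsub>C\<^esub>))
     (\<lambda>x y. Pair [x, y]\<^sub>0\<^sub>0\<^bsub>C\<^esub> (\<ominus>\<^bsub>degm1 C\<^esub> \<langle>x, y\<rangle>\<^bsub>C\<^esub>))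
     (\<lambda>x y z. Pair [x, [y, z]\<^sub>0\<^sub>0\<^bsub>C\<^esub>]\<^sub>0\<^sub>0\<^bsub>C\<^esub> (\<ominus>\<^bsub>degm1 C\<^esub> \<langle>x, y, z\<rangle>\<^bsub>C\<^esub>)))"

definition Gamma_mor :: "('k, 'u univ) el2_mor \<Rightarrow> ('k, 'u univ) lie2_mor" where
  "Gamma_mor f = \<lparr>mdom = Gamma_ob (mdom f), mcod = Gamma_ob (mcod f),
     m0 = m0 f,
     m1 = restrict (\<lambda>p. Pair (m0 f (first p)) (m1 f (second p)))
       (carrier (direct_sum (deg0 (mdom f)) (degm1 (mdom f)))),
     m2 = restrict2
       (\<lambda>x y. Pair [m0 f x, m0 f y]\<^sub>0\<^sub>0\<^bsub>mcod f\<^esub> (\<ominus>\<^bsub>degm1 (mcod f)\<^esub> (m2 f x y)))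
       (carrier (deg0 (mdom f)))\<rparr>"

definition Gamma_cell :: "('k, 'u univ) el2_cell \<Rightarrow> ('k, 'u univ) lie2_cell" where
  "Gamma_cell \<theta> = \<lparr>csrc = Gamma_mor (csrc \<theta>), ctrg = Gamma_mor (ctrg \<theta>),
     cmap = restrict
       (\<lambda>x. Pair (m0 (csrc \<theta>) x) (\<ominus>\<^bsub>degm1 (mcod (csrc \<theta>))\<^esub> (cmap \<theta> x)))
       (carrier (deg0 (mdom (csrc \<theta>))))\<rparr>"

definition Gamma_functor ::
  "(('k, 'u univ) el2, ('k, 'u univ) el2_mor, ('k, 'u univ) el2_cell,
    ('k, 'u univ) lie2, ('k, 'u univ) lie2_mor, ('k, 'u univ) lie2_cell) two_fun" where
  "Gamma_functor = \<lparr>on_ob = Gamma_ob, on_mor = Gamma_mor, on_cell = Gamma_cell\<rparr>"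

end

theory Submission
  imports Defs
begin

text \<open>An arrow \<open>f\<close> of a linear category is its source together with \<open>f - 1\<close> in the kernel of the
  source map, and linearity forces \<open>g \<bullet> f = g + f - 1\<close>, with \<open>1\<close> the identity of the source of
  \<open>g\<close>. Hence every equation between composites of arrows in a Lie 2-algebra is a linear identity
  in the space of arrows, and \<open>N\<close> turns the axioms of Lie 2-algebras, their morphisms and their
  2-morphisms into those of 2-term \<open>EL\<^sub>\<infinity>\<close>-algebras. On 1-cells between fixed objects and on 2-cells
  between fixed 1-cells \<open>N\<close> is bijective, so the 2-category axioms for Lie 2-algebras follow from
  those for 2-term \<open>EL\<^sub>\<infinity>\<close>-algebras. Finally \<open>N \<Gamma> C\<close> is strictly isomorphic to \<open>C\<close>, and on 1- and
  2-cells \<open>\<Gamma>\<close> is conjugation by this isomorphism followed by the inverse of \<open>N\<close>; 2-functoriality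
  of \<open>\<Gamma>\<close> and both 2-natural isomorphisms follow formally.\<close>

section \<open>An ambient abelian group\<close>

text \<open>The two sides of every coherence equation are parallel arrows. A composite has the
  source of its first arrow and, as kernel part, the sum of the kernel parts of its factors; so such
  an equation only says that two sums of kernel parts agree, and the identities padding
  \<open>L1\<close> contribute nothing. The axioms of a 2-term algebra with one argument in degree
  -1 are naturality at tuples in which all entries but one are identities. The converse is the
  harder direction: naturality at arbitrary arrows produces terms with several entries of degree -1,
  and these fit together only because \<open>[\<delta> a, b] = [a, \<delta> b]\<close>, which in
  turn is functoriality of the bracket in pairs of arrows. That \<open>N \<Gamma> C\<close> is not
  literally \<open>C\<close> is an effect of the direct sum: its part of degree -1 consists of the
  pairs \<open>(0, a)\<close>.\<close>

text \<open>The product of all abelian groups carried by subsets of \<open>'v\<close> is a single type of class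
  \<^class>\<open>ab_group_add\<close> that contains each of them. Identities relative to a carrier are proved by
  pushing them into this type, where the simplifier normalises sums without side conditions.\<close>

typedef ('k, 'v) ambient = "{f :: ('k, 'v) module \<Rightarrow> 'v.
    \<forall>M. if abelian_group M then f M \<in> carrier M else f M = undefined}"
  by (rule exI[of _ "\<lambda>M. if abelian_group M then \<zero>\<^bsub>M\<^esub> else undefined"])
    (auto simp: abelian_group.axioms intro: abelian_monoid.zero_closed)

lemma Rep_ambient_carrier: "abelian_group M \<Longrightarrow> Rep_ambient f M \<in> carrier M"
  using Rep_ambient[of f] by auto

lemma Rep_ambient_undefined: "\<not> abelian_group M \<Longrightarrow> Rep_ambient f M = undefined"
  using Rep_ambient[of f] by auto

lemma ambient_eqI: "(\<And>M. abelian_group M \<Longrightarrow> Rep_ambient f M = Rep_ambient g M) \<Longrightarrow> f = g"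
  by (rule Rep_ambient_inject[THEN iffD1], rule ext) (metis Rep_ambient_undefined)

lemma Rep_Abs_ambient:
  assumes "\<And>M. abelian_group M \<Longrightarrow> h M \<in> carrier M"
  shows "Rep_ambient (Abs_ambient (\<lambda>M. if abelian_group M then h M else undefined))
    = (\<lambda>M. if abelian_group M then h M else undefined)"
  by (rule Abs_ambient_inverse) (use assms in auto)

instantiation ambient :: (type, type) ab_group_add
begin

definition "0 = Abs_ambient (\<lambda>M :: ('a, 'b) module. if abelian_group M then \<zero>\<^bsub>M\<^esub> else undefined)"
definition "f + g = Abs_ambient (\<lambda>M :: ('a, 'b) module.
  if abelian_group M then Rep_ambient f M \<oplus>\<^bsub>M\<^esub> Rep_ambient g M else undefined)"
definition "- f = Abs_ambient (\<lambda>M :: ('a, 'b) module.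
  if abelian_group M then \<ominus>\<^bsub>M\<^esub> Rep_ambient f M else undefined)"
definition "f - g = f + - (g :: ('a, 'b) ambient)"

lemma Rep_zero_ambient: "abelian_group M \<Longrightarrow> Rep_ambient 0 M = \<zero>\<^bsub>M\<^esub>"
  unfolding zero_ambient_def
  by (subst Rep_Abs_ambient) (auto intro: abelian_monoid.zero_closed abelian_group.axioms)

lemma Rep_plus_ambient:
  "abelian_group M \<Longrightarrow> Rep_ambient (f + g) M = Rep_ambient f M \<oplus>\<^bsub>M\<^esub> Rep_ambient g M"
  unfolding plus_ambient_def
  by (subst Rep_Abs_ambient)
    (auto intro: abelian_monoid.a_closed abelian_group.axioms Rep_ambient_carrier)

lemma Rep_uminus_ambient: "abelian_group M \<Longrightarrow> Rep_ambient (- f) M = \<ominus>\<^bsub>M\<^esub> Rep_ambient f M"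
  unfolding uminus_ambient_def
  by (subst Rep_Abs_ambient) (auto intro: abelian_group.a_inv_closed Rep_ambient_carrier)

instance
proof
  fix a b c :: "('a, 'b) ambient"
  show "a + b + c = a + (b + c)"
    by (rule ambient_eqI) (simp add: Rep_plus_ambient Rep_ambient_carrier
      abelian_monoid.a_assoc[OF abelian_group.axioms(1)])
  show "a + b = b + a"
    by (rule ambient_eqI) (simp add: Rep_plus_ambient Rep_ambient_carrier
      abelian_monoid.a_comm[OF abelian_group.axioms(1)])
  show "0 + a = a"
    by (rule ambient_eqI) (simp add: Rep_plus_ambient Rep_zero_ambient Rep_ambient_carrier
      abelian_monoid.l_zero[OF abelian_group.axioms(1)])
  show "- a + a = 0"
    by (rule ambient_eqI) (simp add: Rep_plus_ambient Rep_zero_ambient Rep_uminus_ambient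
      Rep_ambient_carrier abelian_group.l_neg)
  show "a - b = a + - b"
    by (fact minus_ambient_def)
qed

end

text \<open>Inclusion of the factor \<open>M\<close> into the product. For an abelian group
  \<open>M\<close> and \<open>x\<close> outside its carrier, \<open>Abs_ambient\<close> is applied
  outside its range, hence the carrier conditions in the rules below.\<close>

definition emb :: "('k, 'v) module \<Rightarrow> 'v \<Rightarrow> ('k, 'v) ambient" where
  "emb M x = Abs_ambient (\<lambda>N. if abelian_group N then (if N = M then x else \<zero>\<^bsub>N\<^esub>) else undefined)"

lemma Rep_emb:
  assumes "x \<in> carrier M" "abelian_group N"
  shows "Rep_ambient (emb M x) N = (if N = M then x else \<zero>\<^bsub>N\<^esub>)"
  unfolding emb_def
  by (subst Rep_Abs_ambient) (use assms in \<open>auto intro: abelian_monoid.zero_closed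
      abelian_group.axioms\<close>)

locale embedded_group = abelian_group G for G :: "('k, 'v) module" (structure)
begin

text \<open>Meant as a rewrite rule from left to right: it moves an equation into the ambient type.
  Objects and arrows share one element type, so the carrier conditions are what selects the right
  group.\<close>

lemma emb_inject: "\<lbrakk>x \<in> carrier G; y \<in> carrier G\<rbrakk> \<Longrightarrow> x = y \<longleftrightarrow> emb G x = emb G y"
  by (metis Rep_emb abelian_group_axioms)

lemma emb_add: "\<lbrakk>x \<in> carrier G; y \<in> carrier G\<rbrakk> \<Longrightarrow> emb G (x \<oplus> y) = emb G x + emb G y"
  by (rule ambient_eqI)
    (simp add: Rep_emb Rep_plus_ambient abelian_monoid.l_zero abelian_group.axioms(1)
      abelian_monoid.zero_closed)

lemma emb_zero: "emb G \<zero> = 0"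
  by (rule ambient_eqI) (simp add: Rep_emb Rep_zero_ambient)

lemma emb_a_inv: "x \<in> carrier G \<Longrightarrow> emb G (\<ominus> x) = - emb G x"
  by (metis a_inv_closed add_eq_0_iff emb_add emb_zero r_neg)

lemma emb_minus: "\<lbrakk>x \<in> carrier G; y \<in> carrier G\<rbrakk> \<Longrightarrow> emb G (x \<ominus> y) = emb G x - emb G y"
  by (simp add: a_minus_def emb_add emb_a_inv)

lemmas emb_simps = emb_inject emb_add emb_zero emb_a_inv emb_minus

end

section \<open>Linear maps\<close>

lemma (in abelian_group) minus_cancel:
  "x \<in> carrier G \<Longrightarrow> x \<ominus> x = \<zero>" "x \<in> carrier G \<Longrightarrow> x \<ominus> \<zero> = x" "x \<in> carrier G \<Longrightarrow> \<zero> \<ominus> x = \<ominus> x"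
  by (simp_all add: a_minus_def r_neg)

lemma linear_mapI:
  assumes "\<And>x. x \<in> carrier V \<Longrightarrow> f x \<in> carrier W"
    and "\<And>x y. \<lbrakk>x \<in> carrier V; y \<in> carrier V\<rbrakk> \<Longrightarrow> f (x \<oplus>\<^bsub>V\<^esub> y) = f x \<oplus>\<^bsub>W\<^esub> f y"
    and "\<And>c x. \<lbrakk>c \<in> carrier K; x \<in> carrier V\<rbrakk> \<Longrightarrow> f (c \<odot>\<^bsub>V\<^esub> x) = c \<odot>\<^bsub>W\<^esub> f x"
  shows "linear_map K V W f"
  using assms by (auto simp: linear_map_def)

locale linear = V: module K V + W: module K W
  for K :: "('k, 'r) ring_scheme" and V :: "('k, 'a) module" and W :: "('k, 'b) module" +
  fixes f :: "'a \<Rightarrow> 'b"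
  assumes map: "linear_map K V W f"
begin

lemma closed: "x \<in> carrier V \<Longrightarrow> f x \<in> carrier W"
  and add: "\<lbrakk>x \<in> carrier V; y \<in> carrier V\<rbrakk> \<Longrightarrow> f (x \<oplus>\<^bsub>V\<^esub> y) = f x \<oplus>\<^bsub>W\<^esub> f y"
  and smult: "\<lbrakk>c \<in> carrier K; x \<in> carrier V\<rbrakk> \<Longrightarrow> f (c \<odot>\<^bsub>V\<^esub> x) = c \<odot>\<^bsub>W\<^esub> f x"
  using map by (auto simp: linear_map_def)

lemma zero: "f \<zero>\<^bsub>V\<^esub> = \<zero>\<^bsub>W\<^esub>"
  by (metis V.M.zero_closed V.M.l_zero W.M.add.r_cancel_one' add closed)

lemma neg: "x \<in> carrier V \<Longrightarrow> f (\<ominus>\<^bsub>V\<^esub> x) = \<ominus>\<^bsub>W\<^esub> f x"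
  by (metis V.M.a_inv_closed V.M.l_neg W.M.minus_equality add closed zero)

lemma diff: "\<lbrakk>x \<in> carrier V; y \<in> carrier V\<rbrakk> \<Longrightarrow> f (x \<ominus>\<^bsub>V\<^esub> y) = f x \<ominus>\<^bsub>W\<^esub> f y"
  by (simp add: a_minus_def add neg)

lemmas simps = closed add smult zero neg diff

end

lemma (in module) smult_minus:
  "\<lbrakk>c \<in> carrier R; x \<in> carrier M; y \<in> carrier M\<rbrakk> \<Longrightarrow> c \<odot>\<^bsub>M\<^esub> (x \<ominus>\<^bsub>M\<^esub> y) = c \<odot>\<^bsub>M\<^esub> x \<ominus>\<^bsub>M\<^esub> c \<odot>\<^bsub>M\<^esub> y"
  by (simp add: a_minus_def smult_r_distr smult_r_minus)

lemmas (in module) smult_simps = smult_r_distr smult_r_minus smult_minus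

locale bilinear = U: module K U + V: module K V + W: module K W
  for K :: "('k, 'r) ring_scheme" and U :: "('k, 'a) module" and V :: "('k, 'b) module"
    and W :: "('k, 'c) module" +
  fixes f :: "'a \<Rightarrow> 'b \<Rightarrow> 'c"
  assumes map: "bilinear_map K U V W f"
begin

lemma right: "x \<in> carrier U \<Longrightarrow> linear K V W (f x)"
  and left: "y \<in> carrier V \<Longrightarrow> linear K U W (\<lambda>x. f x y)"
  using map by (auto simp: bilinear_map_def intro!: linear.intro linear_axioms.intro
    U.module_axioms V.module_axioms W.module_axioms)

lemmas simps = linear.simps[OF right] linear.simps(2-)[OF left]

end

locale trilinear = T: module K T + U: module K U + V: module K V + W: module K W
  for K :: "('k, 'r) ring_scheme" and T :: "('k, 'a) module" and U :: "('k, 'b) module"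
    and V :: "('k, 'c) module" and W :: "('k, 'd) module" +
  fixes f :: "'a \<Rightarrow> 'b \<Rightarrow> 'c \<Rightarrow> 'd"
  assumes map: "trilinear_map K T U V W f"
begin

lemma right: "x \<in> carrier T \<Longrightarrow> bilinear K U V W (f x)"
  and left: "\<lbrakk>y \<in> carrier U; z \<in> carrier V\<rbrakk> \<Longrightarrow> linear K T W (\<lambda>x. f x y z)"
  using map by (auto simp: trilinear_map_def intro!: linear.intro linear_axioms.intro
    bilinear.intro bilinear_axioms.intro
    T.module_axioms U.module_axioms V.module_axioms W.module_axioms)

lemmas simps = bilinear.simps[OF right] linear.simps(2-)[OF left]

end

lemma bilinear_mapI:
  assumes "\<And>x y. \<lbrakk>x \<in> carrier U; y \<in> carrier V\<rbrakk> \<Longrightarrow> f x y \<in> carrier W"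
    and "\<And>x y z. \<lbrakk>x \<in> carrier U; y \<in> carrier V; z \<in> carrier V\<rbrakk> \<Longrightarrow> f x (y \<oplus>\<^bsub>V\<^esub> z) = f x y \<oplus>\<^bsub>W\<^esub> f x z"
    and "\<And>c x y. \<lbrakk>c \<in> carrier K; x \<in> carrier U; y \<in> carrier V\<rbrakk> \<Longrightarrow> f x (c \<odot>\<^bsub>V\<^esub> y) = c \<odot>\<^bsub>W\<^esub> f x y"
    and "\<And>x y z. \<lbrakk>x \<in> carrier U; y \<in> carrier U; z \<in> carrier V\<rbrakk> \<Longrightarrow> f (x \<oplus>\<^bsub>U\<^esub> y) z = f x z \<oplus>\<^bsub>W\<^esub> f y z"
    and "\<And>c x y. \<lbrakk>c \<in> carrier K; x \<in> carrier U; y \<in> carrier V\<rbrakk> \<Longrightarrow> f (c \<odot>\<^bsub>U\<^esub> x) y = c \<odot>\<^bsub>W\<^esub> f x y"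
  shows "bilinear_map K U V W f"
  using assms by (auto simp: bilinear_map_def intro!: linear_mapI)

lemma trilinear_mapI:
  assumes "\<And>x. x \<in> carrier T \<Longrightarrow> bilinear_map K U V W (f x)"
    and "\<And>x y u v. \<lbrakk>x \<in> carrier T; y \<in> carrier T; u \<in> carrier U; v \<in> carrier V\<rbrakk>
      \<Longrightarrow> f (x \<oplus>\<^bsub>T\<^esub> y) u v = f x u v \<oplus>\<^bsub>W\<^esub> f y u v"
    and "\<And>c x u v. \<lbrakk>c \<in> carrier K; x \<in> carrier T; u \<in> carrier U; v \<in> carrier V\<rbrakk>
      \<Longrightarrow> f (c \<odot>\<^bsub>T\<^esub> x) u v = c \<odot>\<^bsub>W\<^esub> f x u v"
  shows "trilinear_map K T U V W f"
  using assms by (auto simp: trilinear_map_def bilinear_map_def linear_map_def Pi_def)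

section \<open>The 2-category of 2-term \<open>EL\<^sub>\<infinity>\<close>-algebras\<close>

context two_term_complex
begin

lemma embedded0: "embedded_group (deg0 C)" and embedded1: "embedded_group (degm1 C)"
  by (intro embedded_group.intro C0.abelian_group_axioms C1.abelian_group_axioms)+

lemma linear_diff: "linear K (degm1 C) (deg0 C) \<delta>"
  by (intro linear.intro linear_axioms.intro C0.module_axioms C1.module_axioms diff_linear)

lemmas diff_simps = linear.simps[OF linear_diff]

lemmas emb0 = embedded_group.emb_simps[OF embedded0]
lemmas emb1 = embedded_group.emb_simps[OF embedded1]
lemmas emb1_add = embedded_group.emb_simps(2-)[OF embedded1]

lemmas group_closed = C0.M.a_closed C0.M.a_inv_closed C0.M.minus_closed C0.M.zero_closed
    C0.smult_closed
  C1.M.a_closed C1.M.a_inv_closed C1.M.minus_closed C1.M.zero_closed C1.smult_closed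

lemmas smult_simps = C0.smult_simps C1.smult_simps

end

context el2_algebra
begin

lemma
  shows bilinear_b00: "bilinear K (deg0 C) (deg0 C) (deg0 C) (b00 C)"
    and bilinear_b01: "bilinear K (deg0 C) (degm1 C) (degm1 C) (b01 C)"
    and bilinear_b10: "bilinear K (degm1 C) (deg0 C) (degm1 C) (b10 C)"
    and bilinear_pairing: "bilinear K (deg0 C) (deg0 C) (degm1 C) (pairing C)"
    and trilinear_ternary: "trilinear K (deg0 C) (deg0 C) (deg0 C) (degm1 C) (ternary C)"
  by (intro bilinear.intro bilinear_axioms.intro trilinear.intro trilinear_axioms.intro
      C0.module_axioms C1.module_axioms b00_bilinear b01_bilinear b10_bilinear pairing_bilinear
      ternary_trilinear)+

lemmas operations = bilinear.simps[OF bilinear_b00] bilinear.simps[OF bilinear_b01]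
  bilinear.simps[OF bilinear_b10] bilinear.simps[OF bilinear_pairing]
  trilinear.simps[OF trilinear_ternary] diff_simps

text \<open>Both sides are the derived bracket of \<open>a\<close> and \<open>b\<close>. The right
  one is taken as normal form, matching the definition of \<open>derived\<close>.\<close>

lemma b01_diff_comm: "\<lbrakk>a \<in> carrier (degm1 C); b \<in> carrier (degm1 C)\<rbrakk> \<Longrightarrow> [a, \<delta> b]\<^sub>1\<^sub>0 = [\<delta> a, b]\<^sub>0\<^sub>1"
  by (simp add: b01_b10)

lemmas brackets = diff_b01 diff_b10 b01_diff_comm

end

context el2_hom
begin

lemma linear_f0: "linear K (deg0 C) (deg0 C') f0"
  and linear_f1: "linear K (degm1 C) (degm1 C') f1"
  using chain_map unfolding chain_map_def
  by (auto intro!: linear.intro linear_axioms.intro dom.C0.module_axioms dom.C1.module_axioms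
      cod.C0.module_axioms cod.C1.module_axioms)

lemma bilinear_f2: "bilinear K (deg0 C) (deg0 C) (degm1 C') f2"
  by (intro bilinear.intro bilinear_axioms.intro dom.C0.module_axioms cod.C1.module_axioms
      f2_bilinear)

lemmas maps = linear.simps[OF linear_f0] linear.simps[OF linear_f1] bilinear.simps[OF bilinear_f2]

lemma diff_f1: "a \<in> carrier (degm1 C) \<Longrightarrow> \<delta>\<^bsub>C'\<^esub> (f1 a) = f0 (\<delta>\<^bsub>C\<^esub> a)"
  using chain_map by (simp add: chain_map_def)

text \<open>The axioms of a morphism are solved for one term each, so that they rewrite:
  \<open>f1\<close> moves inside brackets, \<open>\<delta>\<close> of \<open>f2\<close> is
  eliminated, and the pairing and ternary operation of images are expressed by those of the domain.
  What remains of \<open>f1\<close> stands on pairings, ternary operations and plain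
  elements.\<close>

lemma f1_b01: "\<lbrakk>x \<in> carrier (deg0 C); b \<in> carrier (degm1 C)\<rbrakk>
    \<Longrightarrow> f1 [x, b]\<^sub>0\<^sub>1\<^bsub>C\<^esub> = [f0 x, f1 b]\<^sub>0\<^sub>1\<^bsub>C'\<^esub> \<ominus>\<^bsub>degm1 C'\<^esub> f2 x (\<delta>\<^bsub>C\<^esub> b)"
  using bracket01[of x b]
  by (simp add: dom.operations cod.operations maps cod.emb1 algebra_simps)

lemma f1_b10: "\<lbrakk>a \<in> carrier (degm1 C); y \<in> carrier (deg0 C)\<rbrakk>
    \<Longrightarrow> f1 [a, y]\<^sub>1\<^sub>0\<^bsub>C\<^esub> = [f1 a, f0 y]\<^sub>1\<^sub>0\<^bsub>C'\<^esub> \<ominus>\<^bsub>degm1 C'\<^esub> f2 (\<delta>\<^bsub>C\<^esub> a) y"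
  using bracket10[of a y]
  by (simp add: dom.operations cod.operations maps cod.emb1 algebra_simps)

lemma diff_f2: "\<lbrakk>x \<in> carrier (deg0 C); y \<in> carrier (deg0 C)\<rbrakk>
    \<Longrightarrow> \<delta>\<^bsub>C'\<^esub> (f2 x y) = [f0 x, f0 y]\<^sub>0\<^sub>0\<^bsub>C'\<^esub> \<ominus>\<^bsub>deg0 C'\<^esub> f0 [x, y]\<^sub>0\<^sub>0\<^bsub>C\<^esub>"
  by (simp add: bracket00)

lemma pairing_f: "\<lbrakk>x \<in> carrier (deg0 C); y \<in> carrier (deg0 C)\<rbrakk>
    \<Longrightarrow> \<langle>f0 x, f0 y\<rangle>\<^bsub>C'\<^esub> = f1 \<langle>x, y\<rangle>\<^bsub>C\<^esub> \<oplus>\<^bsub>degm1 C'\<^esub> (f2 x y \<oplus>\<^bsub>degm1 C'\<^esub> f2 y x)"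
  using pairing[of x y]
  by (simp add: dom.operations cod.operations maps cod.emb1 cod.group_closed algebra_simps)

lemma ternary_f: "\<lbrakk>x \<in> carrier (deg0 C); y \<in> carrier (deg0 C); z \<in> carrier (deg0 C)\<rbrakk>
    \<Longrightarrow> \<langle>f0 x, f0 y, f0 z\<rangle>\<^bsub>C'\<^esub> = f1 \<langle>x, y, z\<rangle>\<^bsub>C\<^esub> \<oplus>\<^bsub>degm1 C'\<^esub> (
      [f0 x, f2 y z]\<^sub>0\<^sub>1\<^bsub>C'\<^esub> \<ominus>\<^bsub>degm1 C'\<^esub> [f0 y, f2 x z]\<^sub>0\<^sub>1\<^bsub>C'\<^esub> \<ominus>\<^bsub>degm1 C'\<^esub> [f2 x y, f0 z]\<^sub>1\<^sub>0\<^bsub>C'\<^esub>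
        \<ominus>\<^bsub>degm1 C'\<^esub> f2 [x, y]\<^sub>0\<^sub>0\<^bsub>C\<^esub> z \<ominus>\<^bsub>degm1 C'\<^esub> f2 y [x, z]\<^sub>0\<^sub>0\<^bsub>C\<^esub> \<oplus>\<^bsub>degm1 C'\<^esub> f2 x [y, z]\<^sub>0\<^sub>0\<^bsub>C\<^esub>)"
  using ternary[of x y z]
  by (simp add: dom.operations cod.operations maps cod.emb1 cod.group_closed algebra_simps)

text \<open>Resolves an overlap: \<open>diff_f1\<close> turns \<open>\<delta> (f1 b)\<close> into
  \<open>f0 (\<delta> b)\<close>, after which \<open>b01_diff_comm\<close> no longer recognises the
  derived bracket.\<close>

lemma b10_f0_diff: "\<lbrakk>a \<in> carrier (degm1 C'); b \<in> carrier (degm1 C)\<rbrakk>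
    \<Longrightarrow> [a, f0 (\<delta>\<^bsub>C\<^esub> b)]\<^sub>1\<^sub>0\<^bsub>C'\<^esub> = [\<delta>\<^bsub>C'\<^esub> a, f1 b]\<^sub>0\<^sub>1\<^bsub>C'\<^esub>"
  by (simp flip: diff_f1 add: cod.b01_diff_comm maps)

lemmas pushes = b10_f0_diff diff_f1 f1_b01 f1_b10 diff_f2 pairing_f ternary_f

lemmas rewrite_rules = maps pushes dom.operations cod.operations dom.brackets cod.brackets
  dom.group_closed cod.group_closed dom.smult_simps cod.smult_simps

end

section \<open>Identities and composites of morphisms\<close>

lemma restrict2_extensional2: "restrict2 f A \<in> extensional2 A"
  by (auto simp: restrict2_def extensional2_def)

lemma (in el2_algebra) el2_hom_id:
  "el2_hom K C C (restrict (\<lambda>x. x) (carrier (deg0 C))) (restrict (\<lambda>a. a) (carrier (degm1 C)))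
    (restrict2 (\<lambda>x y. \<zero>\<^bsub>degm1 C\<^esub>) (carrier (deg0 C)))"
proof unfold_locales
  note [simp] = operations group_closed C1.smult_r_null
  show "chain_map K C C (restrict (\<lambda>x. x) (carrier (deg0 C))) (restrict (\<lambda>a. a) (carrier (degm1 C)))"
    by (auto simp: chain_map_def intro!: linear_mapI)
  show "bilinear_map K (deg0 C) (deg0 C) (degm1 C)
      (restrict2 (\<lambda>x y. \<zero>\<^bsub>degm1 C\<^esub>) (carrier (deg0 C)))"
    by (rule bilinear_mapI) (simp_all add: restrict2_def)
qed (simp_all add: restrict2_extensional2 operations group_closed emb0 emb1, simp_all add:
    restrict2_def operations group_closed emb0 emb1)

text \<open>With the axioms of both morphisms as rewrite rules, the two sides of every equation
  reduce to sums of the same terms, which the ambient group compares.\<close>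

lemma el2_hom_comp:
  assumes "el2_hom K C C' f0 f1 f2" "el2_hom K C' C'' g0 g1 g2"
  shows "el2_hom K C C'' (compose (carrier (deg0 C)) g0 f0) (compose (carrier (degm1 C)) g1 f1)
    (restrict2 (\<lambda>x y. g2 (f0 x) (f0 y) \<oplus>\<^bsub>degm1 C''\<^esub> g1 (f2 x y)) (carrier (deg0 C)))"
proof -
  interpret f: el2_hom K C C' f0 f1 f2 by fact
  interpret g: el2_hom K C' C'' g0 g1 g2 by fact
  note [simp] = f.rewrite_rules g.rewrite_rules
  let ?f0 = "compose (carrier (deg0 C)) g0 f0" and ?f1 = "compose (carrier (degm1 C)) g1 f1"
    and ?f2 = "restrict2 (\<lambda>x y. g2 (f0 x) (f0 y) \<oplus>\<^bsub>degm1 C''\<^esub> g1 (f2 x y)) (carrier (deg0 C))"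
  have 0: "x \<in> carrier (deg0 C) \<Longrightarrow> ?f0 x = g0 (f0 x)" for x by (simp add: compose_def)
  have 1: "a \<in> carrier (degm1 C) \<Longrightarrow> ?f1 a = g1 (f1 a)" for a by (simp add: compose_def)
  have 2: "\<lbrakk>x \<in> carrier (deg0 C); y \<in> carrier (deg0 C)\<rbrakk>
      \<Longrightarrow> ?f2 x y = g2 (f0 x) (f0 y) \<oplus>\<^bsub>degm1 C''\<^esub> g1 (f2 x y)" for x y
    by (simp add: restrict2_def)
  show ?thesis
  proof unfold_locales
    show "chain_map K C C'' ?f0 ?f1"
      by (auto simp: chain_map_def 0 1 intro!: linear_mapI)
    show "bilinear_map K (deg0 C) (deg0 C) (degm1 C'') ?f2"
      by (rule bilinear_mapI) (simp_all add: 2 g.cod.emb1 algebra_simps)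
  next
    fix x y assume "x \<in> carrier (deg0 C)" "y \<in> carrier (deg0 C)"
    then show "[?f0 x, ?f0 y]\<^sub>0\<^sub>0\<^bsub>C''\<^esub> \<ominus>\<^bsub>deg0 C''\<^esub> ?f0 [x, y]\<^sub>0\<^sub>0\<^bsub>C\<^esub> = \<delta>\<^bsub>C''\<^esub> (?f2 x y)"
      by (simp add: 0 2 g.cod.emb0)
  next
    fix a y assume "a \<in> carrier (degm1 C)" "y \<in> carrier (deg0 C)"
    then show "[?f1 a, ?f0 y]\<^sub>1\<^sub>0\<^bsub>C''\<^esub> \<ominus>\<^bsub>degm1 C''\<^esub> ?f1 [a, y]\<^sub>1\<^sub>0\<^bsub>C\<^esub> = ?f2 (\<delta>\<^bsub>C\<^esub> a) y"
      by (simp add: 0 1 2 g.cod.emb1)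
  next
    fix x b assume "x \<in> carrier (deg0 C)" "b \<in> carrier (degm1 C)"
    then show "[?f0 x, ?f1 b]\<^sub>0\<^sub>1\<^bsub>C''\<^esub> \<ominus>\<^bsub>degm1 C''\<^esub> ?f1 [x, b]\<^sub>0\<^sub>1\<^bsub>C\<^esub> = ?f2 x (\<delta>\<^bsub>C\<^esub> b)"
      by (simp add: 0 1 2 g.cod.emb1)
  next
    fix x y assume "x \<in> carrier (deg0 C)" "y \<in> carrier (deg0 C)"
    then show "\<langle>?f0 x, ?f0 y\<rangle>\<^bsub>C''\<^esub> \<ominus>\<^bsub>degm1 C''\<^esub> ?f1 \<langle>x, y\<rangle>\<^bsub>C\<^esub> = ?f2 x y \<oplus>\<^bsub>degm1 C''\<^esub> ?f2 y x"
      by (simp add: 0 1 2 g.cod.emb1)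
  next
    fix x y z assume "x \<in> carrier (deg0 C)" "y \<in> carrier (deg0 C)" "z \<in> carrier (deg0 C)"
    then show "\<langle>?f0 x, ?f0 y, ?f0 z\<rangle>\<^bsub>C''\<^esub> \<ominus>\<^bsub>degm1 C''\<^esub> ?f1 \<langle>x, y, z\<rangle>\<^bsub>C\<^esub>
      = [?f0 x, ?f2 y z]\<^sub>0\<^sub>1\<^bsub>C''\<^esub> \<ominus>\<^bsub>degm1 C''\<^esub> [?f0 y, ?f2 x z]\<^sub>0\<^sub>1\<^bsub>C''\<^esub> \<ominus>\<^bsub>degm1 C''\<^esub> [?f2 x y,
          ?f0 z]\<^sub>1\<^sub>0\<^bsub>C''\<^esub>
        \<ominus>\<^bsub>degm1 C''\<^esub> ?f2 [x, y]\<^sub>0\<^sub>0\<^bsub>C\<^esub> z \<ominus>\<^bsub>degm1 C''\<^esub> ?f2 y [x, z]\<^sub>0\<^sub>0\<^bsub>C\<^esub> \<oplus>\<^bsub>degm1 C''\<^esub> ?f2 x [y,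
            z]\<^sub>0\<^sub>0\<^bsub>C\<^esub>"
      by (simp add: 0 1 2 g.cod.emb1)
  qed (simp_all add: restrict2_extensional2)
qed

lemma extensional2_eqI:
  assumes "f \<in> extensional2 A" "g \<in> extensional2 A"
    and "\<And>x y. \<lbrakk>x \<in> A; y \<in> A\<rbrakk> \<Longrightarrow> f x y = g x y"
  shows "f = g"
proof (intro ext)
  fix x y
  show "f x y = g x y"
    by (cases "x \<in> A \<and> y \<in> A") (use assms in \<open>auto simp: extensional2_def\<close>)
qed

lemma el2_morphism_eqI:
  assumes "el2_morphism K f" "el2_morphism K g" "mdom f = mdom g" "mcod f = mcod g"
    and "\<And>x. x \<in> carrier (deg0 (mdom g)) \<Longrightarrow> m0 f x = m0 g x"
    and "\<And>a. a \<in> carrier (degm1 (mdom g)) \<Longrightarrow> m1 f a = m1 g a"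
    and "\<And>x y. \<lbrakk>x \<in> carrier (deg0 (mdom g)); y \<in> carrier (deg0 (mdom g))\<rbrakk> \<Longrightarrow> m2 f x y = m2 g x y"
  shows "f = (g :: ('k, 'v) el2_mor)"
proof -
  interpret f: el2_hom K "mdom f" "mcod f" "m0 f" "m1 f" "m2 f"
    using assms(1) by (simp add: el2_morphism_def)
  interpret g: el2_hom K "mdom g" "mcod g" "m0 g" "m1 g" "m2 g"
    using assms(2) by (simp add: el2_morphism_def)
  note ext = f.extensional[unfolded assms(3)]
  have "m0 f = m0 g" "m1 f = m1 g" "m2 f = m2 g"
    using extensionalityI[OF ext(1) g.extensional(1)] extensionalityI[OF ext(2) g.extensional(2)]
      extensional2_eqI[OF ext(3) g.extensional(3)] assms(5-7) by blast+
  then show ?thesis using assms(3,4) by simp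
qed

lemma el2_morphism_id: "el2_algebra K C \<Longrightarrow> el2_morphism K (el2_id C)"
  by (simp add: el2_morphism_def el2_id_def el2_algebra.el2_hom_id)

lemma el2_morphism_comp:
  "\<lbrakk>el2_morphism K f; el2_morphism K g; mcod f = mdom g\<rbrakk> \<Longrightarrow> el2_morphism K (el2_comp g f)"
  by (simp add: el2_morphism_def el2_comp_def el2_hom_comp)

lemma el2_comp_simps:
  "mdom (el2_comp g f) = mdom f" "mcod (el2_comp g f) = mcod g"
  "x \<in> carrier (deg0 (mdom f)) \<Longrightarrow> m0 (el2_comp g f) x = m0 g (m0 f x)"
  "a \<in> carrier (degm1 (mdom f)) \<Longrightarrow> m1 (el2_comp g f) a = m1 g (m1 f a)"
  "\<lbrakk>x \<in> carrier (deg0 (mdom f)); y \<in> carrier (deg0 (mdom f))\<rbrakk>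
    \<Longrightarrow> m2 (el2_comp g f) x y = m2 g (m0 f x) (m0 f y) \<oplus>\<^bsub>degm1 (mcod g)\<^esub> m1 g (m2 f x y)"
  by (simp_all add: el2_comp_def compose_def restrict2_def)

lemma el2_id_simps:
  "mdom (el2_id C) = C" "mcod (el2_id C) = C"
  "x \<in> carrier (deg0 C) \<Longrightarrow> m0 (el2_id C) x = x"
  "a \<in> carrier (degm1 C) \<Longrightarrow> m1 (el2_id C) a = a"
  "\<lbrakk>x \<in> carrier (deg0 C); y \<in> carrier (deg0 C)\<rbrakk> \<Longrightarrow> m2 (el2_id C) x y = \<zero>\<^bsub>degm1 C\<^esub>"
  by (simp_all add: el2_id_def restrict2_def)

lemma el2_comp_id_right:
  assumes "el2_morphism K f"
  shows "el2_comp f (el2_id (mdom f)) = f"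
proof -
  interpret f: el2_hom K "mdom f" "mcod f" "m0 f" "m1 f" "m2 f"
    using assms by (simp add: el2_morphism_def)
  show ?thesis
    by (rule el2_morphism_eqI[of K])
      (simp_all add: assms el2_morphism_comp el2_morphism_id f.dom.el2_algebra_axioms
        el2_comp_simps el2_id_simps f.rewrite_rules f.cod.emb1)
qed

lemma el2_comp_id_left:
  assumes "el2_morphism K f"
  shows "el2_comp (el2_id (mcod f)) f = f"
proof -
  interpret f: el2_hom K "mdom f" "mcod f" "m0 f" "m1 f" "m2 f"
    using assms by (simp add: el2_morphism_def)
  show ?thesis
    by (rule el2_morphism_eqI[of K])
      (simp_all add: assms el2_morphism_comp el2_morphism_id f.cod.el2_algebra_axioms
        el2_comp_simps el2_id_simps f.rewrite_rules f.cod.emb1)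
qed

lemma el2_comp_assoc:
  assumes "el2_morphism K f" "el2_morphism K g" "el2_morphism K h"
    and "mcod f = mdom g" "mcod g = mdom h"
  shows "el2_comp h (el2_comp g f) = el2_comp (el2_comp h g) f"
proof -
  interpret f: el2_hom K "mdom f" "mdom g" "m0 f" "m1 f" "m2 f"
    using assms(1,4) by (simp add: el2_morphism_def)
  interpret g: el2_hom K "mdom g" "mdom h" "m0 g" "m1 g" "m2 g"
    using assms(2,5) by (simp add: el2_morphism_def)
  interpret h: el2_hom K "mdom h" "mcod h" "m0 h" "m1 h" "m2 h"
    using assms(3) by (simp add: el2_morphism_def)
  show ?thesis
    by (rule el2_morphism_eqI[of K])
      (simp_all add: assms el2_morphism_comp el2_comp_simps f.maps g.maps h.maps
        h.cod.group_closed h.cod.emb1)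
qed

section \<open>Homotopies between morphisms and their two compositions\<close>

locale el2_homotopy = f: el2_hom K C C' f0 f1 f2 + g: el2_hom K C C' g0 g1 g2
  for K :: "('k, 'r) ring_scheme" and C C' :: "('k, 'v) el2"
    and f0 f1 :: "'v \<Rightarrow> 'v" and f2 and g0 g1 :: "'v \<Rightarrow> 'v" and g2 +
  fixes \<theta> :: "'v \<Rightarrow> 'v"
  assumes homotopy_extensional: "\<theta> \<in> extensional (carrier (deg0 C))"
    and homotopy_linear: "linear_map K (deg0 C) (degm1 C') \<theta>"
    and homotopy0: "x \<in> carrier (deg0 C) \<Longrightarrow> f0 x \<ominus>\<^bsub>deg0 C'\<^esub> g0 x = \<delta>\<^bsub>C'\<^esub> (\<theta> x)"
    and homotopy1: "a \<in> carrier (degm1 C) \<Longrightarrow> f1 a \<ominus>\<^bsub>degm1 C'\<^esub> g1 a = \<theta> (\<delta>\<^bsub>C\<^esub> a)"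
    and homotopy_bracket: "\<lbrakk>x \<in> carrier (deg0 C); y \<in> carrier (deg0 C)\<rbrakk> \<Longrightarrow>
      f2 x y \<ominus>\<^bsub>degm1 C'\<^esub> g2 x y
      = [f0 x, \<theta> y]\<^sub>0\<^sub>1\<^bsub>C'\<^esub> \<oplus>\<^bsub>degm1 C'\<^esub> [\<theta> x, f0 y]\<^sub>1\<^sub>0\<^bsub>C'\<^esub>
        \<ominus>\<^bsub>degm1 C'\<^esub> \<theta> [x, y]\<^sub>0\<^sub>0\<^bsub>C\<^esub> \<ominus>\<^bsub>degm1 C'\<^esub> [\<theta> x, \<theta> y]\<^sub>1\<^sub>1\<^bsub>C'\<^esub>"
begin

lemma linear_homotopy: "linear K (deg0 C) (degm1 C') \<theta>"
  by (intro linear.intro linear_axioms.intro f.dom.C0.module_axioms f.cod.C1.module_axioms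
      homotopy_linear)

lemmas homotopy_simps = linear.simps[OF linear_homotopy]

text \<open>A homotopy and its source determine its target. Solving for the target eliminates it
  from every goal about 2-cells, leaving the source 1-cell and the homotopies.\<close>

lemma target0: "x \<in> carrier (deg0 C) \<Longrightarrow> g0 x = f0 x \<ominus>\<^bsub>deg0 C'\<^esub> \<delta>\<^bsub>C'\<^esub> (\<theta> x)"
  using homotopy0[of x]
  by (simp add: f.maps g.maps f.cod.operations homotopy_simps f.cod.group_closed f.cod.emb0
      algebra_simps)

lemma target1: "a \<in> carrier (degm1 C) \<Longrightarrow> g1 a = f1 a \<ominus>\<^bsub>degm1 C'\<^esub> \<theta> (\<delta>\<^bsub>C\<^esub> a)"
  using homotopy1[of a]
  by (simp add: f.maps g.maps f.dom.operations homotopy_simps f.cod.group_closed f.cod.emb1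
      algebra_simps)

lemma target2: "\<lbrakk>x \<in> carrier (deg0 C); y \<in> carrier (deg0 C)\<rbrakk> \<Longrightarrow>
      g2 x y = f2 x y \<ominus>\<^bsub>degm1 C'\<^esub> ([f0 x, \<theta> y]\<^sub>0\<^sub>1\<^bsub>C'\<^esub> \<oplus>\<^bsub>degm1 C'\<^esub> [\<theta> x, f0 y]\<^sub>1\<^sub>0\<^bsub>C'\<^esub>
        \<ominus>\<^bsub>degm1 C'\<^esub> \<theta> [x, y]\<^sub>0\<^sub>0\<^bsub>C\<^esub> \<ominus>\<^bsub>degm1 C'\<^esub> [\<delta>\<^bsub>C'\<^esub> (\<theta> x), \<theta> y]\<^sub>0\<^sub>1\<^bsub>C'\<^esub>)"
  using homotopy_bracket[of x y]
  by (simp add: f.maps g.maps f.dom.operations f.cod.operations homotopy_simps f.cod.group_closed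
      f.cod.emb1 derived_def algebra_simps)

lemmas target = target0 target1 target2

end

text \<open>\<open>el2_homotopy\<close> imposes the same conditions on unbundled maps. Having both
  1-cells as parent locales over the same \<open>C\<close> and \<open>C'\<close> makes their rewrite
  rules available together.\<close>

lemma el2_two_hom_iff:
  "el2_two_hom K f g \<theta> \<longleftrightarrow> mdom g = mdom f \<and> mcod g = mcod f
    \<and> el2_homotopy K (mdom f) (mcod f) (m0 f) (m1 f) (m2 f) (m0 g) (m1 g) (m2 g) \<theta>"
  by (auto simp: el2_two_hom_def el2_homotopy_def el2_homotopy_axioms_def el2_morphism_def)

text \<open>The bracket condition is quadratic, so it is not obviously additive. Replacing
  \<open>g0\<close> by \<open>f0 - \<delta> \<theta>\<close> in the condition for
  \<open>\<psi>\<close> creates the two mixed derived brackets of \<open>\<theta>\<close> and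
  \<open>\<psi>\<close>, which complete the square of \<open>\<psi> + \<theta>\<close>.\<close>

lemma el2_homotopy_vcomp:
  assumes "el2_homotopy K C C' f0 f1 f2 g0 g1 g2 \<theta>" "el2_homotopy K C C' g0 g1 g2 h0 h1 h2 \<psi>"
  shows "el2_homotopy K C C' f0 f1 f2 h0 h1 h2
    (restrict (\<lambda>x. \<psi> x \<oplus>\<^bsub>degm1 C'\<^esub> \<theta> x) (carrier (deg0 C)))"
proof -
  interpret \<theta>: el2_homotopy K C C' f0 f1 f2 g0 g1 g2 \<theta> by fact
  interpret \<psi>: el2_homotopy K C C' g0 g1 g2 h0 h1 h2 \<psi> by fact
  note [simp] = \<theta>.f.rewrite_rules \<theta>.homotopy_simps \<psi>.homotopy_simps \<theta>.target \<psi>.target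
  show ?thesis
  proof unfold_locales
    show "linear_map K (deg0 C) (degm1 C') (restrict (\<lambda>x. \<psi> x \<oplus>\<^bsub>degm1 C'\<^esub> \<theta> x) (carrier (deg0 C)))"
      by (rule linear_mapI) (simp_all add: \<theta>.f.cod.emb1)
  qed (simp_all add: \<theta>.f.cod.emb0 \<theta>.f.cod.emb1 derived_def)
qed

text \<open>The composite passes through the 1-cell \<open>g f'\<close>: the summand
  \<open>g1 \<theta>\<close> leads from \<open>g f\<close> to \<open>g f'\<close>, and
  \<open>\<psi> f0'\<close> from there to \<open>g' f'\<close>.\<close>

lemma el2_homotopy_hcomp:
  assumes "el2_homotopy K C C' f0 f1 f2 f0' f1' f2' \<theta>" "el2_homotopy K C' C'' g0 g1 g2 g0' g1' g2' \<psi>"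
  shows "el2_homotopy K C C''
    (compose (carrier (deg0 C)) g0 f0) (compose (carrier (degm1 C)) g1 f1)
    (restrict2 (\<lambda>x y. g2 (f0 x) (f0 y) \<oplus>\<^bsub>degm1 C''\<^esub> g1 (f2 x y)) (carrier (deg0 C)))
    (compose (carrier (deg0 C)) g0' f0') (compose (carrier (degm1 C)) g1' f1')
    (restrict2 (\<lambda>x y. g2' (f0' x) (f0' y) \<oplus>\<^bsub>degm1 C''\<^esub> g1' (f2' x y)) (carrier (deg0 C)))
    (restrict (\<lambda>x. g1 (\<theta> x) \<oplus>\<^bsub>degm1 C''\<^esub> \<psi> (f0' x)) (carrier (deg0 C)))"
proof -
  interpret \<theta>: el2_homotopy K C C' f0 f1 f2 f0' f1' f2' \<theta> by fact
  interpret \<psi>: el2_homotopy K C' C'' g0 g1 g2 g0' g1' g2' \<psi> by fact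
  note [simp] = \<theta>.f.rewrite_rules \<psi>.f.rewrite_rules \<theta>.homotopy_simps \<psi>.homotopy_simps \<theta>.target
      \<psi>.target
  \<comment> \<open>Both ends are composites already known to be morphisms, so only the conditions
    on the homotopy itself remain.\<close>
  interpret f: el2_hom K C C'' "compose (carrier (deg0 C)) g0 f0" "compose (carrier (degm1 C)) g1 f1"
    "restrict2 (\<lambda>x y. g2 (f0 x) (f0 y) \<oplus>\<^bsub>degm1 C''\<^esub> g1 (f2 x y)) (carrier (deg0 C))"
    by (rule el2_hom_comp[OF \<theta>.f.el2_hom_axioms \<psi>.f.el2_hom_axioms])
  interpret g: el2_hom K C C'' "compose (carrier (deg0 C)) g0' f0'" "compose (carrier (degm1 C))
      g1' f1'"
    "restrict2 (\<lambda>x y. g2' (f0' x) (f0' y) \<oplus>\<^bsub>degm1 C''\<^esub> g1' (f2' x y)) (carrier (deg0 C))"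
    by (rule el2_hom_comp[OF \<theta>.g.el2_hom_axioms \<psi>.g.el2_hom_axioms])
  show ?thesis
  proof unfold_locales
    show "linear_map K (deg0 C) (degm1 C'')
        (restrict (\<lambda>x. g1 (\<theta> x) \<oplus>\<^bsub>degm1 C''\<^esub> \<psi> (f0' x)) (carrier (deg0 C)))"
      by (rule linear_mapI) (simp_all add: \<psi>.f.cod.emb1)
  qed (simp_all add: compose_def restrict2_def \<psi>.f.cod.emb0 \<psi>.f.cod.emb1 derived_def)
qed

section \<open>2-cells and the axioms of the 2-category\<close>

definition el2_cell :: "('k, 'r) ring_scheme \<Rightarrow> ('k, 'v) el2_cell \<Rightarrow> bool" where
  "el2_cell K \<theta> \<longleftrightarrow> el2_two_hom K (csrc \<theta>) (ctrg \<theta>) (cmap \<theta>)"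

lemma el2_cellD:
  assumes "el2_cell K \<theta>"
  shows "el2_morphism K (csrc \<theta>)" "el2_morphism K (ctrg \<theta>)"
    and "mdom (ctrg \<theta>) = mdom (csrc \<theta>)" "mcod (ctrg \<theta>) = mcod (csrc \<theta>)"
    and "el2_homotopy K (mdom (csrc \<theta>)) (mcod (csrc \<theta>)) (m0 (csrc \<theta>)) (m1 (csrc \<theta>)) (m2 (csrc \<theta>))
      (m0 (ctrg \<theta>)) (m1 (ctrg \<theta>)) (m2 (ctrg \<theta>)) (cmap \<theta>)"
  using assms el2_two_hom.cells1[of K "csrc \<theta>" "ctrg \<theta>" "cmap \<theta>"]
  by (simp_all add: el2_cell_def el2_two_hom_iff)

lemma el2_cell_eqI:
  assumes "el2_cell K \<theta>" "el2_cell K \<psi>" "csrc \<theta> = csrc \<psi>" "ctrg \<theta> = ctrg \<psi>"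
    and "\<And>x. x \<in> carrier (deg0 (mdom (csrc \<psi>))) \<Longrightarrow> cmap \<theta> x = cmap \<psi> x"
  shows "\<theta> = (\<psi> :: ('k, 'v) el2_cell)"
proof -
  interpret \<theta>: el2_two_hom K "csrc \<theta>" "ctrg \<theta>" "cmap \<theta>" using assms(1) by (simp add: el2_cell_def)
  interpret \<psi>: el2_two_hom K "csrc \<psi>" "ctrg \<psi>" "cmap \<psi>" using assms(2) by (simp add: el2_cell_def)
  have "cmap \<theta> = cmap \<psi>"
    using extensionalityI[OF \<theta>.extensional[unfolded assms(3)] \<psi>.extensional] assms(5) by blast
  then show ?thesis using assms(3,4) by simp
qed

lemma el2_id2_simps:
  "csrc (el2_id2 f) = f" "ctrg (el2_id2 f) = f"
  "x \<in> carrier (deg0 (mdom f)) \<Longrightarrow> cmap (el2_id2 f) x = \<zero>\<^bsub>degm1 (mcod f)\<^esub>"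
  by (simp_all add: el2_id2_def)

lemma el2_vcomp_simps:
  "csrc (el2_vcomp \<psi> \<theta>) = csrc \<theta>" "ctrg (el2_vcomp \<psi> \<theta>) = ctrg \<psi>"
  "x \<in> carrier (deg0 (mdom (csrc \<theta>)))
    \<Longrightarrow> cmap (el2_vcomp \<psi> \<theta>) x = cmap \<psi> x \<oplus>\<^bsub>degm1 (mcod (csrc \<theta>))\<^esub> cmap \<theta> x"
  by (simp_all add: el2_vcomp_def)

lemma el2_hcomp_simps:
  "csrc (el2_hcomp \<psi> \<theta>) = el2_comp (csrc \<psi>) (csrc \<theta>)" "ctrg (el2_hcomp \<psi> \<theta>) = el2_comp (ctrg \<psi>)
      (ctrg \<theta>)"
  "x \<in> carrier (deg0 (mdom (csrc \<theta>)))
    \<Longrightarrow> cmap (el2_hcomp \<psi> \<theta>) x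
      = m1 (csrc \<psi>) (cmap \<theta> x) \<oplus>\<^bsub>degm1 (mcod (csrc \<psi>))\<^esub> cmap \<psi> (m0 (ctrg \<theta>) x)"
  by (simp_all add: el2_hcomp_def)

lemma el2_cell_id2:
  assumes "el2_morphism K f"
  shows "el2_cell K (el2_id2 f)"
proof -
  interpret f: el2_hom K "mdom f" "mcod f" "m0 f" "m1 f" "m2 f"
    using assms by (simp add: el2_morphism_def)
  note [simp] = f.rewrite_rules
  have "el2_homotopy K (mdom f) (mcod f) (m0 f) (m1 f) (m2 f) (m0 f) (m1 f) (m2 f)
    (restrict (\<lambda>x. \<zero>\<^bsub>degm1 (mcod f)\<^esub>) (carrier (deg0 (mdom f))))"
  proof unfold_locales
    show "linear_map K (deg0 (mdom f)) (degm1 (mcod f))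
      (restrict (\<lambda>x. \<zero>\<^bsub>degm1 (mcod f)\<^esub>) (carrier (deg0 (mdom f))))"
      by (rule linear_mapI) (simp_all add: f.cod.C1.smult_r_null)
  qed (simp_all add: f.cod.emb0 f.cod.emb1 derived_def)
  then show ?thesis by (simp add: el2_cell_def el2_two_hom_iff el2_id2_def)
qed

lemma el2_cell_vcomp:
  assumes "el2_cell K \<theta>" "el2_cell K \<psi>" "ctrg \<theta> = csrc \<psi>"
  shows "el2_cell K (el2_vcomp \<psi> \<theta>)"
  using el2_cellD(3-5)[OF assms(1)] el2_cellD(3-5)[OF assms(2)] assms(3)
  by (simp add: el2_cell_def el2_two_hom_iff el2_vcomp_def el2_homotopy_vcomp)

lemma el2_cell_hcomp:
  assumes "el2_cell K \<theta>" "el2_cell K \<psi>" "mcod (csrc \<theta>) = mdom (csrc \<psi>)"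
  shows "el2_cell K (el2_hcomp \<psi> \<theta>)"
  using el2_cellD(3-5)[OF assms(1)] el2_cellD(3-5)[OF assms(2)] assms(3)
  by (simp add: el2_cell_def el2_two_hom_iff el2_hcomp_def el2_comp_def el2_homotopy_hcomp)

lemmas el2_simps = el2_id_simps el2_comp_simps el2_id2_simps el2_vcomp_simps el2_hcomp_simps

lemmas el2_closed = el2_morphism_id el2_morphism_comp el2_cell_id2 el2_cell_vcomp el2_cell_hcomp

lemma el2_vcomp_id:
  assumes "el2_cell K \<theta>"
  shows "el2_vcomp \<theta> (el2_id2 (csrc \<theta>)) = \<theta>" "el2_vcomp (el2_id2 (ctrg \<theta>)) \<theta> = \<theta>"
proof -
  note D = el2_cellD[OF assms]
  interpret \<theta>: el2_homotopy K "mdom (csrc \<theta>)" "mcod (csrc \<theta>)" "m0 (csrc \<theta>)" "m1 (csrc \<theta>)"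
    "m2 (csrc \<theta>)" "m0 (ctrg \<theta>)" "m1 (ctrg \<theta>)" "m2 (ctrg \<theta>)" "cmap \<theta>" by (fact D(5))
  show "el2_vcomp \<theta> (el2_id2 (csrc \<theta>)) = \<theta>" "el2_vcomp (el2_id2 (ctrg \<theta>)) \<theta> = \<theta>"
    by (rule el2_cell_eqI[of K]; simp add: assms D(1-4) el2_closed el2_simps \<theta>.homotopy_simps \<theta>.f.maps
      \<theta>.f.cod.group_closed \<theta>.f.cod.emb1)+
qed

lemma el2_vcomp_assoc:
  assumes "el2_cell K \<theta>" "el2_cell K \<psi>" "el2_cell K \<chi>" "ctrg \<theta> = csrc \<psi>" "ctrg \<psi> = csrc \<chi>"
  shows "el2_vcomp \<chi> (el2_vcomp \<psi> \<theta>) = el2_vcomp (el2_vcomp \<chi> \<psi>) \<theta>"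
proof -
  note D = el2_cellD[OF assms(1)] and E = el2_cellD[OF assms(2)] and F = el2_cellD[OF assms(3)]
  have [simp]: "mdom (csrc \<psi>) = mdom (csrc \<theta>)" "mcod (csrc \<psi>) = mcod (csrc \<theta>)"
    "mdom (csrc \<chi>) = mdom (csrc \<theta>)" "mcod (csrc \<chi>) = mcod (csrc \<theta>)"
    using D(3,4) E(3,4) assms(4,5) by simp_all
  interpret \<theta>: el2_homotopy K "mdom (csrc \<theta>)" "mcod (csrc \<theta>)" "m0 (csrc \<theta>)" "m1 (csrc \<theta>)"
    "m2 (csrc \<theta>)" "m0 (ctrg \<theta>)" "m1 (ctrg \<theta>)" "m2 (ctrg \<theta>)" "cmap \<theta>" by (fact D(5))
  interpret \<psi>: el2_homotopy K "mdom (csrc \<theta>)" "mcod (csrc \<theta>)" "m0 (csrc \<psi>)" "m1 (csrc \<psi>)"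
    "m2 (csrc \<psi>)" "m0 (ctrg \<psi>)" "m1 (ctrg \<psi>)" "m2 (ctrg \<psi>)" "cmap \<psi>" using E(5) by simp
  interpret \<chi>: el2_homotopy K "mdom (csrc \<theta>)" "mcod (csrc \<theta>)" "m0 (csrc \<chi>)" "m1 (csrc \<chi>)"
    "m2 (csrc \<chi>)" "m0 (ctrg \<chi>)" "m1 (ctrg \<chi>)" "m2 (ctrg \<chi>)" "cmap \<chi>" using F(5) by simp
  show ?thesis
    by (rule el2_cell_eqI[of K]; simp add: assms el2_closed el2_simps \<theta>.homotopy_simps
        \<psi>.homotopy_simps
      \<chi>.homotopy_simps \<theta>.f.cod.group_closed \<theta>.f.cod.emb1)
qed

lemma el2_hcomp_id:
  assumes "el2_cell K \<theta>"
  shows "el2_hcomp \<theta> (el2_id2 (el2_id (mdom (csrc \<theta>)))) = \<theta>"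
    and "el2_hcomp (el2_id2 (el2_id (mcod (csrc \<theta>)))) \<theta> = \<theta>"
proof -
  note D = el2_cellD[OF assms]
  interpret \<theta>: el2_homotopy K "mdom (csrc \<theta>)" "mcod (csrc \<theta>)" "m0 (csrc \<theta>)" "m1 (csrc \<theta>)"
    "m2 (csrc \<theta>)" "m0 (ctrg \<theta>)" "m1 (ctrg \<theta>)" "m2 (ctrg \<theta>)" "cmap \<theta>" by (fact D(5))
  note id = el2_comp_id_right[OF D(1)] el2_comp_id_left[OF D(1)]
    el2_comp_id_right[OF D(2), unfolded D(3,4)] el2_comp_id_left[OF D(2), unfolded D(3,4)]
  note [simp] = D(1-4) id el2_closed el2_simps \<theta>.f.dom.el2_algebra_axioms \<theta>.f.cod.el2_algebra_axioms
     \<theta>.homotopy_simps \<theta>.f.maps \<theta>.g.maps \<theta>.f.cod.group_closed \<theta>.f.cod.emb1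
  show "el2_hcomp \<theta> (el2_id2 (el2_id (mdom (csrc \<theta>)))) = \<theta>"
    and "el2_hcomp (el2_id2 (el2_id (mcod (csrc \<theta>)))) \<theta> = \<theta>"
    by (rule el2_cell_eqI[of K]; simp add: assms)+
qed

lemma el2_hcomp_id2:
  assumes "el2_morphism K f" "el2_morphism K g" "mcod f = mdom g"
  shows "el2_hcomp (el2_id2 g) (el2_id2 f) = el2_id2 (el2_comp g f)"
proof -
  interpret f: el2_hom K "mdom f" "mdom g" "m0 f" "m1 f" "m2 f"
    using assms by (simp add: el2_morphism_def)
  interpret g: el2_hom K "mdom g" "mcod g" "m0 g" "m1 g" "m2 g"
    using assms by (simp add: el2_morphism_def)
  show ?thesis
    by (rule el2_cell_eqI[of K]; simp add: assms el2_closed el2_simps f.maps g.maps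
      g.cod.group_closed g.cod.emb1)
qed

lemma el2_hcomp_assoc:
  assumes "el2_cell K \<theta>" "el2_cell K \<psi>" "el2_cell K \<chi>"
    and "mcod (csrc \<theta>) = mdom (csrc \<psi>)" "mcod (csrc \<psi>) = mdom (csrc \<chi>)"
  shows "el2_hcomp \<chi> (el2_hcomp \<psi> \<theta>) = el2_hcomp (el2_hcomp \<chi> \<psi>) \<theta>"
proof -
  note D = el2_cellD[OF assms(1)] and E = el2_cellD[OF assms(2)] and F = el2_cellD[OF assms(3)]
  interpret \<theta>: el2_homotopy K "mdom (csrc \<theta>)" "mdom (csrc \<psi>)" "m0 (csrc \<theta>)" "m1 (csrc \<theta>)"
    "m2 (csrc \<theta>)" "m0 (ctrg \<theta>)" "m1 (ctrg \<theta>)" "m2 (ctrg \<theta>)" "cmap \<theta>" using D(5) assms(4) by simp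
  interpret \<psi>: el2_homotopy K "mdom (csrc \<psi>)" "mdom (csrc \<chi>)" "m0 (csrc \<psi>)" "m1 (csrc \<psi>)"
    "m2 (csrc \<psi>)" "m0 (ctrg \<psi>)" "m1 (ctrg \<psi>)" "m2 (ctrg \<psi>)" "cmap \<psi>" using E(5) assms(5) by simp
  interpret \<chi>: el2_homotopy K "mdom (csrc \<chi>)" "mcod (csrc \<chi>)" "m0 (csrc \<chi>)" "m1 (csrc \<chi>)"
    "m2 (csrc \<chi>)" "m0 (ctrg \<chi>)" "m1 (ctrg \<chi>)" "m2 (ctrg \<chi>)" "cmap \<chi>" by (fact F(5))
  have "el2_comp (csrc \<chi>) (el2_comp (csrc \<psi>) (csrc \<theta>)) = el2_comp (el2_comp (csrc \<chi>) (csrc \<psi>))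
      (csrc \<theta>)"
    "el2_comp (ctrg \<chi>) (el2_comp (ctrg \<psi>) (ctrg \<theta>)) = el2_comp (el2_comp (ctrg \<chi>) (ctrg \<psi>)) (ctrg \<theta>)"
    by (rule el2_comp_assoc[of K]; simp add: D(1-4) E(1-4) F(1-4) assms(4,5))+
  then show ?thesis
    by (intro el2_cell_eqI[of K]; simp add: assms el2_closed el2_simps D(3,4) E(3,4) F(3,4)
      \<theta>.homotopy_simps \<psi>.homotopy_simps
      \<chi>.homotopy_simps \<theta>.f.maps \<psi>.f.maps \<chi>.f.maps \<theta>.g.maps \<psi>.g.maps \<chi>.g.maps
      \<chi>.f.cod.group_closed \<chi>.f.cod.emb1)
qed

text \<open>The two sides differ in two places, and the differences cancel: the sources of
  \<open>\<psi>\<close> and \<open>\<psi>'\<close> differ on \<open>\<theta>' x\<close> by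
  \<open>\<psi> (\<delta> (\<theta>' x))\<close>, and so do the values of \<open>\<psi>\<close> at
  the source and the target of \<open>\<theta>'\<close>, because these objects differ by
  \<open>\<delta> (\<theta>' x)\<close>.\<close>

lemma el2_interchange:
  assumes "el2_cell K \<theta>" "el2_cell K \<theta>'" "el2_cell K \<psi>" "el2_cell K \<psi>'"
    and "ctrg \<theta> = csrc \<theta>'" "ctrg \<psi> = csrc \<psi>'" "mcod (csrc \<theta>) = mdom (csrc \<psi>)"
  shows "el2_hcomp (el2_vcomp \<psi>' \<psi>) (el2_vcomp \<theta>' \<theta>) = el2_vcomp (el2_hcomp \<psi>' \<theta>') (el2_hcomp \<psi> \<theta>)"
proof -
  note D = el2_cellD[OF assms(1)] and D' = el2_cellD[OF assms(2)]
    and E = el2_cellD[OF assms(3)] and E' = el2_cellD[OF assms(4)]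
  have eqs: "mdom (csrc \<theta>') = mdom (csrc \<theta>)" "mcod (csrc \<theta>') = mdom (csrc \<psi>)"
    "mdom (csrc \<psi>') = mdom (csrc \<psi>)" "mcod (csrc \<psi>') = mcod (csrc \<psi>)"
    using D(3,4) E(3,4) assms(5-7) by simp_all
  interpret \<theta>: el2_homotopy K "mdom (csrc \<theta>)" "mdom (csrc \<psi>)" "m0 (csrc \<theta>)" "m1 (csrc \<theta>)"
    "m2 (csrc \<theta>)" "m0 (csrc \<theta>')" "m1 (csrc \<theta>')" "m2 (csrc \<theta>')" "cmap \<theta>" using D(5) assms(5,7) by simp
  interpret \<theta>': el2_homotopy K "mdom (csrc \<theta>)" "mdom (csrc \<psi>)" "m0 (csrc \<theta>')" "m1 (csrc \<theta>')"
    "m2 (csrc \<theta>')" "m0 (ctrg \<theta>')" "m1 (ctrg \<theta>')" "m2 (ctrg \<theta>')" "cmap \<theta>'" using D'(5) by (simp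
        add: eqs)
  interpret \<psi>: el2_homotopy K "mdom (csrc \<psi>)" "mcod (csrc \<psi>)" "m0 (csrc \<psi>)" "m1 (csrc \<psi>)"
    "m2 (csrc \<psi>)" "m0 (csrc \<psi>')" "m1 (csrc \<psi>')" "m2 (csrc \<psi>')" "cmap \<psi>" using E(5) assms(6) by simp
  interpret \<psi>': el2_homotopy K "mdom (csrc \<psi>)" "mcod (csrc \<psi>)" "m0 (csrc \<psi>')" "m1 (csrc \<psi>')"
    "m2 (csrc \<psi>')" "m0 (ctrg \<psi>')" "m1 (ctrg \<psi>')" "m2 (ctrg \<psi>')" "cmap \<psi>'" using E'(5) by (simp
        add: eqs)
  note [simp] = el2_closed el2_simps D(3,4) E(3,4) D'(3,4) E'(3,4) eqs
    \<theta>.homotopy_simps \<theta>'.homotopy_simps \<psi>.homotopy_simps \<psi>'.homotopy_simps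
    \<theta>.f.maps \<psi>.f.maps \<theta>.target \<theta>'.target \<psi>.target \<psi>'.target \<theta>.f.dom.operations
    \<theta>.f.cod.operations \<theta>.f.cod.group_closed \<psi>.f.cod.group_closed \<psi>.f.cod.emb1
  show ?thesis
    by (rule el2_cell_eqI[of K]; simp add: assms)
qed

lemma el2_morphismD:
  assumes "el2_morphism K f"
  shows "el2_algebra K (mdom f)" "el2_algebra K (mcod f)"
  using assms by (simp_all add: el2_morphism_def el2_hom_def)

lemma two_category_TwoTermEL: "two_category (TwoTermEL K)"
  by (unfold_locales; simp add: TwoTermEL_def el2_morphismD el2_cellD el2_closed el2_simps
      el2_vcomp_id el2_vcomp_assoc el2_hcomp_id
      el2_hcomp_assoc el2_hcomp_id2 el2_interchange el2_comp_id_right el2_comp_id_left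
      el2_comp_assoc flip: el2_cell_def)

section \<open>Transport of 2-categories along local isomorphisms\<close>

text \<open>\<open>N\<close> is bijective on the 1-cells between two given objects and on the 2-cells between two given
  1-cells, with inverses \<open>lift1\<close> and \<open>lift2\<close>, and the operations of \<open>C\<close> are those of \<open>D\<close>
  transported along these bijections. Thus \<open>C\<close> inherits the axioms of a 2-category from \<open>D\<close>.\<close>

locale local_iso = D: two_category D
  for C :: "('o, 'm, 'c) two_cat" and D :: "('p, 'n, 'd) two_cat" +
  fixes N :: "('o, 'm, 'c, 'p, 'n, 'd) two_fun"
    and lift1 :: "'o \<Rightarrow> 'o \<Rightarrow> 'n \<Rightarrow> 'm" and lift2 :: "'m \<Rightarrow> 'm \<Rightarrow> 'd \<Rightarrow> 'c"
  assumes Dom_Ob: "f \<in> Mor C \<Longrightarrow> Dom C f \<in> Ob C"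
    and Cod_Ob: "f \<in> Mor C \<Longrightarrow> Cod C f \<in> Ob C"
    and Src_Mor: "\<alpha> \<in> Cell C \<Longrightarrow> Src C \<alpha> \<in> Mor C"
    and Trg_Mor: "\<alpha> \<in> Cell C \<Longrightarrow> Trg C \<alpha> \<in> Mor C"
    and Dom_parallel: "\<alpha> \<in> Cell C \<Longrightarrow> Dom C (Trg C \<alpha>) = Dom C (Src C \<alpha>)"
    and Cod_parallel: "\<alpha> \<in> Cell C \<Longrightarrow> Cod C (Trg C \<alpha>) = Cod C (Src C \<alpha>)"
    and on_ob: "A \<in> Ob C \<Longrightarrow> on_ob N A \<in> Ob D"
    and on_mor: "f \<in> Mor C \<Longrightarrow> on_mor N f \<in> Mor D"
    and on_cell: "\<alpha> \<in> Cell C \<Longrightarrow> on_cell N \<alpha> \<in> Cell D"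
    and Dom_on_mor: "f \<in> Mor C \<Longrightarrow> Dom D (on_mor N f) = on_ob N (Dom C f)"
    and Cod_on_mor: "f \<in> Mor C \<Longrightarrow> Cod D (on_mor N f) = on_ob N (Cod C f)"
    and Src_on_cell: "\<alpha> \<in> Cell C \<Longrightarrow> Src D (on_cell N \<alpha>) = on_mor N (Src C \<alpha>)"
    and Trg_on_cell: "\<alpha> \<in> Cell C \<Longrightarrow> Trg D (on_cell N \<alpha>) = on_mor N (Trg C \<alpha>)"
    and lift1_on_mor: "f \<in> Mor C \<Longrightarrow> lift1 (Dom C f) (Cod C f) (on_mor N f) = f"
    and lift1: "\<lbrakk>A \<in> Ob C; B \<in> Ob C; k \<in> Mor D; Dom D k = on_ob N A; Cod D k = on_ob N B\<rbrakk>
      \<Longrightarrow> lift1 A B k \<in> Mor C \<and> Dom C (lift1 A B k) = A \<and> Cod C (lift1 A B k) = B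
        \<and> on_mor N (lift1 A B k) = k"
    and lift2_on_cell: "\<alpha> \<in> Cell C \<Longrightarrow> lift2 (Src C \<alpha>) (Trg C \<alpha>) (on_cell N \<alpha>) = \<alpha>"
    and lift2: "\<lbrakk>f \<in> Mor C; g \<in> Mor C; Dom C g = Dom C f; Cod C g = Cod C f;
        \<kappa> \<in> Cell D; Src D \<kappa> = on_mor N f; Trg D \<kappa> = on_mor N g\<rbrakk>
      \<Longrightarrow> lift2 f g \<kappa> \<in> Cell C \<and> Src C (lift2 f g \<kappa>) = f \<and> Trg C (lift2 f g \<kappa>) = g
        \<and> on_cell N (lift2 f g \<kappa>) = \<kappa>"
    and id1_lift: "A \<in> Ob C \<Longrightarrow> id1 C A = lift1 A A (id1 D (on_ob N A))"
    and comp1_lift: "\<lbrakk>f \<in> Mor C; g \<in> Mor C; Cod C f = Dom C g\<rbrakk>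
      \<Longrightarrow> comp1 C g f = lift1 (Dom C f) (Cod C g) (comp1 D (on_mor N g) (on_mor N f))"
    and id2_lift: "f \<in> Mor C \<Longrightarrow> id2 C f = lift2 f f (id2 D (on_mor N f))"
    and vcomp_lift: "\<lbrakk>\<alpha> \<in> Cell C; \<beta> \<in> Cell C; Trg C \<alpha> = Src C \<beta>\<rbrakk>
      \<Longrightarrow> vcomp C \<beta> \<alpha> = lift2 (Src C \<alpha>) (Trg C \<beta>) (vcomp D (on_cell N \<beta>) (on_cell N \<alpha>))"
    and hcomp_lift: "\<lbrakk>\<alpha> \<in> Cell C; \<beta> \<in> Cell C; Cod C (Src C \<alpha>) = Dom C (Src C \<beta>)\<rbrakk>
      \<Longrightarrow> hcomp C \<beta> \<alpha> = lift2 (comp1 C (Src C \<beta>) (Src C \<alpha>)) (comp1 C (Trg C \<beta>) (Trg C \<alpha>))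
        (hcomp D (on_cell N \<beta>) (on_cell N \<alpha>))"
begin

lemma mor_eqI:
  "\<lbrakk>f \<in> Mor C; g \<in> Mor C; Dom C f = Dom C g; Cod C f = Cod C g; on_mor N f = on_mor N g\<rbrakk> \<Longrightarrow> f = g"
  by (metis lift1_on_mor)

lemma cell_eqI:
  "\<lbrakk>\<alpha> \<in> Cell C; \<beta> \<in> Cell C; Src C \<alpha> = Src C \<beta>; Trg C \<alpha> = Trg C \<beta>; on_cell N \<alpha> = on_cell N \<beta>\<rbrakk>
    \<Longrightarrow> \<alpha> = \<beta>"
  by (metis lift2_on_cell)

lemmas axD = D.id1_Mor D.Dom_id1 D.Cod_id1 D.comp1_Mor D.Dom_comp1 D.Cod_comp1
  D.id2_Cell D.Src_id2 D.Trg_id2 D.vcomp_Cell D.Src_vcomp D.Trg_vcomp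
  D.hcomp_Cell D.Src_hcomp D.Trg_hcomp D.Src_Mor D.Trg_Mor D.Dom_Ob D.Cod_Ob D.Dom_parallel
      D.Cod_parallel

lemmas typing = Dom_Ob Cod_Ob Src_Mor Trg_Mor Dom_parallel Cod_parallel on_ob on_mor on_cell
  Dom_on_mor Cod_on_mor Src_on_cell Trg_on_cell

lemma id1:
  assumes "A \<in> Ob C"
  shows "id1 C A \<in> Mor C" "Dom C (id1 C A) = A" "Cod C (id1 C A) = A"
    "on_mor N (id1 C A) = id1 D (on_ob N A)"
  using lift1[of A A "id1 D (on_ob N A)"] assms by (simp_all add: id1_lift typing axD)

lemma comp1:
  assumes "f \<in> Mor C" "g \<in> Mor C" "Cod C f = Dom C g"
  shows "comp1 C g f \<in> Mor C" "Dom C (comp1 C g f) = Dom C f" "Cod C (comp1 C g f) = Cod C g"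
    "on_mor N (comp1 C g f) = comp1 D (on_mor N g) (on_mor N f)"
  using lift1[of "Dom C f" "Cod C g" "comp1 D (on_mor N g) (on_mor N f)"] assms
  by (simp_all add: comp1_lift typing axD)

lemma id2:
  assumes "f \<in> Mor C"
  shows "id2 C f \<in> Cell C" "Src C (id2 C f) = f" "Trg C (id2 C f) = f"
    "on_cell N (id2 C f) = id2 D (on_mor N f)"
  using lift2[of f f "id2 D (on_mor N f)"] assms by (simp_all add: id2_lift typing axD)

lemma vcomp:
  assumes "\<alpha> \<in> Cell C" "\<beta> \<in> Cell C" "Trg C \<alpha> = Src C \<beta>"
  shows "vcomp C \<beta> \<alpha> \<in> Cell C" "Src C (vcomp C \<beta> \<alpha>) = Src C \<alpha>" "Trg C (vcomp C \<beta> \<alpha>) = Trg C \<beta>"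
    "on_cell N (vcomp C \<beta> \<alpha>) = vcomp D (on_cell N \<beta>) (on_cell N \<alpha>)"
proof -
  have "Dom C (Trg C \<beta>) = Dom C (Src C \<alpha>)" "Cod C (Trg C \<beta>) = Cod C (Src C \<alpha>)"
    using assms by (metis Dom_parallel, metis Cod_parallel)
  then show "vcomp C \<beta> \<alpha> \<in> Cell C" "Src C (vcomp C \<beta> \<alpha>) = Src C \<alpha>" "Trg C (vcomp C \<beta> \<alpha>) = Trg C \<beta>"
    "on_cell N (vcomp C \<beta> \<alpha>) = vcomp D (on_cell N \<beta>) (on_cell N \<alpha>)"
    using lift2[of "Src C \<alpha>" "Trg C \<beta>" "vcomp D (on_cell N \<beta>) (on_cell N \<alpha>)"] assms
    by (simp_all add: vcomp_lift typing axD)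
qed

lemma hcomp:
  assumes "\<alpha> \<in> Cell C" "\<beta> \<in> Cell C" "Cod C (Src C \<alpha>) = Dom C (Src C \<beta>)"
  shows "hcomp C \<beta> \<alpha> \<in> Cell C" "Src C (hcomp C \<beta> \<alpha>) = comp1 C (Src C \<beta>) (Src C \<alpha>)"
    "Trg C (hcomp C \<beta> \<alpha>) = comp1 C (Trg C \<beta>) (Trg C \<alpha>)"
    "on_cell N (hcomp C \<beta> \<alpha>) = hcomp D (on_cell N \<beta>) (on_cell N \<alpha>)"
  using lift2[of "comp1 C (Src C \<beta>) (Src C \<alpha>)" "comp1 C (Trg C \<beta>) (Trg C \<alpha>)"
      "hcomp D (on_cell N \<beta>) (on_cell N \<alpha>)"] assms
  by (simp_all add: hcomp_lift typing axD comp1)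

lemmas ops = id1 comp1 id2 vcomp hcomp

lemma two_category_C: "two_category C"
proof (unfold_locales, goal_cases)
  \<comment> \<open>The numbers follow the assumptions of \<open>two_category\<close>: 9 to 11 are
    the laws for 1-cells, 22 to 24 those for vertical composition, 28 to 32 those for horizontal
    composition. All others are typing conditions, which the lifts satisfy by construction.\<close>
  case (9 f) then show ?case
    by (intro mor_eqI) (simp_all add: ops typing axD D.comp1_id_right flip: Dom_on_mor)
next
  case (10 f) then show ?case
    by (intro mor_eqI) (simp_all add: ops typing axD D.comp1_id_left flip: Cod_on_mor)
next
  case (11 f g h) then show ?case
    by (intro mor_eqI) (simp_all add: ops typing axD D.comp1_assoc)
next
  case (22 \<alpha>) then show ?case
    by (intro cell_eqI) (simp_all add: ops typing axD D.vcomp_id_right flip: Src_on_cell)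
next
  case (23 \<alpha>) then show ?case
    by (intro cell_eqI) (simp_all add: ops typing axD D.vcomp_id_left flip: Trg_on_cell)
next
  case (24 \<alpha> \<beta> \<gamma>) then show ?case
    by (intro cell_eqI) (simp_all add: ops typing axD D.vcomp_assoc)
next
  case (28 \<alpha>)
  then have "hcomp D (on_cell N \<alpha>) (id2 D (id1 D (on_ob N (Dom C (Src C \<alpha>))))) = on_cell N \<alpha>"
    using D.hcomp_id_right[of "on_cell N \<alpha>"] by (simp add: typing)
  \<comment> \<open>\<open>cell_eqI\<close> also asks for equal sources and targets. These are
    composites with an identity 1-cell, so the unit law for 1-cells is needed inside the law for
    2-cells.\<close>
  moreover have "comp1 C f (id1 C (Dom C f)) = f" if "f \<in> Mor C" for f
    using that by (intro mor_eqI) (simp_all add: ops typing axD D.comp1_id_right flip: Dom_on_mor)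
  ultimately show ?case using 28
    by (intro cell_eqI) (simp_all add: ops typing axD, metis Dom_parallel Trg_Mor)
next
  case (29 \<alpha>)
  then have "hcomp D (id2 D (id1 D (on_ob N (Cod C (Src C \<alpha>))))) (on_cell N \<alpha>) = on_cell N \<alpha>"
    using D.hcomp_id_left[of "on_cell N \<alpha>"] by (simp add: typing)
  moreover have "comp1 C (id1 C (Cod C f)) f = f" if "f \<in> Mor C" for f
    using that by (intro mor_eqI) (simp_all add: ops typing axD D.comp1_id_left flip: Cod_on_mor)
  ultimately show ?case using 29
    by (intro cell_eqI) (simp_all add: ops typing axD, metis Cod_parallel Trg_Mor)
next
  case (30 \<alpha> \<beta> \<gamma>)
  have "comp1 C h (comp1 C g f) = comp1 C (comp1 C h g) f"
    if "f \<in> Mor C" "g \<in> Mor C" "h \<in> Mor C" "Cod C f = Dom C g" "Cod C g = Dom C h" for f g h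
    using that by (intro mor_eqI) (simp_all add: ops typing axD D.comp1_assoc)
  with 30 show ?case
    by (intro cell_eqI) (simp_all add: ops typing axD D.hcomp_assoc)
next
  case (31 f g) then show ?case
    by (intro cell_eqI) (simp_all add: ops typing axD D.hcomp_id2)
next
  case (32 \<alpha> \<alpha>' \<beta> \<beta>')
  then have "Dom C (Src C \<alpha>') = Dom C (Src C \<alpha>)" "Cod C (Src C \<alpha>') = Cod C (Src C \<alpha>)"
    "Dom C (Src C \<beta>') = Dom C (Src C \<beta>)" "Cod C (Src C \<beta>') = Cod C (Src C \<beta>)"
    by (metis Dom_parallel, metis Cod_parallel, metis Dom_parallel, metis Cod_parallel)
  with 32 show ?case
    by (intro cell_eqI) (simp_all add: ops typing axD D.interchange)
qed (simp_all add: ops typing)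

lemma two_functor_N: "two_functor C D N"
  by (intro two_functor.intro two_category_C D.two_category_axioms two_functor_axioms.intro)
    (simp_all add: typing ops)

end

section \<open>From an invertible counit to an equivalence\<close>

locale local_equivalence = local_iso C D N lift1 lift2
  for C :: "('o, 'm, 'c) two_cat" and D :: "('p, 'n, 'd) two_cat" and N lift1 lift2 +
  fixes G :: "('p, 'n, 'd, 'o, 'm, 'c) two_fun" and e e' :: "'p \<Rightarrow> 'n"
  assumes G_ob: "A \<in> Ob D \<Longrightarrow> on_ob G A \<in> Ob C"
    and counit: "A \<in> Ob D \<Longrightarrow> e A \<in> Mor D \<and> Dom D (e A) = on_ob N (on_ob G A) \<and> Cod D (e A) = A"
    and counit': "A \<in> Ob D \<Longrightarrow> e' A \<in> Mor D \<and> Dom D (e' A) = A \<and> Cod D (e' A) = on_ob N (on_ob G A)"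
    and counit_iso: "A \<in> Ob D \<Longrightarrow> comp1 D (e A) (e' A) = id1 D A"
      "A \<in> Ob D \<Longrightarrow> comp1 D (e' A) (e A) = id1 D (on_ob N (on_ob G A))"
    and G_mor_lift: "f \<in> Mor D \<Longrightarrow> on_mor G f = lift1 (on_ob G (Dom D f)) (on_ob G (Cod D f))
        (comp1 D (e' (Cod D f)) (comp1 D f (e (Dom D f))))"
    and G_cell_lift: "\<alpha> \<in> Cell D \<Longrightarrow> on_cell G \<alpha> = lift2 (on_mor G (Src D \<alpha>)) (on_mor G (Trg D \<alpha>))
        (hcomp D (id2 D (e' (Cod D (Src D \<alpha>)))) (hcomp D \<alpha> (id2 D (e (Dom D (Src D \<alpha>))))))"
begin

lemma G_mor:
  assumes "f \<in> Mor D"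
  shows "on_mor G f \<in> Mor C" "Dom C (on_mor G f) = on_ob G (Dom D f)"
    "Cod C (on_mor G f) = on_ob G (Cod D f)"
    "on_mor N (on_mor G f) = comp1 D (e' (Cod D f)) (comp1 D f (e (Dom D f)))"
  using lift1[of "on_ob G (Dom D f)" "on_ob G (Cod D f)"
      "comp1 D (e' (Cod D f)) (comp1 D f (e (Dom D f)))"] assms
  by (simp_all add: G_mor_lift G_ob axD counit counit')

lemma G_cell:
  assumes "\<alpha> \<in> Cell D"
  shows "on_cell G \<alpha> \<in> Cell C" "Src C (on_cell G \<alpha>) = on_mor G (Src D \<alpha>)"
    "Trg C (on_cell G \<alpha>) = on_mor G (Trg D \<alpha>)"
    "on_cell N (on_cell G \<alpha>)
      = hcomp D (id2 D (e' (Cod D (Src D \<alpha>)))) (hcomp D \<alpha> (id2 D (e (Dom D (Src D \<alpha>)))))"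
  using lift2[of "on_mor G (Src D \<alpha>)" "on_mor G (Trg D \<alpha>)"
      "hcomp D (id2 D (e' (Cod D (Src D \<alpha>)))) (hcomp D \<alpha> (id2 D (e (Dom D (Src D \<alpha>)))))"] assms
  by (simp_all add: G_cell_lift G_ob G_mor axD counit counit')

lemmas G_typing = G_ob counit counit' G_mor G_cell

lemma comp1_assoc_right: "\<lbrakk>f \<in> Mor D; g \<in> Mor D; h \<in> Mor D; Cod D f = Dom D g; Cod D g = Dom D h\<rbrakk>
    \<Longrightarrow> comp1 D (comp1 D h g) f = comp1 D h (comp1 D g f)"
  by (simp add: D.comp1_assoc)

lemma hcomp_assoc_right: "\<lbrakk>\<alpha> \<in> Cell D; \<beta> \<in> Cell D; \<gamma> \<in> Cell D;
        Cod D (Src D \<alpha>) = Dom D (Src D \<beta>); Cod D (Src D \<beta>) = Dom D (Src D \<gamma>)\<rbrakk>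
      \<Longrightarrow> hcomp D (hcomp D \<gamma> \<beta>) \<alpha> = hcomp D \<gamma> (hcomp D \<beta> \<alpha>)"
  by (simp add: D.hcomp_assoc)

lemma id1_comp1: "\<lbrakk>f \<in> Mor D; Cod D f = A\<rbrakk> \<Longrightarrow> comp1 D (id1 D A) f = f"
  "\<lbrakk>f \<in> Mor D; Dom D f = A\<rbrakk> \<Longrightarrow> comp1 D f (id1 D A) = f"
  using D.comp1_id_left D.comp1_id_right by auto

lemma id1_hcomp: "\<lbrakk>\<alpha> \<in> Cell D; Cod D (Src D \<alpha>) = A\<rbrakk> \<Longrightarrow> hcomp D (id2 D (id1 D A)) \<alpha> = \<alpha>"
  "\<lbrakk>\<alpha> \<in> Cell D; Dom D (Src D \<alpha>) = A\<rbrakk> \<Longrightarrow> hcomp D \<alpha> (id2 D (id1 D A)) = \<alpha>"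
  using D.hcomp_id_left D.hcomp_id_right by auto

text \<open>Composites are normalised to nest to the right, so \<open>e\<close> and its inverse meet
  only in front of a further factor; cancellation is therefore stated with this factor.\<close>

lemma cancel1:
  "\<lbrakk>A \<in> Ob D; f \<in> Mor D; Cod D f = A\<rbrakk> \<Longrightarrow> comp1 D (e A) (comp1 D (e' A) f) = f"
  "\<lbrakk>A \<in> Ob D; f \<in> Mor D; Cod D f = on_ob N (on_ob G A)\<rbrakk> \<Longrightarrow> comp1 D (e' A) (comp1 D (e A) f) = f"
  by (simp_all add: D.comp1_assoc G_typing counit_iso id1_comp1)

lemma cancel2:
  "\<lbrakk>A \<in> Ob D; \<alpha> \<in> Cell D; Cod D (Src D \<alpha>) = A\<rbrakk>
    \<Longrightarrow> hcomp D (id2 D (e A)) (hcomp D (id2 D (e' A)) \<alpha>) = \<alpha>"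
  "\<lbrakk>A \<in> Ob D; \<alpha> \<in> Cell D; Cod D (Src D \<alpha>) = on_ob N (on_ob G A)\<rbrakk>
    \<Longrightarrow> hcomp D (id2 D (e' A)) (hcomp D (id2 D (e A)) \<alpha>) = \<alpha>"
  by (simp_all add: D.hcomp_assoc D.hcomp_id2 G_typing axD counit_iso id1_hcomp)

lemmas normalize = comp1_assoc_right hcomp_assoc_right id1_comp1 id1_hcomp counit_iso cancel1 cancel2
  D.hcomp_id2

text \<open>\<open>N\<close> carries \<open>G f\<close> to the conjugate \<open>e' f e\<close>. In
  the image of a composite the inner pair \<open>e e'\<close> cancels, and faithfulness of
  \<open>N\<close> on parallel cells transfers the resulting equation to \<open>C\<close>.\<close>

lemma two_functor_G: "two_functor D C G"
proof (intro two_functor.intro two_category_C D.two_category_axioms two_functor_axioms.intro,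
    goal_cases)
  case (8 A) then show ?case
    by (intro mor_eqI) (simp_all add: ops G_typing axD normalize)
next
  case (9 f g) then show ?case
    by (intro mor_eqI) (simp_all add: ops G_typing axD normalize)
next
  case (10 f) then show ?case
    by (intro cell_eqI) (simp_all add: ops G_typing axD normalize)
next
  case (11 \<alpha> \<beta>)
  then have "Dom D (Src D \<beta>) = Dom D (Src D \<alpha>)" "Cod D (Src D \<beta>) = Cod D (Src D \<alpha>)"
    by (metis D.Dom_parallel, metis D.Cod_parallel)
  note 11 = 11 this
  \<comment> \<open>Reading interchange backwards composes each whiskering identity vertically with
    itself; this collapses it again.\<close>
  have "vcomp D (id2 D h) (id2 D h) = id2 D h" if "h \<in> Mor D" for h
    using D.vcomp_id_left[of "id2 D h"] that by (simp add: axD)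
  with 11 show ?case
    by (intro cell_eqI) (simp_all add: ops G_typing axD normalize flip: D.interchange)
next
  case (12 \<alpha> \<beta>)
  have "on_mor G (comp1 D g f) = comp1 C (on_mor G g) (on_mor G f)"
    if "f \<in> Mor D" "g \<in> Mor D" "Cod D f = Dom D g" for f g
    using that by (intro mor_eqI) (simp_all add: ops G_typing axD normalize)
  with 12 show ?case
    by (intro cell_eqI) (simp_all add: ops G_typing axD normalize)
qed (simp_all add: G_typing)

text \<open>The triangle identity leaves no choice: \<open>N\<close> of the unit at \<open>L\<close>
  has to be the inverse of the counit at \<open>N L\<close>, and bijectivity of \<open>N\<close> on
  1-cells provides exactly one such 1-cell.\<close>

definition unit :: "'o \<Rightarrow> 'm" where
  "unit L = lift1 L (on_ob G (on_ob N L)) (e' (on_ob N L))"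

definition unit_inv :: "'o \<Rightarrow> 'm" where
  "unit_inv L = lift1 (on_ob G (on_ob N L)) L (e (on_ob N L))"

lemma unit:
  assumes "L \<in> Ob C"
  shows "unit L \<in> Mor C" "Dom C (unit L) = L" "Cod C (unit L) = on_ob G (on_ob N L)"
    "on_mor N (unit L) = e' (on_ob N L)"
  using lift1[of L "on_ob G (on_ob N L)" "e' (on_ob N L)"] assms
  by (simp_all add: unit_def typing G_typing)

lemma unit_inv:
  assumes "L \<in> Ob C"
  shows "unit_inv L \<in> Mor C" "Dom C (unit_inv L) = on_ob G (on_ob N L)" "Cod C (unit_inv L) = L"
    "on_mor N (unit_inv L) = e (on_ob N L)"
  using lift1[of "on_ob G (on_ob N L)" L "e (on_ob N L)"] assms
  by (simp_all add: unit_inv_def typing G_typing)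

lemma two_functor_two_fun_id: "two_category A \<Longrightarrow> two_functor A A two_fun_id"
  by (intro two_functor.intro two_functor_axioms.intro) (simp_all add: two_fun_id_def)

lemma two_functor_GN: "two_functor C C (two_fun_comp G N)"
proof -
  interpret N: two_functor C D N by (fact two_functor_N)
  interpret G: two_functor D C G by (fact two_functor_G)
  show ?thesis
    by (intro two_functor.intro two_category_C two_functor_axioms.intro)
      (simp_all add: two_fun_comp_def ops typing G_typing G.on_id1 G.on_comp1 G.on_id2 G.on_vcomp
          G.on_hcomp)
qed

lemma two_functor_NG: "two_functor D D (two_fun_comp N G)"
proof -
  interpret N: two_functor C D N by (fact two_functor_N)
  interpret G: two_functor D C G by (fact two_functor_G)
  show ?thesis
    by (intro two_functor.intro D.two_category_axioms two_functor_axioms.intro)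
      (simp_all add: two_fun_comp_def typing ops axD G_ob G_mor(1-3) G_cell(1-3)
        G.on_id1 G.on_comp1 G.on_id2 G.on_vcomp G.on_hcomp)
qed

lemma unit_natural_iso: "two_natural_iso C C two_fun_id (two_fun_comp G N) unit"
proof -
  have mor: "comp1 C (unit (Cod C f)) f = comp1 C (on_mor G (on_mor N f)) (unit (Dom C f))"
    if "f \<in> Mor C" for f
    using that by (intro mor_eqI) (simp_all add: unit ops typing G_typing axD normalize)
  have "two_natural C C two_fun_id (two_fun_comp G N) unit"
  proof (intro two_natural.intro two_functor_two_fun_id two_category_C two_functor_GN
      two_natural_axioms.intro, goal_cases)
    case (5 \<alpha>)
    with mor[of "Trg C \<alpha>"] mor[of "Src C \<alpha>"] show ?case
      unfolding two_fun_id_def two_fun_comp_def two_fun.simps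
      by (intro cell_eqI) (simp_all add: unit ops typing G_typing axD normalize)
  qed (simp_all add: mor unit two_fun_id_def two_fun_comp_def)
  moreover have "iso1 C (unit L)" if "L \<in> Ob C" for L
  proof -
    have "comp1 C (unit_inv L) (unit L) = id1 C L"
      "comp1 C (unit L) (unit_inv L) = id1 C (on_ob G (on_ob N L))"
      using that by (auto intro!: mor_eqI simp: unit unit_inv ops typing G_typing axD normalize)
    with that show ?thesis by (auto simp: iso1_def unit unit_inv intro!: bexI[of _ "unit_inv L"])
  qed
  ultimately show ?thesis by (simp add: two_natural_iso_def)
qed

text \<open>Naturality is built into \<open>G\<close>: since \<open>N G f\<close> is
  \<open>e' f e\<close>, composing with \<open>e\<close> cancels the first factor.\<close>

lemma counit_natural_iso: "two_natural_iso D D (two_fun_comp N G) two_fun_id e"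
proof -
  have "two_natural D D (two_fun_comp N G) two_fun_id e"
  proof (intro two_natural.intro two_functor_two_fun_id D.two_category_axioms two_functor_NG
      two_natural_axioms.intro)
  qed (simp_all add: two_fun_id_def two_fun_comp_def G_typing axD normalize)
  moreover have "iso1 D (e A)" if "A \<in> Ob D" for A
    using that by (auto simp: iso1_def G_typing counit_iso intro!: bexI[of _ "e' A"])
  ultimately show ?thesis by (simp add: two_natural_iso_def)
qed

lemma two_equivalence: "two_equivalence C D N G"
  unfolding two_equivalence_def
  using two_functor_N two_functor_G unit_natural_iso counit_natural_iso by blast

end

section \<open>Arrows of linear categories and Lie 2-algebras\<close>

text \<open>Transfers a known equation to a goal by comparing the differences of their sides. The
  known equation is never rewritten, so composites in it can be expanded on the spot. The sign of
  the difference matters, which is why some equations are later supplied as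
  \<open>symmetric\<close>.\<close>

lemma (in embedded_group) eq_from_eq:
  assumes "h = h'" "emb G g - emb G g' = emb G h - emb G h'" "g \<in> carrier G" "g' \<in> carrier G"
  shows "g = g'"
  using assms by (simp add: emb_inject)

lemma source_kernel_simps:
  "a \<in> carrier (source_kernel V) \<longleftrightarrow> a \<in> carrier (ar V) \<and> src V a = \<zero>\<^bsub>ob V\<^esub>"
  "zero (source_kernel V) = zero (ar V)" "add (source_kernel V) = add (ar V)"
  "smult (source_kernel V) = smult (ar V)"
  by (auto simp: source_kernel_def)

context linear_category
begin

lemma linear_src: "linear K (ar V) (ob V) (src V)"
  and linear_tgt: "linear K (ar V) (ob V) (tgt V)"
  and linear_ident: "linear K (ob V) (ar V) (ident V)"
  by (intro linear.intro linear_axioms.intro O.module_axioms A.module_axioms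
      src_linear tgt_linear ident_linear)+

lemma embeddedO: "embedded_group (ob V)" and embeddedA: "embedded_group (ar V)"
  by (intro embedded_group.intro O.abelian_group_axioms A.abelian_group_axioms)+

lemmas embO = embedded_group.emb_simps[OF embeddedO]
lemmas embA = embedded_group.emb_simps[OF embeddedA]

lemma ident_simps:
  "x \<in> carrier (ob V) \<Longrightarrow> src V (\<iota>\<^bsub>V\<^esub> x) = x" "x \<in> carrier (ob V) \<Longrightarrow> tgt V (\<iota>\<^bsub>V\<^esub> x) = x"
  using ident_arrow by (auto simp: is_arrow_def)

lemmas group_closed = O.M.a_closed O.M.a_inv_closed O.M.minus_closed O.M.zero_closed O.smult_closed
  A.M.a_closed A.M.a_inv_closed A.M.minus_closed A.M.zero_closed A.smult_closed

lemmas structure_simps = linear.simps[OF linear_src] linear.simps[OF linear_tgt]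
  linear.simps[OF linear_ident] ident_simps group_closed O.smult_simps A.smult_simps

text \<open>Split \<open>g\<close> as the identity of its source plus a kernel part
  \<open>k\<close>, and \<open>f\<close> as \<open>f + 0\<close>. Additivity of composition then
  gives \<open>g \<bullet> f = 1 \<bullet> f + k \<bullet> 0 = f + k\<close>.\<close>

lemma cmp_eq:
  assumes f: "f \<in> carrier (ar V)" and g: "g \<in> carrier (ar V)" and fg: "tgt V f = src V g"
  shows "g \<bullet>\<^bsub>V\<^esub> f = g \<oplus>\<^bsub>ar V\<^esub> f \<ominus>\<^bsub>ar V\<^esub> \<iota>\<^bsub>V\<^esub> (src V g)"
proof -
  let ?y = "src V g" and ?k = "g \<ominus>\<^bsub>ar V\<^esub> \<iota>\<^bsub>V\<^esub> (src V g)"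
  note [simp] = structure_simps f g
  have k: "is_arrow V ?k \<zero>\<^bsub>ob V\<^esub> (tgt V g \<ominus>\<^bsub>ob V\<^esub> ?y)"
    by (simp add: is_arrow_def embO)
  have z: "is_arrow V \<zero>\<^bsub>ar V\<^esub> \<zero>\<^bsub>ob V\<^esub> \<zero>\<^bsub>ob V\<^esub>" by (simp add: is_arrow_def)
  have f': "is_arrow V f (src V f) ?y" using fg by (simp add: is_arrow_def)
  have "(\<iota>\<^bsub>V\<^esub> ?y \<oplus>\<^bsub>ar V\<^esub> ?k) \<bullet>\<^bsub>V\<^esub> (f \<oplus>\<^bsub>ar V\<^esub> \<zero>\<^bsub>ar V\<^esub>)
      = (\<iota>\<^bsub>V\<^esub> ?y \<bullet>\<^bsub>V\<^esub> f) \<oplus>\<^bsub>ar V\<^esub> (?k \<bullet>\<^bsub>V\<^esub> \<zero>\<^bsub>ar V\<^esub>)"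
    by (rule cmp_add[OF f' ident_arrow z k]) simp
  moreover have "\<iota>\<^bsub>V\<^esub> ?y \<oplus>\<^bsub>ar V\<^esub> ?k = g" by (simp add: embA)
  \<comment> \<open>By linearity of \<open>ident\<close> the zero arrow is the identity of the zero
    object, which is the source of \<open>k\<close>.\<close>
  moreover have "?k \<bullet>\<^bsub>V\<^esub> \<zero>\<^bsub>ar V\<^esub> = ?k"
    using cmp_ident_right[OF k] linear.zero[OF linear_ident] by simp
  ultimately have "g \<bullet>\<^bsub>V\<^esub> f = f \<oplus>\<^bsub>ar V\<^esub> ?k" by (simp add: cmp_ident_left[OF f'])
  then show ?thesis by (simp add: embA)
qed

lemma cmp_src: "\<lbrakk>f \<in> carrier (ar V); g \<in> carrier (ar V); tgt V f = src V g\<rbrakk>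
    \<Longrightarrow> src V (g \<bullet>\<^bsub>V\<^esub> f) = src V f"
  and cmp_tgt: "\<lbrakk>f \<in> carrier (ar V); g \<in> carrier (ar V); tgt V f = src V g\<rbrakk>
    \<Longrightarrow> tgt V (g \<bullet>\<^bsub>V\<^esub> f) = tgt V g"
  and cmp_closed: "\<lbrakk>f \<in> carrier (ar V); g \<in> carrier (ar V); tgt V f = src V g\<rbrakk>
    \<Longrightarrow> g \<bullet>\<^bsub>V\<^esub> f \<in> carrier (ar V)"
  using cmp_arrow[of f "src V f" "tgt V f" g "tgt V g"] by (auto simp: is_arrow_def)

text \<open>By \<open>cmp_eq\<close> the equation \<open>g \<bullet> f = 1\<close> is linear in
  \<open>g\<close> with this unique solution, which is also a right inverse. Hence every arrow is
  invertible and the description in \<open>arrow_inverse\<close> is proper.\<close>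

lemma arrow_inverse_eq:
  assumes f: "f \<in> carrier (ar V)"
  shows "arrow_inverse V f = \<iota>\<^bsub>V\<^esub> (src V f) \<oplus>\<^bsub>ar V\<^esub> \<iota>\<^bsub>V\<^esub> (tgt V f) \<ominus>\<^bsub>ar V\<^esub> f"
  unfolding arrow_inverse_def is_arrow_def
proof (rule the_equality)
  note [simp] = structure_simps f
  let ?g = "\<iota>\<^bsub>V\<^esub> (src V f) \<oplus>\<^bsub>ar V\<^esub> \<iota>\<^bsub>V\<^esub> (tgt V f) \<ominus>\<^bsub>ar V\<^esub> f"
  have "src V ?g = tgt V f" "tgt V ?g = src V f" by (simp_all add: embO)
  then show "(?g \<in> carrier (ar V) \<and> src V ?g = tgt V f \<and> tgt V ?g = src V f) \<and>
    ?g \<bullet>\<^bsub>V\<^esub> f = \<iota>\<^bsub>V\<^esub> (src V f) \<and> f \<bullet>\<^bsub>V\<^esub> ?g = \<iota>\<^bsub>V\<^esub> (tgt V f)"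
    by (simp add: cmp_eq) (simp add: embA)
next
  note [simp] = structure_simps f
  fix g assume g: "(g \<in> carrier (ar V) \<and> src V g = tgt V f \<and> tgt V g = src V f) \<and>
    g \<bullet>\<^bsub>V\<^esub> f = \<iota>\<^bsub>V\<^esub> (src V f) \<and> f \<bullet>\<^bsub>V\<^esub> g = \<iota>\<^bsub>V\<^esub> (tgt V f)"
  then have "g \<oplus>\<^bsub>ar V\<^esub> f \<ominus>\<^bsub>ar V\<^esub> \<iota>\<^bsub>V\<^esub> (tgt V f) = \<iota>\<^bsub>V\<^esub> (src V f)"
    using cmp_eq[OF f, of g] by metis
  with g show "g = \<iota>\<^bsub>V\<^esub> (src V f) \<oplus>\<^bsub>ar V\<^esub> \<iota>\<^bsub>V\<^esub> (tgt V f) \<ominus>\<^bsub>ar V\<^esub> f"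
    by (simp add: embA algebra_simps)
qed

lemma module_source_kernel: "module K (source_kernel V)"
proof (intro moduleI abelian_groupI)
  note [simp] = structure_simps source_kernel_simps
  fix a assume "a \<in> carrier (source_kernel V)"
  then show "\<exists>b \<in> carrier (source_kernel V). b \<oplus>\<^bsub>source_kernel V\<^esub> a = \<zero>\<^bsub>source_kernel V\<^esub>"
    by (intro bexI[of _ "\<ominus>\<^bsub>ar V\<^esub> a"]) (simp_all add: A.M.l_neg)
qed (auto simp: source_kernel_simps structure_simps A.M.a_ac A.smult_l_distr A.smult_assoc1
    K.is_cring)

text \<open>The inverse of a group is a definite description over its carrier, so shrinking the
  carrier changes the defining condition and the agreement has to be proved.\<close>

lemma source_kernel_a_inv:
  assumes "a \<in> carrier (source_kernel V)"
  shows "\<ominus>\<^bsub>source_kernel V\<^esub> a = \<ominus>\<^bsub>ar V\<^esub> a"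
proof -
  interpret N: module K "source_kernel V" by (rule module_source_kernel)
  show ?thesis
    by (rule N.M.minus_equality)
      (use assms in \<open>simp_all add: source_kernel_simps structure_simps A.M.l_neg\<close>)
qed

lemma source_kernel_minus:
  "b \<in> carrier (source_kernel V) \<Longrightarrow> a \<ominus>\<^bsub>source_kernel V\<^esub> b = a \<ominus>\<^bsub>ar V\<^esub> b"
  by (simp add: a_minus_def source_kernel_a_inv source_kernel_simps(3))

lemmas kernel_simps = source_kernel_simps source_kernel_a_inv source_kernel_minus

end

section \<open>Linear rules for the brackets, alternator and Jacobiator on arrows\<close>

context lie2_algebra
begin

lemma bilinear_br0: "bilinear K (ob L) (ob L) (ob L) (br0 L)"
  and bilinear_br1: "bilinear K (ar L) (ar L) (ar L) (br1 L)"
  and bilinear_alternator: "bilinear K (ob L) (ob L) (ar L) \<S>"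
  and trilinear_jacobiator: "trilinear K (ob L) (ob L) (ob L) (ar L) \<J>"
  using bracket alternator jacobiator
  unfolding bilinear_functor_def bilinear_transformation_def trilinear_transformation_def
  by (auto intro!: bilinear.intro bilinear_axioms.intro trilinear.intro trilinear_axioms.intro
      O.module_axioms A.module_axioms)

lemma br1_src: "\<lbrakk>f \<in> carrier (ar L); g \<in> carrier (ar L)\<rbrakk> \<Longrightarrow> src L \<lbrace>f, g\<rbrace>\<^sub>1 = \<lbrace>src L f, src L g\<rbrace>"
  and br1_tgt: "\<lbrakk>f \<in> carrier (ar L); g \<in> carrier (ar L)\<rbrakk> \<Longrightarrow> tgt L \<lbrace>f, g\<rbrace>\<^sub>1 = \<lbrace>tgt L f, tgt L g\<rbrace>"
  and br1_ident: "\<lbrakk>x \<in> carrier (ob L); y \<in> carrier (ob L)\<rbrakk> \<Longrightarrow> \<lbrace>\<iota> x, \<iota> y\<rbrace>\<^sub>1 = \<iota> \<lbrace>x, y\<rbrace>"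
  and br1_cmp: "\<lbrakk>f \<in> carrier (ar L); f' \<in> carrier (ar L); tgt L f = src L f';
      g \<in> carrier (ar L); g' \<in> carrier (ar L); tgt L g = src L g'\<rbrakk>
    \<Longrightarrow> \<lbrace>f' \<bullet> f, g' \<bullet> g\<rbrace>\<^sub>1 = \<lbrace>f', g'\<rbrace>\<^sub>1 \<bullet> \<lbrace>f, g\<rbrace>\<^sub>1"
  using bracket unfolding bilinear_functor_def is_arrow_def by blast+

lemma alternator_src: "\<lbrakk>x \<in> carrier (ob L); y \<in> carrier (ob L)\<rbrakk> \<Longrightarrow> src L (\<S> x y) = \<lbrace>x, y\<rbrace>"
  and alternator_tgt: "\<lbrakk>x \<in> carrier (ob L); y \<in> carrier (ob L)\<rbrakk> \<Longrightarrow> tgt L (\<S> x y) = \<ominus>\<^bsub>ob L\<^esub> \<lbrace>y, x\<rbrace>"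
  and alternator_natural: "\<lbrakk>f \<in> carrier (ar L); g \<in> carrier (ar L)\<rbrakk>
    \<Longrightarrow> (\<ominus>\<^bsub>ar L\<^esub> \<lbrace>g, f\<rbrace>\<^sub>1) \<bullet> \<S> (src L f) (src L g) = \<S> (tgt L f) (tgt L g) \<bullet> \<lbrace>f, g\<rbrace>\<^sub>1"
  using alternator unfolding bilinear_transformation_def is_arrow_def by blast+

lemma jacobiator_src: "\<lbrakk>x \<in> carrier (ob L); y \<in> carrier (ob L); z \<in> carrier (ob L)\<rbrakk>
    \<Longrightarrow> src L (\<J> x y z) = \<lbrace>x, \<lbrace>y, z\<rbrace>\<rbrace>"
  and jacobiator_tgt: "\<lbrakk>x \<in> carrier (ob L); y \<in> carrier (ob L); z \<in> carrier (ob L)\<rbrakk>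
    \<Longrightarrow> tgt L (\<J> x y z) = \<lbrace>\<lbrace>x, y\<rbrace>, z\<rbrace> \<oplus>\<^bsub>ob L\<^esub> \<lbrace>y, \<lbrace>x, z\<rbrace>\<rbrace>"
  and jacobiator_natural: "\<lbrakk>f \<in> carrier (ar L); g \<in> carrier (ar L); h \<in> carrier (ar L)\<rbrakk>
    \<Longrightarrow> (\<lbrace>\<lbrace>f, g\<rbrace>\<^sub>1, h\<rbrace>\<^sub>1 \<oplus>\<^bsub>ar L\<^esub> \<lbrace>g, \<lbrace>f, h\<rbrace>\<^sub>1\<rbrace>\<^sub>1) \<bullet> \<J> (src L f) (src L g) (src L h)
      = \<J> (tgt L f) (tgt L g) (tgt L h) \<bullet> \<lbrace>f, \<lbrace>g, h\<rbrace>\<^sub>1\<rbrace>\<^sub>1"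
  using jacobiator unfolding trilinear_transformation_def is_arrow_def by blast+

lemmas arrow_simps = structure_simps bilinear.simps[OF bilinear_br0] bilinear.simps[OF bilinear_br1]
  bilinear.simps[OF bilinear_alternator] trilinear.simps[OF trilinear_jacobiator]
  br1_src br1_tgt br1_ident alternator_src alternator_tgt jacobiator_src jacobiator_tgt

text \<open>Origin of the derived bracket. Write \<open>a = a \<bullet> 0\<close> and
  \<open>b = 1 \<bullet> b\<close>, the identity being that of the target of \<open>b\<close>:
  functoriality in pairs gives \<open>[a, b] = [a, 1] \<bullet> [0, b]\<close>, and the second
  factor is zero. The other equation is symmetric.\<close>

lemma br1_kernel:
  assumes "a \<in> carrier (ar L)" "src L a = \<zero>\<^bsub>ob L\<^esub>" "b \<in> carrier (ar L)" "src L b = \<zero>\<^bsub>ob L\<^esub>"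
  shows "\<lbrace>\<iota> (tgt L a), b\<rbrace>\<^sub>1 = \<lbrace>a, b\<rbrace>\<^sub>1" "\<lbrace>a, \<iota> (tgt L b)\<rbrace>\<^sub>1 = \<lbrace>a, b\<rbrace>\<^sub>1"
proof -
  note [simp] = assms arrow_simps
  show "\<lbrace>a, \<iota> (tgt L b)\<rbrace>\<^sub>1 = \<lbrace>a, b\<rbrace>\<^sub>1"
    using br1_cmp[of "\<zero>\<^bsub>ar L\<^esub>" a b "\<iota> (tgt L b)"] by (simp add: cmp_eq) (simp add: embA)
  show "\<lbrace>\<iota> (tgt L a), b\<rbrace>\<^sub>1 = \<lbrace>a, b\<rbrace>\<^sub>1"
    using br1_cmp[of a "\<iota> (tgt L a)" "\<zero>\<^bsub>ar L\<^esub>" b] by (simp add: cmp_eq) (simp add: embA)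
qed

end

section \<open>Normalization of Lie 2-algebras\<close>

lemma N_ob_simps:
  "deg0 (N_ob L) = ob L" "degm1 (N_ob L) = source_kernel L" "diff (N_ob L) = tgt L"
  "b00 (N_ob L) x y = \<lbrace>x, y\<rbrace>\<^bsub>L\<^esub>"
  "b01 (N_ob L) x b = \<lbrace>\<iota>\<^bsub>L\<^esub> x, b\<rbrace>\<^sub>1\<^bsub>L\<^esub>"
  "b10 (N_ob L) a y = \<lbrace>a, \<iota>\<^bsub>L\<^esub> y\<rbrace>\<^sub>1\<^bsub>L\<^esub>"
  "pairing (N_ob L) x y = \<ominus>\<^bsub>ar L\<^esub> (kernel_part L (\<S>\<^bsub>L\<^esub> x y))"
  "ternary (N_ob L) x y z = \<ominus>\<^bsub>ar L\<^esub> (kernel_part L (\<J>\<^bsub>L\<^esub> x y z))"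
  by (simp_all add: N_ob_def normalization_def cplx.extend_def el2.fields_def)

context lie2_algebra
begin

text \<open>The degree 0 identities are the targets of \<open>\<S>\<close> and \<open>\<J>\<close>;
  the sign in the definitions of the pairing and the ternary operation makes these targets read
  \<open>[x, y] + [y, x] = \<delta> \<langle>x, y\<rangle>\<close> and its analogue. The identities
  in degree -1 are naturality with identities in all slots but one, and \<open>E1\<close> to
  \<open>E4\<close> are \<open>L1\<close> to \<open>L4\<close> with composites expanded by
  \<open>cmp_eq\<close>.\<close>

lemma el2_algebra_N_ob: "el2_algebra K (N_ob L)"
proof -
  note [simp] = N_ob_simps arrow_simps kernel_simps kernel_part_def cmp_src cmp_tgt cmp_closed cmp_eq
    jacobiator_hat_def arrow_inverse_eq embO embA
  note eqI = embedded_group.eq_from_eq[OF embeddedA]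
  have two: "two_term_complex K (N_ob L)"
  proof (intro two_term_complex.intro two_term_complex_axioms.intro)
    show "field K" by (rule K.field_axioms)
    show "module K (deg0 (N_ob L))" by (simp add: O.module_axioms)
    show "module K (degm1 (N_ob L))" by (simp add: module_source_kernel)
    show "linear_map K (degm1 (N_ob L)) (deg0 (N_ob L)) \<delta>\<^bsub>N_ob L\<^esub>" by (rule linear_mapI) simp_all
  qed
  show ?thesis
  proof (intro el2_algebra.intro el2_algebra_axioms.intro two, goal_cases)
    case 1 show ?case by (rule bilinear_mapI) simp_all
  next
    case 2 show ?case by (rule bilinear_mapI) simp_all
  next
    case 3 show ?case by (rule bilinear_mapI) simp_all
  next
    case 4 show ?case by (rule bilinear_mapI) simp_all
  next
    case 5 show ?case by (intro trilinear_mapI bilinear_mapI) simp_all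
  next
    case 6 then show ?case by simp
  next
    case 7 then show ?case by simp
  next
    case 8 then show ?case by (simp add: br1_kernel del: embA embO)
  next
    case 9 then show ?case by simp
  next
    case (10 a y) show ?case
      by (rule eqI[OF alternator_natural[of a "\<iota> y", symmetric]]) (use 10 in simp_all)
  next
    case (11 x b) show ?case
      by (rule eqI[OF alternator_natural[of "\<iota> x" b, symmetric]]) (use 11 in simp_all)
  next
    case 12 then show ?case by simp
  next
    case (13 u v w) show ?case
      by (rule eqI[OF jacobiator_natural[of u "\<iota> v" "\<iota> w", symmetric]]) (use 13 in simp_all)
  next
    case (14 u v w) show ?case
      by (rule eqI[OF jacobiator_natural[of "\<iota> u" v "\<iota> w", symmetric]]) (use 14 in simp_all)
  next
    case (15 u v w) show ?case
      by (rule eqI[OF jacobiator_natural[of "\<iota> u" "\<iota> v" w, symmetric]]) (use 15 in simp_all)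
  next
    case (16 x y z w) show ?case
      by (rule eqI[OF L1[OF 16[unfolded N_ob_simps], symmetric]]) (use 16 in simp_all)
  next
    case (17 x y z) show ?case
      by (rule eqI[OF L2[OF 17[unfolded N_ob_simps], symmetric]]) (use 17 in simp_all)
  next
    case (18 x y z) show ?case
      by (rule eqI[OF L3[OF 18[unfolded N_ob_simps]]]) (use 18 in simp_all)
  next
    case (19 x y z) show ?case
      by (rule eqI[OF L4[OF 19[unfolded N_ob_simps], symmetric]]) (use 19 in simp_all)
  qed
qed

end

section \<open>Morphisms of Lie 2-algebras and of their normalizations\<close>

context lie2_hom
begin

lemma linear_F0: "linear K (ob L) (ob L') F0" and linear_F1: "linear K (ar L) (ar L') F1"
  and bilinear_F2: "bilinear K (ob L) (ob L) (ar L') F2"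
  using linear_functor transformation unfolding linear_functor_def bilinear_transformation_def
  by (auto intro!: linear.intro linear_axioms.intro bilinear.intro bilinear_axioms.intro
      dom.O.module_axioms dom.A.module_axioms cod.O.module_axioms cod.A.module_axioms)

lemma F1_src: "f \<in> carrier (ar L) \<Longrightarrow> src L' (F1 f) = F0 (src L f)"
  and F1_tgt: "f \<in> carrier (ar L) \<Longrightarrow> tgt L' (F1 f) = F0 (tgt L f)"
  and F1_ident: "x \<in> carrier (ob L) \<Longrightarrow> F1 (\<iota>\<^bsub>L\<^esub> x) = \<iota>\<^bsub>L'\<^esub> (F0 x)"
  using linear_functor unfolding linear_functor_def is_arrow_def by blast+

lemma F2_src: "\<lbrakk>x \<in> carrier (ob L); y \<in> carrier (ob L)\<rbrakk> \<Longrightarrow> src L' (F2 x y) = \<lbrace>F0 x, F0 y\<rbrace>\<^bsub>L'\<^esub>"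
  and F2_tgt: "\<lbrakk>x \<in> carrier (ob L); y \<in> carrier (ob L)\<rbrakk> \<Longrightarrow> tgt L' (F2 x y) = F0 \<lbrace>x, y\<rbrace>\<^bsub>L\<^esub>"
  and F2_natural: "\<lbrakk>f \<in> carrier (ar L); g \<in> carrier (ar L)\<rbrakk>
    \<Longrightarrow> F1 \<lbrace>f, g\<rbrace>\<^sub>1\<^bsub>L\<^esub> \<bullet>\<^bsub>L'\<^esub> F2 (src L f) (src L g) = F2 (tgt L f) (tgt L g) \<bullet>\<^bsub>L'\<^esub> \<lbrace>F1 f, F1 g\<rbrace>\<^sub>1\<^bsub>L'\<^esub>"
  using transformation unfolding bilinear_transformation_def is_arrow_def by blast+

lemmas hom_simps = linear.simps[OF linear_F0] linear.simps[OF linear_F1] bilinear.simps[OF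
    bilinear_F2]
  F1_src F1_tgt F1_ident F2_src F2_tgt

abbreviation "f1 \<equiv> restrict F1 (carrier (source_kernel L))"
abbreviation "f2 \<equiv> restrict2 (\<lambda>x y. \<ominus>\<^bsub>ar L'\<^esub> (kernel_part L' (F2 x y))) (carrier (ob L))"

text \<open>The target of \<open>F2\<close> gives the bracket condition in degree 0, and naturality
  of \<open>F2\<close> at a kernel arrow and an identity gives the two conditions in degree
  -1.\<close>

lemma el2_hom_N: "el2_hom K (N_ob L) (N_ob L') F0 f1 f2"
proof -
  interpret N: el2_algebra K "N_ob L" by (rule dom.el2_algebra_N_ob)
  interpret N': el2_algebra K "N_ob L'" by (rule cod.el2_algebra_N_ob)
  note [simp] = N_ob_simps dom.arrow_simps cod.arrow_simps dom.kernel_simps cod.kernel_simps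
    kernel_part_def cod.cmp_eq cod.cmp_src cod.cmp_tgt cod.cmp_closed dom.embO cod.embO cod.embA
        hom_simps restrict2_def
  note eqI = embedded_group.eq_from_eq[OF cod.embeddedA]
  show ?thesis
  proof (intro el2_hom.intro el2_hom_axioms.intro N.el2_algebra_axioms N'.el2_algebra_axioms,
      goal_cases)
    case 1 show ?case using extensional(1) by simp
  next
    case 2 show ?case by (simp del: source_kernel_simps)
  next
    case 3 show ?case by (simp add: restrict2_extensional2 del: restrict2_def)
  next
    case 4 show ?case unfolding chain_map_def by (intro conjI linear_mapI ballI) simp_all
  next
    case 5 show ?case by (rule bilinear_mapI) simp_all
  next
    case 6 then show ?case by simp
  next
    case (7 a y) show ?case
      by (rule eqI[OF F2_natural[of a "\<iota>\<^bsub>L\<^esub> y", symmetric]]) (use 7 in simp_all)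
  next
    case (8 x b) show ?case
      by (rule eqI[OF F2_natural[of "\<iota>\<^bsub>L\<^esub> x" b, symmetric]]) (use 8 in simp_all)
  next
    case (9 x y) show ?case
      by (rule eqI[OF alternator[OF 9[unfolded N_ob_simps]]]) (use 9 in simp_all)
  next
    case (10 x y z) show ?case
      by (rule eqI[OF jacobiator[OF 10[unfolded N_ob_simps]]]) (use 10 in simp_all)
  qed
qed

end

section \<open>Lifting a morphism between normalizations\<close>

locale normal_hom = dom: lie2_algebra K L + cod: lie2_algebra K L' +
    f: el2_hom K "N_ob L" "N_ob L'" f0 f1 f2
  for K :: "('k, 'r) ring_scheme" and L L' :: "('k, 'v) lie2"
    and f0 f1 :: "'v \<Rightarrow> 'v" and f2 :: "'v \<Rightarrow> 'v \<Rightarrow> 'v"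
begin

lemma linear_f0: "linear K (ob L) (ob L') f0"
  using f.linear_f0 by (simp add: N_ob_simps)

lemma f1_closed: "\<lbrakk>a \<in> carrier (ar L); src L a = \<zero>\<^bsub>ob L\<^esub>\<rbrakk> \<Longrightarrow> f1 a \<in> carrier (ar L')"
  and f1_src: "\<lbrakk>a \<in> carrier (ar L); src L a = \<zero>\<^bsub>ob L\<^esub>\<rbrakk> \<Longrightarrow> src L' (f1 a) = \<zero>\<^bsub>ob L'\<^esub>"
  and f1_tgt: "\<lbrakk>a \<in> carrier (ar L); src L a = \<zero>\<^bsub>ob L\<^esub>\<rbrakk> \<Longrightarrow> tgt L' (f1 a) = f0 (tgt L a)"
  and f1_add: "\<lbrakk>a \<in> carrier (ar L); src L a = \<zero>\<^bsub>ob L\<^esub>; b \<in> carrier (ar L); src L b = \<zero>\<^bsub>ob L\<^esub>\<rbrakk>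
    \<Longrightarrow> f1 (a \<oplus>\<^bsub>ar L\<^esub> b) = f1 a \<oplus>\<^bsub>ar L'\<^esub> f1 b"
  and f1_smult: "\<lbrakk>c \<in> carrier K; a \<in> carrier (ar L); src L a = \<zero>\<^bsub>ob L\<^esub>\<rbrakk>
    \<Longrightarrow> f1 (c \<odot>\<^bsub>ar L\<^esub> a) = c \<odot>\<^bsub>ar L'\<^esub> f1 a"
  and f1_zero: "f1 \<zero>\<^bsub>ar L\<^esub> = \<zero>\<^bsub>ar L'\<^esub>"
  using linear.simps[OF f.linear_f1] f.diff_f1 by (simp_all add: N_ob_simps source_kernel_simps)

lemma f2_src: "\<lbrakk>x \<in> carrier (ob L); y \<in> carrier (ob L)\<rbrakk> \<Longrightarrow> src L' (f2 x y) = \<zero>\<^bsub>ob L'\<^esub>"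
  and f2_tgt: "\<lbrakk>x \<in> carrier (ob L); y \<in> carrier (ob L)\<rbrakk>
    \<Longrightarrow> tgt L' (f2 x y) = \<lbrace>f0 x, f0 y\<rbrace>\<^bsub>L'\<^esub> \<ominus>\<^bsub>ob L'\<^esub> f0 \<lbrace>x, y\<rbrace>\<^bsub>L\<^esub>"
  using bilinear.simps(1)[OF f.bilinear_f2] f.diff_f2
  by (simp_all add: N_ob_simps source_kernel_simps)

lemma bilinear_f2: "bilinear K (ob L) (ob L) (ar L') f2"
proof (intro bilinear.intro bilinear_axioms.intro dom.O.module_axioms cod.A.module_axioms)
  show "bilinear_map K (ob L) (ob L) (ar L') f2"
    using bilinear.simps[OF f.bilinear_f2]
    by (intro bilinear_mapI) (simp_all add: N_ob_simps source_kernel_simps)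
qed

text \<open>The only possible extension: a linear functor has to send an identity plus a kernel
  arrow to the identity of the image plus the value of \<open>f1\<close> on the kernel
  arrow.\<close>

definition F1 :: "'v \<Rightarrow> 'v" where
  "F1 = restrict (\<lambda>p. \<iota>\<^bsub>L'\<^esub> (f0 (src L p)) \<oplus>\<^bsub>ar L'\<^esub> f1 (kernel_part L p)) (carrier (ar L))"

definition F2 :: "'v \<Rightarrow> 'v \<Rightarrow> 'v" where
  "F2 = restrict2 (\<lambda>x y. \<iota>\<^bsub>L'\<^esub> \<lbrace>f0 x, f0 y\<rbrace>\<^bsub>L'\<^esub> \<ominus>\<^bsub>ar L'\<^esub> f2 x y) (carrier (ob L))"

lemma F1_eq: "p \<in> carrier (ar L) \<Longrightarrow> F1 p = \<iota>\<^bsub>L'\<^esub> (f0 (src L p)) \<oplus>\<^bsub>ar L'\<^esub> f1 (kernel_part L p)"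
  by (simp add: F1_def)

lemma F2_eq: "\<lbrakk>x \<in> carrier (ob L); y \<in> carrier (ob L)\<rbrakk>
    \<Longrightarrow> F2 x y = \<iota>\<^bsub>L'\<^esub> \<lbrace>f0 x, f0 y\<rbrace>\<^bsub>L'\<^esub> \<ominus>\<^bsub>ar L'\<^esub> f2 x y"
  by (simp add: F2_def restrict2_def)

lemma kernel_part_simps:
  "p \<in> carrier (ar L) \<Longrightarrow> kernel_part L p \<in> carrier (ar L)"
  "p \<in> carrier (ar L) \<Longrightarrow> src L (kernel_part L p) = \<zero>\<^bsub>ob L\<^esub>"
  "\<lbrakk>p \<in> carrier (ar L); q \<in> carrier (ar L)\<rbrakk>
    \<Longrightarrow> kernel_part L (p \<oplus>\<^bsub>ar L\<^esub> q) = kernel_part L p \<oplus>\<^bsub>ar L\<^esub> kernel_part L q"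
  "\<lbrakk>c \<in> carrier K; p \<in> carrier (ar L)\<rbrakk> \<Longrightarrow> kernel_part L (c \<odot>\<^bsub>ar L\<^esub> p) = c \<odot>\<^bsub>ar L\<^esub> kernel_part L p"
  by (simp_all add: kernel_part_def dom.arrow_simps dom.embO dom.embA)

lemma linear_F1: "linear K (ar L) (ar L') F1"
proof (intro linear.intro linear_axioms.intro dom.A.module_axioms cod.A.module_axioms)
  show "linear_map K (ar L) (ar L') F1"
    by (rule linear_mapI) (simp_all add: F1_eq kernel_part_simps f1_closed f1_add f1_smult
      dom.structure_simps cod.structure_simps linear.simps[OF linear_f0] cod.embA)
qed

lemma F1_src: "p \<in> carrier (ar L) \<Longrightarrow> src L' (F1 p) = f0 (src L p)"
  and F1_tgt: "p \<in> carrier (ar L) \<Longrightarrow> tgt L' (F1 p) = f0 (tgt L p)"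
  and F1_ident: "x \<in> carrier (ob L) \<Longrightarrow> F1 (\<iota>\<^bsub>L\<^esub> x) = \<iota>\<^bsub>L'\<^esub> (f0 x)"
proof -
  note [simp] = dom.structure_simps cod.structure_simps linear.simps[OF linear_f0]
    f1_closed f1_src f1_tgt f1_zero kernel_part_simps(1,2) cod.embO
  show "src L' (F1 p) = f0 (src L p)" if "p \<in> carrier (ar L)"
    using that by (simp add: F1_eq)
  show "tgt L' (F1 p) = f0 (tgt L p)" if "p \<in> carrier (ar L)"
    using that by (simp add: F1_eq) (simp add: kernel_part_def)
  have "kernel_part L (\<iota>\<^bsub>L\<^esub> x) = \<zero>\<^bsub>ar L\<^esub>" if "x \<in> carrier (ob L)"
    using that by (simp add: kernel_part_def dom.embA)
  then show "F1 (\<iota>\<^bsub>L\<^esub> x) = \<iota>\<^bsub>L'\<^esub> (f0 x)" if "x \<in> carrier (ob L)"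
    using that by (simp add: F1_eq cod.embA)
qed

lemma kernel_part_kernel: "\<lbrakk>a \<in> carrier (ar L); src L a = \<zero>\<^bsub>ob L\<^esub>\<rbrakk> \<Longrightarrow> kernel_part L a = a"
  by (simp add: kernel_part_def dom.structure_simps dom.embA)

text \<open>Eliminates \<open>f1\<close>, which is linear only on the kernel of the source map, in
  favour of \<open>F1\<close>, which is linear on all arrows; sums can then be rewritten without
  checking membership in the kernel.\<close>

lemma f1_eq_F1: "\<lbrakk>a \<in> carrier (ar L); src L a = \<zero>\<^bsub>ob L\<^esub>\<rbrakk> \<Longrightarrow> f1 a = F1 a"
  by (simp add: F1_eq kernel_part_kernel cod.structure_simps linear.simps[OF linear_f0] f1_closed
      cod.embA)

lemmas lift_simps = linear.simps[OF linear_f0] linear.simps[OF linear_F1] bilinear.simps[OF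
    bilinear_f2]
  F1_src F1_tgt F1_ident f2_src f2_tgt

lemma f2_kernel:
  "\<lbrakk>a \<in> carrier (ar L); src L a = \<zero>\<^bsub>ob L\<^esub>; y \<in> carrier (ob L)\<rbrakk>
    \<Longrightarrow> f2 (tgt L a) y = \<lbrace>F1 a, \<iota>\<^bsub>L'\<^esub> (f0 y)\<rbrace>\<^sub>1\<^bsub>L'\<^esub> \<ominus>\<^bsub>ar L'\<^esub> F1 \<lbrace>a, \<iota>\<^bsub>L\<^esub> y\<rbrace>\<^sub>1\<^bsub>L\<^esub>"
  "\<lbrakk>x \<in> carrier (ob L); b \<in> carrier (ar L); src L b = \<zero>\<^bsub>ob L\<^esub>\<rbrakk>
    \<Longrightarrow> f2 x (tgt L b) = \<lbrace>\<iota>\<^bsub>L'\<^esub> (f0 x), F1 b\<rbrace>\<^sub>1\<^bsub>L'\<^esub> \<ominus>\<^bsub>ar L'\<^esub> F1 \<lbrace>\<iota>\<^bsub>L\<^esub> x, b\<rbrace>\<^sub>1\<^bsub>L\<^esub>"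
  using f.bracket10[of a y] f.bracket01[of x b]
  by (simp_all add: N_ob_simps dom.arrow_simps cod.arrow_simps dom.kernel_simps cod.kernel_simps
      lift_simps f1_eq_F1)

text \<open>The hypotheses give naturality only with an identity in one slot. Splitting both arrows
  into identity and kernel part leaves, besides these cases, the value of \<open>f2\<close> at two
  boundaries, which \<open>f2_kernel\<close> expresses by brackets of the kernel parts.\<close>

lemma F2_natural:
  assumes p: "p \<in> carrier (ar L)" and q: "q \<in> carrier (ar L)"
  shows "F1 \<lbrace>p, q\<rbrace>\<^sub>1\<^bsub>L\<^esub> \<bullet>\<^bsub>L'\<^esub> F2 (src L p) (src L q) = F2 (tgt L p) (tgt L q) \<bullet>\<^bsub>L'\<^esub> \<lbrace>F1 p, F1
      q\<rbrace>\<^sub>1\<^bsub>L'\<^esub>"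
proof -
  note [simp] = dom.arrow_simps cod.arrow_simps lift_simps dom.embO cod.embO
  define x y where "x = src L p" and "y = src L q"
  define a b where "a = kernel_part L p" and "b = kernel_part L q"
  have [simp]: "x \<in> carrier (ob L)" "y \<in> carrier (ob L)" "a \<in> carrier (ar L)" "b \<in> carrier (ar L)"
    "src L a = \<zero>\<^bsub>ob L\<^esub>" "src L b = \<zero>\<^bsub>ob L\<^esub>"
    using p q by (simp_all add: x_def y_def a_def b_def kernel_part_simps)
  have eq: "p = \<iota>\<^bsub>L\<^esub> x \<oplus>\<^bsub>ar L\<^esub> a" "q = \<iota>\<^bsub>L\<^esub> y \<oplus>\<^bsub>ar L\<^esub> b"
    using p q by (simp_all add: x_def y_def a_def b_def kernel_part_def dom.embA)
  \<comment> \<open>Brackets of two kernel parts arise in several shapes, depending on which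
    boundary was evaluated; \<open>br\<close> and \<open>br2\<close> reduce them to one.\<close>
  have br: "\<lbrace>\<iota>\<^bsub>L\<^esub> (tgt L a), b\<rbrace>\<^sub>1\<^bsub>L\<^esub> = \<lbrace>a, b\<rbrace>\<^sub>1\<^bsub>L\<^esub>" "\<lbrace>\<iota>\<^bsub>L'\<^esub> (f0 (tgt L a)), F1 b\<rbrace>\<^sub>1\<^bsub>L'\<^esub> = \<lbrace>F1 a,
      F1 b\<rbrace>\<^sub>1\<^bsub>L'\<^esub>"
    using dom.br1_kernel(1)[of a b] cod.br1_kernel(1)[of "F1 a" "F1 b"] by simp_all
  have br2: "\<lbrace>a, \<iota>\<^bsub>L\<^esub> (tgt L b)\<rbrace>\<^sub>1\<^bsub>L\<^esub> = \<lbrace>a, b\<rbrace>\<^sub>1\<^bsub>L\<^esub>" "\<lbrace>F1 a, \<iota>\<^bsub>L'\<^esub> (f0 (tgt L b))\<rbrace>\<^sub>1\<^bsub>L'\<^esub> = \<lbrace>F1 a,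
      F1 b\<rbrace>\<^sub>1\<^bsub>L'\<^esub>"
    using dom.br1_kernel(2)[of a b] cod.br1_kernel(2)[of "F1 a" "F1 b"] by simp_all
  show ?thesis
    unfolding eq by (simp add: F2_eq cod.cmp_eq f2_kernel br br2) (simp add: cod.embA br br2)
qed

text \<open>Preservation of composition is automatic: by \<open>cmp_eq\<close> composition is
  addition followed by subtraction of an identity, and \<open>F1\<close> is linear and compatible
  with sources and identities. The coherence conditions come from those of \<open>f\<close> by the
  expansion of composites used for \<open>el2_hom_N\<close>, read in the opposite direction.\<close>

lemma lie2_hom_lift: "lie2_hom K L L' f0 F1 F2"
proof -
  note [simp] = N_ob_simps dom.arrow_simps cod.arrow_simps dom.kernel_simps cod.kernel_simps
      kernel_part_def
    lift_simps f1_eq_F1 F2_eq dom.cmp_eq cod.cmp_eq dom.cmp_src cod.cmp_src dom.cmp_tgt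
        cod.cmp_tgt dom.cmp_closed cod.cmp_closed
    dom.embO cod.embO cod.embA
  note eqI = embedded_group.eq_from_eq[OF cod.embeddedA]
  have F2_arrow: "F2 x y \<in> carrier (ar L')" "src L' (F2 x y) = \<lbrace>f0 x, f0 y\<rbrace>\<^bsub>L'\<^esub>" "tgt L' (F2 x y)
      = f0 \<lbrace>x, y\<rbrace>\<^bsub>L\<^esub>"
    if "x \<in> carrier (ob L)" "y \<in> carrier (ob L)" for x y using that by simp_all
  show ?thesis
  proof (intro lie2_hom.intro lie2_hom_axioms.intro dom.lie2_algebra_axioms
      cod.lie2_algebra_axioms, goal_cases)
    case 1 show ?case using f.extensional(1) by simp
  next
    case 2 show ?case by (simp add: F1_def)
  next
    case 3 show ?case by (simp add: F2_def restrict2_extensional2)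
  next
    case 4 show ?case
      unfolding linear_functor_def
      using linear.map[OF linear_f0] linear.map[OF linear_F1] by (auto simp: is_arrow_def simp
          del: cod.embA)
  next
    case 5 show ?case
      unfolding bilinear_transformation_def is_arrow_def
    proof (intro conjI ballI allI impI)
      show "bilinear_map K (ob L) (ob L) (ar L') F2" by (rule bilinear_mapI) simp_all
    qed (use F2_arrow F2_natural in blast)+
  next
    case (6 x y) show ?case
      by (rule eqI[OF f.pairing[of x y]]) (use 6 in simp_all)
  next
    case (7 x y z) show ?case
      by (rule eqI[OF f.ternary[of x y z]]) (use 7 in simp_all)
  qed
qed

end

text \<open>Explains the quadratic term in the condition on 2-morphisms: the derived bracket of
  \<open>N_ob L\<close> is nothing but the bracket of arrows, restricted to the kernel of the source
  map.\<close>

lemma (in lie2_algebra) derived_N_ob: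
  "\<lbrakk>a \<in> carrier (ar L); src L a = \<zero>\<^bsub>ob L\<^esub>; b \<in> carrier (ar L); src L b = \<zero>\<^bsub>ob L\<^esub>\<rbrakk>
    \<Longrightarrow> [a, b]\<^sub>1\<^sub>1\<^bsub>N_ob L\<^esub> = \<lbrace>a, b\<rbrace>\<^sub>1"
  by (simp add: derived_def N_ob_simps br1_kernel)

section \<open>2-morphisms of Lie 2-algebras and homotopies of normalizations\<close>

locale lie2_homotopy = F: lie2_hom K L L' F0 F1 F2 + G: lie2_hom K L L' G0 G1 G2
  for K :: "('k, 'r) ring_scheme" and L L' :: "('k, 'v) lie2"
    and F0 F1 :: "'v \<Rightarrow> 'v" and F2 and G0 G1 :: "'v \<Rightarrow> 'v" and G2 +
  fixes \<Theta> :: "'v \<Rightarrow> 'v"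
  assumes homotopy_extensional: "\<Theta> \<in> extensional (carrier (ob L))"
    and homotopy_transformation: "linear_transformation K L L' F0 F1 G0 G1 \<Theta>"
    and homotopy_bracket: "\<lbrakk>x \<in> carrier (ob L); y \<in> carrier (ob L)\<rbrakk> \<Longrightarrow>
      \<Theta> \<lbrace>x, y\<rbrace>\<^bsub>L\<^esub> \<bullet>\<^bsub>L'\<^esub> F2 x y = G2 x y \<bullet>\<^bsub>L'\<^esub> \<lbrace>\<Theta> x, \<Theta> y\<rbrace>\<^sub>1\<^bsub>L'\<^esub>"
begin

lemma linear_homotopy: "linear K (ob L) (ar L') \<Theta>"
  using homotopy_transformation unfolding linear_transformation_def
  by (auto intro!: linear.intro linear_axioms.intro F.dom.O.module_axioms F.cod.A.module_axioms)

lemma homotopy_src: "x \<in> carrier (ob L) \<Longrightarrow> src L' (\<Theta> x) = F0 x"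
  and homotopy_tgt: "x \<in> carrier (ob L) \<Longrightarrow> tgt L' (\<Theta> x) = G0 x"
  and homotopy_natural: "p \<in> carrier (ar L) \<Longrightarrow> G1 p \<bullet>\<^bsub>L'\<^esub> \<Theta> (src L p) = \<Theta> (tgt L p) \<bullet>\<^bsub>L'\<^esub> F1 p"
  using homotopy_transformation unfolding linear_transformation_def is_arrow_def by blast+

text \<open>Naturality at kernel arrows is the degree -1 homotopy condition. For the bracket
  condition, \<open>\<Theta> x\<close> is an identity minus \<open>\<theta> x\<close>, and the
  bracket of two such differences expands into an identity, the two mixed brackets and the derived
  bracket.\<close>

lemma el2_homotopy_N:
  "el2_homotopy K (N_ob L) (N_ob L') F0 F.f1 F.f2 G0 G.f1 G.f2
    (restrict (\<lambda>x. \<ominus>\<^bsub>ar L'\<^esub> (kernel_part L' (\<Theta> x))) (carrier (ob L)))"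
proof -
  note [simp] = N_ob_simps F.dom.arrow_simps F.cod.arrow_simps F.dom.kernel_simps F.cod.kernel_simps
    kernel_part_def F.cod.cmp_eq F.cod.cmp_src F.cod.cmp_tgt F.cod.cmp_closed F.dom.embO
        F.cod.embO F.cod.embA
    F.hom_simps G.hom_simps restrict2_def linear.simps[OF linear_homotopy] homotopy_src homotopy_tgt
    F.cod.derived_N_ob
  note eqI = embedded_group.eq_from_eq[OF F.cod.embeddedA]
  show ?thesis
  proof (intro el2_homotopy.intro el2_homotopy_axioms.intro F.el2_hom_N G.el2_hom_N, goal_cases)
    case 1 show ?case by simp
  next
    case 2 show ?case by (rule linear_mapI) simp_all
  next
    case 3 then show ?case by simp
  next
    case (4 a) show ?case
      by (rule eqI[OF homotopy_natural[of a, symmetric]]) (use 4 in simp_all)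
  next
    case (5 x y) show ?case
      by (rule eqI[OF homotopy_bracket[of x y, symmetric]]) (use 5 in simp_all)
  qed
qed

end

locale normal_homotopy = F: lie2_hom K L L' F0 F1 F2 + G: lie2_hom K L L' G0 G1 G2 +
    h: el2_homotopy K "N_ob L" "N_ob L'" F0 F.f1 F.f2 G0 G.f1 G.f2 \<theta>
  for K :: "('k, 'r) ring_scheme" and L L' :: "('k, 'v) lie2"
    and F0 F1 :: "'v \<Rightarrow> 'v" and F2 and G0 G1 :: "'v \<Rightarrow> 'v" and G2 and \<theta> :: "'v \<Rightarrow> 'v"
begin

definition \<Theta> :: "'v \<Rightarrow> 'v" where
  "\<Theta> = restrict (\<lambda>x. \<iota>\<^bsub>L'\<^esub> (F0 x) \<ominus>\<^bsub>ar L'\<^esub> \<theta> x) (carrier (ob L))"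

lemma \<theta>_closed: "x \<in> carrier (ob L) \<Longrightarrow> \<theta> x \<in> carrier (ar L')"
  and \<theta>_src: "x \<in> carrier (ob L) \<Longrightarrow> src L' (\<theta> x) = \<zero>\<^bsub>ob L'\<^esub>"
  and \<theta>_tgt: "x \<in> carrier (ob L) \<Longrightarrow> tgt L' (\<theta> x) = F0 x \<ominus>\<^bsub>ob L'\<^esub> G0 x"
  using linear.simps(1)[OF h.linear_homotopy] h.homotopy0 by (simp_all add: N_ob_simps
      source_kernel_simps)

lemma linear_\<theta>: "linear K (ob L) (ar L') \<theta>"
proof (intro linear.intro linear_axioms.intro F.dom.O.module_axioms F.cod.A.module_axioms)
  show "linear_map K (ob L) (ar L') \<theta>"
    using linear.simps[OF h.linear_homotopy]
    by (intro linear_mapI) (simp_all add: N_ob_simps source_kernel_simps)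
qed

lemma \<theta>_kernel:
  assumes "a \<in> carrier (ar L)" "src L a = \<zero>\<^bsub>ob L\<^esub>"
  shows "\<theta> (tgt L a) = F1 a \<ominus>\<^bsub>ar L'\<^esub> G1 a"
  using h.homotopy1[of a] assms
  by (simp add: N_ob_simps F.hom_simps G.hom_simps F.cod.kernel_simps F.dom.structure_simps)

lemma lie2_homotopy_lift: "lie2_homotopy K L L' F0 F1 F2 G0 G1 G2 \<Theta>"
proof -
  note [simp] = F.dom.arrow_simps F.cod.arrow_simps F.hom_simps G.hom_simps
    linear.simps[OF linear_\<theta>] \<theta>_src \<theta>_tgt
  have \<Theta>: "\<Theta> x = \<iota>\<^bsub>L'\<^esub> (F0 x) \<ominus>\<^bsub>ar L'\<^esub> \<theta> x" if "x \<in> carrier (ob L)" for x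
    using that by (simp add: \<Theta>_def)
  have arrow: "\<Theta> x \<in> carrier (ar L')" "src L' (\<Theta> x) = F0 x" "tgt L' (\<Theta> x) = G0 x" if "x \<in> carrier
      (ob L)" for x
    using that by (simp_all add: \<Theta> F.cod.embO)
  \<comment> \<open>An arrow is an identity plus a kernel arrow; on the kernel arrow the claim is
    \<open>\<theta>_kernel\<close>, and the identity contributes equally to both sides.\<close>
  have natural: "G1 p \<bullet>\<^bsub>L'\<^esub> \<Theta> (src L p) = \<Theta> (tgt L p) \<bullet>\<^bsub>L'\<^esub> F1 p" if p: "p \<in> carrier (ar L)" for p
  proof -
    define x a where "x = src L p" and "a = kernel_part L p"
    have [simp]: "x \<in> carrier (ob L)" "a \<in> carrier (ar L)" "src L a = \<zero>\<^bsub>ob L\<^esub>"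
      using p by (simp_all add: x_def a_def kernel_part_def F.dom.embO)
    have eq: "p = \<iota>\<^bsub>L\<^esub> x \<oplus>\<^bsub>ar L\<^esub> a"
      using p by (simp add: x_def a_def kernel_part_def F.dom.embA)
    show ?thesis
      unfolding eq by (simp add: \<Theta> F.cod.cmp_eq \<theta>_kernel F.cod.embO F.dom.embO) (simp add: F.cod.embA)
  qed
  show ?thesis
  proof (intro lie2_homotopy.intro lie2_homotopy_axioms.intro F.lie2_hom_axioms G.lie2_hom_axioms,
      goal_cases)
    case 1 show ?case by (simp add: \<Theta>_def)
  next
    case 2
    have "linear_map K (ob L) (ar L') \<Theta>"
      by (rule linear_mapI) (simp_all add: \<Theta> F.cod.embA)
    then show ?case
      unfolding linear_transformation_def is_arrow_def using arrow natural by blast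
  next
    case (3 x y)
    note [simp] = N_ob_simps F.cod.kernel_simps kernel_part_def F.cod.cmp_eq F.cod.embO F.cod.embA
        restrict2_def
      F.cod.derived_N_ob \<Theta>
    show ?case
      by (rule embedded_group.eq_from_eq[OF F.cod.embeddedA h.homotopy_bracket[of x y,
          symmetric]]) (use 3 in simp_all)
  qed
qed

end

section \<open>The normalization is bijective on 1-cells and on 2-cells\<close>

text \<open>The formulas of \<open>normal_hom\<close> for records and without its hypotheses, so
  that the inverse of \<open>N\<close> is a total function, as the signature of
  \<open>local_iso\<close> demands.\<close>

definition lift_mor :: "('k, 'v) lie2 \<Rightarrow> ('k, 'v) lie2 \<Rightarrow> ('k, 'v) el2_mor \<Rightarrow> ('k, 'v) lie2_mor" where
  "lift_mor L L' f = \<lparr>mdom = L, mcod = L', m0 = m0 f,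
     m1 = restrict (\<lambda>p. \<iota>\<^bsub>L'\<^esub> (m0 f (src L p)) \<oplus>\<^bsub>ar L'\<^esub> m1 f (kernel_part L p)) (carrier (ar L)),
     m2 = restrict2 (\<lambda>x y. \<iota>\<^bsub>L'\<^esub> \<lbrace>m0 f x, m0 f y\<rbrace>\<^bsub>L'\<^esub> \<ominus>\<^bsub>ar L'\<^esub> m2 f x y) (carrier (ob L))\<rparr>"

definition lift_cell :: "('k, 'v) lie2_mor \<Rightarrow> ('k, 'v) lie2_mor \<Rightarrow> ('k, 'v) el2_cell \<Rightarrow> ('k, 'v)
    lie2_cell"
  where
  "lift_cell F G \<theta> = \<lparr>csrc = F, ctrg = G,
     cmap = restrict (\<lambda>x. \<iota>\<^bsub>mcod F\<^esub> (m0 F x) \<ominus>\<^bsub>ar (mcod F)\<^esub> cmap \<theta> x) (carrier (ob (mdom F)))\<rparr>"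

lemma lie2_morphismD:
  assumes "lie2_morphism K F"
  shows "lie2_algebra K (mdom F)" "lie2_algebra K (mcod F)"
    "lie2_hom K (mdom F) (mcod F) (m0 F) (m1 F) (m2 F)"
  using assms by (simp_all add: lie2_morphism_def lie2_hom_def)

text \<open>In contrast to \<open>el2_morphism_eqI\<close>, only extensionality is asked for. This
  matters because \<open>lie2_comp G F\<close> and \<open>Gamma_mor f\<close> are identified with
  lifts before they are known to be morphisms.\<close>

lemma mor_eqI:
  fixes f g :: "('o, 'v) mor"
  assumes "mdom f = mdom g" "mcod f = mcod g"
    and "m0 f \<in> extensional A" "m0 g \<in> extensional A" "\<And>x. x \<in> A \<Longrightarrow> m0 f x = m0 g x"
    and "m1 f \<in> extensional B" "m1 g \<in> extensional B" "\<And>a. a \<in> B \<Longrightarrow> m1 f a = m1 g a"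
    and "m2 f \<in> extensional2 A" "m2 g \<in> extensional2 A"
    and "\<And>x y. \<lbrakk>x \<in> A; y \<in> A\<rbrakk> \<Longrightarrow> m2 f x y = m2 g x y"
  shows "f = g"
proof -
  have "m0 f = m0 g" "m1 f = m1 g" "m2 f = m2 g"
    using assms extensionalityI[of "m0 f" A] extensionalityI[of "m1 f" B] extensional2_eqI[of "m2
        f" A]
    by blast+
  with assms(1,2) show ?thesis by simp
qed

lemma cell_eqI:
  fixes \<theta> \<psi> :: "('o, 'v) cell"
  assumes "csrc \<theta> = csrc \<psi>" "ctrg \<theta> = ctrg \<psi>"
    and "cmap \<theta> \<in> extensional A" "cmap \<psi> \<in> extensional A" "\<And>x. x \<in> A \<Longrightarrow> cmap \<theta> x = cmap \<psi> x"
  shows "\<theta> = \<psi>"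
  using assms extensionalityI[of "cmap \<theta>" A "cmap \<psi>"] by simp

lemma N_mor_simps:
  "mdom (N_mor F) = N_ob (mdom F)" "mcod (N_mor F) = N_ob (mcod F)" "m0 (N_mor F) = m0 F"
  "a \<in> carrier (source_kernel (mdom F)) \<Longrightarrow> m1 (N_mor F) a = m1 F a"
  "\<lbrakk>x \<in> carrier (ob (mdom F)); y \<in> carrier (ob (mdom F))\<rbrakk>
    \<Longrightarrow> m2 (N_mor F) x y = \<ominus>\<^bsub>ar (mcod F)\<^esub> (kernel_part (mcod F) (m2 F x y))"
  by (simp_all add: N_mor_def restrict2_def)

lemma lift_mor_simps:
  "mdom (lift_mor L L' f) = L" "mcod (lift_mor L L' f) = L'" "m0 (lift_mor L L' f) = m0 f"
  "p \<in> carrier (ar L)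
    \<Longrightarrow> m1 (lift_mor L L' f) p = \<iota>\<^bsub>L'\<^esub> (m0 f (src L p)) \<oplus>\<^bsub>ar L'\<^esub> m1 f (kernel_part L p)"
  "\<lbrakk>x \<in> carrier (ob L); y \<in> carrier (ob L)\<rbrakk>
    \<Longrightarrow> m2 (lift_mor L L' f) x y = \<iota>\<^bsub>L'\<^esub> \<lbrace>m0 f x, m0 f y\<rbrace>\<^bsub>L'\<^esub> \<ominus>\<^bsub>ar L'\<^esub> m2 f x y"
  by (simp_all add: lift_mor_def restrict2_def)

lemma lift_mor_extensional:
  "m1 (lift_mor L L' f) \<in> extensional (carrier (ar L))"
  "m2 (lift_mor L L' f) \<in> extensional2 (carrier (ob L))"
  by (simp_all add: lift_mor_def restrict2_extensional2)

lemma el2_morphism_N_mor: "lie2_morphism K F \<Longrightarrow> el2_morphism K (N_mor F)"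
  unfolding lie2_morphism_def el2_morphism_def N_mor_def mor.simps by (rule lie2_hom.el2_hom_N)

lemma
  assumes L: "lie2_algebra K L" and L': "lie2_algebra K L'"
    and f: "el2_morphism K f" "mdom f = N_ob L" "mcod f = N_ob L'"
  shows lie2_morphism_lift: "lie2_morphism K (lift_mor L L' f)"
    and N_mor_lift: "N_mor (lift_mor L L' f) = f"
proof -
  interpret f: el2_hom K "N_ob L" "N_ob L'" "m0 f" "m1 f" "m2 f"
    using f by (simp add: el2_morphism_def)
  interpret f: normal_hom K L L' "m0 f" "m1 f" "m2 f"
    by (intro normal_hom.intro L L' f.el2_hom_axioms)
  show lift: "lie2_morphism K (lift_mor L L' f)"
    using f.lie2_hom_lift by (simp add: lie2_morphism_def lift_mor_def f.F1_def f.F2_def)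
  show "N_mor (lift_mor L L' f) = f"
    by (rule el2_morphism_eqI[of K])
      (simp_all add: el2_morphism_N_mor lift f N_mor_simps lift_mor_simps N_ob_simps,
       simp_all add: source_kernel_simps lift_mor_simps f.kernel_part_kernel kernel_part_def[of
           L'] f.dom.structure_simps f.cod.arrow_simps f.lift_simps
         f.f1_closed f.cod.embO f.cod.embA)
qed

lemma lift_mor_N:
  assumes "lie2_morphism K F"
  shows "lift_mor (mdom F) (mcod F) (N_mor F) = F"
proof -
  interpret F: lie2_hom K "mdom F" "mcod F" "m0 F" "m1 F" "m2 F" using lie2_morphismD[OF assms] by
      simp
  have k: "kernel_part (mdom F) p \<in> carrier (source_kernel (mdom F))" if "p \<in> carrier (ar (mdom
      F))" for p
    using that by (simp add: source_kernel_simps kernel_part_def F.dom.structure_simps F.dom.embO)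
  show ?thesis
    by (rule mor_eqI[of _ _ "carrier (ob (mdom F))" "carrier (ar (mdom F))"])
      (simp_all add: lift_mor_simps lift_mor_extensional N_mor_simps k F.extensional,
       simp_all add: kernel_part_def F.dom.structure_simps F.cod.arrow_simps F.hom_simps F.cod.embA)
qed

text \<open>Being a lift is all that is checked about each operation on Lie 2-algebras; its closure,
  its typing and its laws then follow from \<open>local_iso\<close>.\<close>

lemma lie2_id_lift:
  assumes "lie2_algebra K L"
  shows "lie2_id L = lift_mor L L (el2_id (N_ob L))"
proof -
  interpret lie2_algebra K L by fact
  have k: "kernel_part L p \<in> carrier (source_kernel L)" if "p \<in> carrier (ar L)" for p
    using that by (simp add: source_kernel_simps kernel_part_def structure_simps embO)
  show ?thesis
    by (rule mor_eqI[of _ _ "carrier (ob L)" "carrier (ar L)"])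
      (simp_all add: lift_mor_simps lift_mor_extensional lie2_id_def el2_id_simps N_ob_simps k
          restrict2_extensional2,
       simp_all add: el2_id_def restrict2_def N_ob_simps kernel_simps kernel_part_def arrow_simps
           embA)
qed

text \<open>By \<open>cmp_eq\<close> the kernel part of a composite is the sum of the kernel parts,
  and \<open>m1 G\<close>, being linear and preserving identities, commutes with taking kernel
  parts. This yields the two summands of \<open>m2\<close> in \<open>el2_comp\<close>. The vertical
  and horizontal composites below are treated alike.\<close>

lemma lie2_comp_lift:
  assumes "lie2_morphism K F" "lie2_morphism K G" "mcod F = mdom G"
  shows "lie2_comp G F = lift_mor (mdom F) (mcod G) (el2_comp (N_mor G) (N_mor F))"
proof -
  interpret F: lie2_hom K "mdom F" "mdom G" "m0 F" "m1 F" "m2 F" using lie2_morphismD[OF assms(1)]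
      assms(3) by simp
  interpret G: lie2_hom K "mdom G" "mcod G" "m0 G" "m1 G" "m2 G" using lie2_morphismD[OF assms(2)]
      by simp
  note [simp] = assms(3) source_kernel_simps N_ob_simps kernel_part_def F.dom.arrow_simps
      F.cod.arrow_simps G.cod.arrow_simps
    F.hom_simps G.hom_simps F.dom.embO F.cod.embO G.cod.embO
  show ?thesis
    by (rule mor_eqI[of _ _ "carrier (ob (mdom F))" "carrier (ar (mdom F))"])
      (simp_all add: lift_mor_simps lift_mor_extensional lie2_comp_def el2_comp_simps N_mor_simps
          restrict2_extensional2 compose_def,
       simp_all add: el2_comp_def compose_def N_mor_simps restrict2_def G.cod.cmp_eq G.cod.embA)
qed

section \<open>2-cells of Lie 2-algebras as lifts of homotopies\<close>

definition lie2_cell :: "('k, 'r) ring_scheme \<Rightarrow> ('k, 'v) lie2_cell \<Rightarrow> bool" where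
  "lie2_cell K \<Theta> \<longleftrightarrow> lie2_two_hom K (csrc \<Theta>) (ctrg \<Theta>) (cmap \<Theta>)"

lemma lie2_two_hom_iff:
  "lie2_two_hom K F G \<Theta> \<longleftrightarrow> mdom G = mdom F \<and> mcod G = mcod F
    \<and> lie2_homotopy K (mdom F) (mcod F) (m0 F) (m1 F) (m2 F) (m0 G) (m1 G) (m2 G) \<Theta>"
  by (auto simp: lie2_two_hom_def lie2_homotopy_def lie2_homotopy_axioms_def lie2_morphism_def)

lemma lie2_cellD:
  assumes "lie2_cell K \<Theta>"
  shows "lie2_morphism K (csrc \<Theta>)" "lie2_morphism K (ctrg \<Theta>)"
    and "mdom (ctrg \<Theta>) = mdom (csrc \<Theta>)" "mcod (ctrg \<Theta>) = mcod (csrc \<Theta>)"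
    and "lie2_homotopy K (mdom (csrc \<Theta>)) (mcod (csrc \<Theta>)) (m0 (csrc \<Theta>)) (m1 (csrc \<Theta>)) (m2 (csrc \<Theta>))
      (m0 (ctrg \<Theta>)) (m1 (ctrg \<Theta>)) (m2 (ctrg \<Theta>)) (cmap \<Theta>)"
  using assms lie2_two_hom.cells1[of K "csrc \<Theta>" "ctrg \<Theta>" "cmap \<Theta>"]
  by (simp_all add: lie2_cell_def lie2_two_hom_iff)

lemma N_cell_simps:
  "csrc (N_cell \<Theta>) = N_mor (csrc \<Theta>)" "ctrg (N_cell \<Theta>) = N_mor (ctrg \<Theta>)"
  "x \<in> carrier (ob (mdom (csrc \<Theta>)))
    \<Longrightarrow> cmap (N_cell \<Theta>) x = \<ominus>\<^bsub>ar (mcod (csrc \<Theta>))\<^esub> (kernel_part (mcod (csrc \<Theta>)) (cmap \<Theta> x))"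
  by (simp_all add: N_cell_def)

lemma lift_cell_simps:
  "csrc (lift_cell F G \<theta>) = F" "ctrg (lift_cell F G \<theta>) = G"
  "x \<in> carrier (ob (mdom F))
    \<Longrightarrow> cmap (lift_cell F G \<theta>) x = \<iota>\<^bsub>mcod F\<^esub> (m0 F x) \<ominus>\<^bsub>ar (mcod F)\<^esub> cmap \<theta> x"
  "cmap (lift_cell F G \<theta>) \<in> extensional (carrier (ob (mdom F)))"
  by (simp_all add: lift_cell_def)

lemma el2_cell_N_cell:
  assumes "lie2_cell K \<Theta>"
  shows "el2_cell K (N_cell \<Theta>)"
  using lie2_cellD(3,4)[OF assms] lie2_homotopy.el2_homotopy_N[OF lie2_cellD(5)[OF assms]]
  by (simp add: el2_cell_def el2_two_hom_iff N_cell_def N_mor_def)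

lemma
  assumes F: "lie2_morphism K F" and G: "lie2_morphism K G" "mdom G = mdom F" "mcod G = mcod F"
    and \<theta>: "el2_cell K \<theta>" "csrc \<theta> = N_mor F" "ctrg \<theta> = N_mor G"
  shows lie2_cell_lift: "lie2_cell K (lift_cell F G \<theta>)"
    and N_cell_lift: "N_cell (lift_cell F G \<theta>) = \<theta>"
proof -
  interpret h: normal_homotopy K "mdom F" "mcod F" "m0 F" "m1 F" "m2 F" "m0 G" "m1 G" "m2 G" "cmap \<theta>"
    using lie2_morphismD(3)[OF F] lie2_morphismD(3)[OF G(1)] el2_cellD(5)[OF \<theta>(1)] G(2,3) \<theta>(2,3)
    by (simp add: normal_homotopy_def N_mor_def)
  show lift: "lie2_cell K (lift_cell F G \<theta>)"
    using h.lie2_homotopy_lift G(2,3)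
    by (simp add: lie2_cell_def lie2_two_hom_iff lift_cell_def h.\<Theta>_def)
  show "N_cell (lift_cell F G \<theta>) = \<theta>"
    by (rule el2_cell_eqI[of K])
      (simp_all add: el2_cell_N_cell lift \<theta> N_cell_simps lift_cell_simps N_mor_simps N_ob_simps
          kernel_part_def
        h.F.cod.structure_simps h.F.hom_simps h.\<theta>_closed h.\<theta>_src h.F.cod.embO h.F.cod.embA)
qed

lemma lift_cell_N:
  assumes "lie2_cell K \<Theta>"
  shows "lift_cell (csrc \<Theta>) (ctrg \<Theta>) (N_cell \<Theta>) = \<Theta>"
proof -
  interpret \<Theta>: lie2_homotopy K "mdom (csrc \<Theta>)" "mcod (csrc \<Theta>)" "m0 (csrc \<Theta>)" "m1 (csrc \<Theta>)" "m2
      (csrc \<Theta>)"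
    "m0 (ctrg \<Theta>)" "m1 (ctrg \<Theta>)" "m2 (ctrg \<Theta>)" "cmap \<Theta>" by (rule lie2_cellD(5)[OF assms])
  show ?thesis
    by (rule cell_eqI[of _ _ "carrier (ob (mdom (csrc \<Theta>)))"])
      (simp_all add: lift_cell_simps N_cell_simps \<Theta>.homotopy_extensional kernel_part_def
          \<Theta>.F.cod.structure_simps \<Theta>.F.hom_simps
        linear.simps[OF \<Theta>.linear_homotopy] \<Theta>.homotopy_src \<Theta>.F.cod.embA)
qed

lemma lie2_id2_lift:
  assumes "lie2_morphism K F"
  shows "lie2_id2 F = lift_cell F F (el2_id2 (N_mor F))"
proof -
  interpret F: lie2_hom K "mdom F" "mcod F" "m0 F" "m1 F" "m2 F" using lie2_morphismD[OF assms] by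
      simp
  show ?thesis
    by (rule cell_eqI[of _ _ "carrier (ob (mdom F))"])
      (simp_all add: lift_cell_simps lie2_id2_def el2_id2_simps N_mor_simps N_ob_simps
          source_kernel_simps
        F.cod.structure_simps F.hom_simps F.cod.embA)
qed

lemma lie2_vcomp_lift:
  assumes "lie2_cell K \<Theta>" "lie2_cell K \<Psi>" "ctrg \<Theta> = csrc \<Psi>"
  shows "lie2_vcomp \<Psi> \<Theta> = lift_cell (csrc \<Theta>) (ctrg \<Psi>) (el2_vcomp (N_cell \<Psi>) (N_cell \<Theta>))"
proof -
  have eqs: "mdom (csrc \<Psi>) = mdom (csrc \<Theta>)" "mcod (csrc \<Psi>) = mcod (csrc \<Theta>)"
    using lie2_cellD(3,4)[OF assms(1)] assms(3) by simp_all
  interpret \<Theta>: lie2_homotopy K "mdom (csrc \<Theta>)" "mcod (csrc \<Theta>)" "m0 (csrc \<Theta>)" "m1 (csrc \<Theta>)" "m2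
      (csrc \<Theta>)"
    "m0 (csrc \<Psi>)" "m1 (csrc \<Psi>)" "m2 (csrc \<Psi>)" "cmap \<Theta>" using lie2_cellD(5)[OF assms(1)] assms(3)
        by simp
  interpret \<Psi>: lie2_homotopy K "mdom (csrc \<Theta>)" "mcod (csrc \<Theta>)" "m0 (csrc \<Psi>)" "m1 (csrc \<Psi>)" "m2
      (csrc \<Psi>)"
    "m0 (ctrg \<Psi>)" "m1 (ctrg \<Psi>)" "m2 (ctrg \<Psi>)" "cmap \<Psi>" using lie2_cellD(5)[OF assms(2)] eqs by simp
  show ?thesis
    by (rule cell_eqI[of _ _ "carrier (ob (mdom (csrc \<Theta>)))"])
      (simp_all add: lift_cell_simps lie2_vcomp_def el2_vcomp_simps N_cell_simps N_mor_simps
          N_ob_simps source_kernel_simps eqs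
        kernel_part_def \<Theta>.F.cod.structure_simps \<Theta>.F.hom_simps \<Theta>.G.hom_simps \<Theta>.F.cod.cmp_eq
        linear.simps[OF \<Theta>.linear_homotopy] linear.simps[OF \<Psi>.linear_homotopy]
        \<Theta>.homotopy_src \<Psi>.homotopy_src \<Theta>.homotopy_tgt \<Theta>.F.cod.embA)
qed

lemma lie2_comp_simps:
  "mdom (lie2_comp G F) = mdom F" "mcod (lie2_comp G F) = mcod G"
  "x \<in> carrier (ob (mdom F)) \<Longrightarrow> m0 (lie2_comp G F) x = m0 G (m0 F x)"
  by (simp_all add: lie2_comp_def compose_def)

lemma lie2_hcomp_lift:
  assumes "lie2_cell K \<Theta>" "lie2_cell K \<Psi>" "mcod (csrc \<Theta>) = mdom (csrc \<Psi>)"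
  shows "lie2_hcomp \<Psi> \<Theta> = lift_cell (lie2_comp (csrc \<Psi>) (csrc \<Theta>)) (lie2_comp (ctrg \<Psi>) (ctrg \<Theta>))
    (el2_hcomp (N_cell \<Psi>) (N_cell \<Theta>))"
proof -
  interpret \<Theta>: lie2_homotopy K "mdom (csrc \<Theta>)" "mdom (csrc \<Psi>)" "m0 (csrc \<Theta>)" "m1 (csrc \<Theta>)" "m2
      (csrc \<Theta>)"
    "m0 (ctrg \<Theta>)" "m1 (ctrg \<Theta>)" "m2 (ctrg \<Theta>)" "cmap \<Theta>" using lie2_cellD(5)[OF assms(1)] assms(3)
        by simp
  interpret \<Psi>: lie2_homotopy K "mdom (csrc \<Psi>)" "mcod (csrc \<Psi>)" "m0 (csrc \<Psi>)" "m1 (csrc \<Psi>)" "m2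
      (csrc \<Psi>)"
    "m0 (ctrg \<Psi>)" "m1 (ctrg \<Psi>)" "m2 (ctrg \<Psi>)" "cmap \<Psi>" using lie2_cellD(5)[OF assms(2)] by simp
  note [simp] = assms(3) source_kernel_simps N_ob_simps kernel_part_def \<Theta>.F.cod.structure_simps
      \<Psi>.F.cod.structure_simps
     \<Theta>.F.hom_simps \<Psi>.F.hom_simps \<Theta>.G.hom_simps linear.simps[OF \<Theta>.linear_homotopy] linear.simps[OF
         \<Psi>.linear_homotopy]
     \<Theta>.homotopy_src \<Theta>.homotopy_tgt \<Psi>.homotopy_src \<Theta>.F.cod.embO
  show ?thesis
    by (rule cell_eqI[of _ _ "carrier (ob (mdom (csrc \<Theta>)))"])
      (simp_all add: lift_cell_simps lie2_hcomp_def lie2_comp_simps el2_hcomp_simps N_cell_simps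
          N_mor_simps
        \<Psi>.F.cod.cmp_eq,
       (simp_all add: lift_cell_def lie2_comp_def \<Psi>.F.cod.embA)?)
qed

lemma local_iso_normalization: "local_iso (TwoLie K) (TwoTermEL K) N_functor lift_mor lift_cell"
proof (intro local_iso.intro two_category_TwoTermEL local_iso_axioms.intro)
qed (simp_all add: TwoLie_def TwoTermEL_def N_functor_def lie2_morphismD lie2_cellD N_mor_simps
    N_cell_simps lie2_algebra.el2_algebra_N_ob el2_morphism_N_mor el2_cell_N_cell lift_mor_N
        lift_cell_N
    lie2_morphism_lift N_mor_lift lift_mor_simps lie2_cell_lift N_cell_lift lift_cell_simps
    lie2_id_lift lie2_comp_lift lie2_id2_lift lie2_vcomp_lift lie2_hcomp_lift
    flip: lie2_cell_def el2_cell_def)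

section \<open>The Lie 2-algebra of a 2-term \<open>EL\<^sub>\<infinity>\<close>-algebra\<close>

lemma direct_sum_simps:
  "Pair x a \<in> carrier (direct_sum V W) \<longleftrightarrow> x \<in> carrier V \<and> a \<in> carrier W"
  "zero (direct_sum V W) = Pair \<zero>\<^bsub>V\<^esub> \<zero>\<^bsub>W\<^esub>"
  "Pair x a \<oplus>\<^bsub>direct_sum V W\<^esub> Pair y b = Pair (x \<oplus>\<^bsub>V\<^esub> y) (a \<oplus>\<^bsub>W\<^esub> b)"
  "c \<odot>\<^bsub>direct_sum V W\<^esub> Pair x a = Pair (c \<odot>\<^bsub>V\<^esub> x) (c \<odot>\<^bsub>W\<^esub> a)"
  by (simp_all add: direct_sum_def)

lemma direct_sumE:
  assumes "p \<in> carrier (direct_sum V W)"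
  obtains x a where "p = Pair x a" "x \<in> carrier V" "a \<in> carrier W"
  using assms by (auto simp: direct_sum_def)

lemma ball_direct_sum:
  "(\<forall>p \<in> carrier (direct_sum V W). P p) \<longleftrightarrow> (\<forall>x \<in> carrier V. \<forall>a \<in> carrier W. P (Pair x a))"
  by (auto simp: direct_sum_def)

lemma module_direct_sum:
  assumes "module K V" "module K W"
  shows "module K (direct_sum V W)"
proof -
  interpret V: module K V by fact
  interpret W: module K W by fact
  show ?thesis
  proof (intro moduleI abelian_groupI V.is_cring)
    fix p assume "p \<in> carrier (direct_sum V W)"
    then obtain x a where "p = Pair x a" "x \<in> carrier V" "a \<in> carrier W" by (rule direct_sumE)
    then show "\<exists>q \<in> carrier (direct_sum V W). q \<oplus>\<^bsub>direct_sum V W\<^esub> p = \<zero>\<^bsub>direct_sum V W\<^esub>"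
      by (intro bexI[of _ "Pair (\<ominus>\<^bsub>V\<^esub> x) (\<ominus>\<^bsub>W\<^esub> a)"]) (simp_all add: direct_sum_simps V.M.l_neg
          W.M.l_neg)
  qed (auto elim!: direct_sumE simp: direct_sum_simps V.M.a_ac W.M.a_ac V.smult_l_distr
      W.smult_l_distr
      V.smult_r_distr W.smult_r_distr V.smult_assoc1 W.smult_assoc1)
qed

lemma direct_sum_minus_simps:
  assumes "module K V" "module K W" "x \<in> carrier V" "a \<in> carrier W"
  shows "\<ominus>\<^bsub>direct_sum V W\<^esub> (Pair x a) = Pair (\<ominus>\<^bsub>V\<^esub> x) (\<ominus>\<^bsub>W\<^esub> a)"
    and "Pair y b \<ominus>\<^bsub>direct_sum V W\<^esub> Pair x a = Pair (y \<ominus>\<^bsub>V\<^esub> x) (b \<ominus>\<^bsub>W\<^esub> a)"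
proof -
  interpret V: module K V by fact
  interpret W: module K W by fact
  interpret S: module K "direct_sum V W" by (rule module_direct_sum) fact+
  show *: "\<ominus>\<^bsub>direct_sum V W\<^esub> (Pair x a) = Pair (\<ominus>\<^bsub>V\<^esub> x) (\<ominus>\<^bsub>W\<^esub> a)"
    by (rule S.M.minus_equality) (use assms in \<open>simp_all add: direct_sum_simps V.M.l_neg W.M.l_neg\<close>)
  show "Pair y b \<ominus>\<^bsub>direct_sum V W\<^esub> Pair x a = Pair (y \<ominus>\<^bsub>V\<^esub> x) (b \<ominus>\<^bsub>W\<^esub> a)"
    by (simp add: a_minus_def * direct_sum_simps)
qed

lemma Gamma_ob_simps:
  "ob (Gamma_ob C) = deg0 C" "ar (Gamma_ob C) = direct_sum (deg0 C) (degm1 C)"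
  "src (Gamma_ob C) = first" "tgt (Gamma_ob C) p = first p \<oplus>\<^bsub>deg0 C\<^esub> \<delta>\<^bsub>C\<^esub> (second p)"
  "\<iota>\<^bsub>Gamma_ob C\<^esub> x = Pair x \<zero>\<^bsub>degm1 C\<^esub>"
  "q \<bullet>\<^bsub>Gamma_ob C\<^esub> p = Pair (first p) (second p \<oplus>\<^bsub>degm1 C\<^esub> second q)"
  "\<lbrace>x, y\<rbrace>\<^bsub>Gamma_ob C\<^esub> = [x, y]\<^sub>0\<^sub>0\<^bsub>C\<^esub>"
  "\<lbrace>p, q\<rbrace>\<^sub>1\<^bsub>Gamma_ob C\<^esub> = Pair [first p, first q]\<^sub>0\<^sub>0\<^bsub>C\<^esub>
        ([first p, second q]\<^sub>0\<^sub>1\<^bsub>C\<^esub> \<oplus>\<^bsub>degm1 C\<^esub> [second p, first q]\<^sub>1\<^sub>0\<^bsub>C\<^esub>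
          \<oplus>\<^bsub>degm1 C\<^esub> [\<delta>\<^bsub>C\<^esub> (second p), second q]\<^sub>0\<^sub>1\<^bsub>C\<^esub>)"
  "\<S>\<^bsub>Gamma_ob C\<^esub> x y = Pair [x, y]\<^sub>0\<^sub>0\<^bsub>C\<^esub> (\<ominus>\<^bsub>degm1 C\<^esub> \<langle>x, y\<rangle>\<^bsub>C\<^esub>)"
  "\<J>\<^bsub>Gamma_ob C\<^esub> x y z = Pair [x, [y, z]\<^sub>0\<^sub>0\<^bsub>C\<^esub>]\<^sub>0\<^sub>0\<^bsub>C\<^esub> (\<ominus>\<^bsub>degm1 C\<^esub> \<langle>x, y, z\<rangle>\<^bsub>C\<^esub>)"
  by (simp_all add: Gamma_ob_def Gamma_def lincat.extend_def lie2.fields_def derived_def)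

context el2_algebra
begin

text \<open>Since \<open>[\<delta> b, z]\<close> is \<open>\<delta> [b, z]\<close>, both sides are
  the derived bracket of \<open>a\<close> with \<open>[b, z]\<close>.\<close>

lemma b10_diff_left: "\<lbrakk>a \<in> carrier (degm1 C); b \<in> carrier (degm1 C); z \<in> carrier (deg0 C)\<rbrakk>
    \<Longrightarrow> [a, [\<delta> b, z]\<^sub>0\<^sub>0]\<^sub>1\<^sub>0 = [\<delta> a, [b, z]\<^sub>1\<^sub>0]\<^sub>0\<^sub>1"
  using b01_b10[of a "[b, z]\<^sub>1\<^sub>0"] by (simp add: operations diff_b10)

lemma b10_diff_right: "\<lbrakk>a \<in> carrier (degm1 C); y \<in> carrier (deg0 C); c \<in> carrier (degm1 C)\<rbrakk>
    \<Longrightarrow> [a, [y, \<delta> c]\<^sub>0\<^sub>0]\<^sub>1\<^sub>0 = [\<delta> a, [y, c]\<^sub>0\<^sub>1]\<^sub>0\<^sub>1"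
  using b01_b10[of a "[y, c]\<^sub>0\<^sub>1"] by (simp add: operations diff_b01)

text \<open>Read from right to left, the homotopy axioms expand \<open>\<langle>\<delta> a, \<delta> b, z\<rangle>\<close> and its like in
  whichever slot comes first; the two rules above make the results agree.\<close>

lemmas homotopy_rules = b10_diff_left b10_diff_right jacobi100[symmetric] jacobi010[symmetric]
  jacobi001[symmetric] skew10[symmetric] skew01[symmetric] jacobi000[symmetric] skew00[symmetric]

end

locale el2_univ = el2_algebra K C for K :: "('k, 'r) ring_scheme" and C :: "('k, 'u univ) el2"
    (structure)
begin

lemmas Gamma_simps = Gamma_ob_simps direct_sum_simps
  direct_sum_minus_simps[OF C0.module_axioms C1.module_axioms]

lemma linear_category_Gamma_ob: "linear_category K (Gamma_ob C)"
proof -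
  note [simp] = Gamma_simps operations group_closed smult_simps
  show ?thesis
  proof (intro linear_category.intro linear_category_axioms.intro K.field_axioms, goal_cases)
    case 1 show ?case by (simp add: C0.module_axioms)
  next
    case 2 show ?case by (simp add: module_direct_sum C0.module_axioms C1.module_axioms)
  qed (auto simp: is_arrow_def linear_map_def ball_direct_sum elim!: direct_sumE, simp_all add:
      emb0 emb1)
qed

end

context el2_univ
begin

text \<open>The substance lies in naturality of \<open>\<S>\<close> and \<open>\<J>\<close> at
  arbitrary arrows. Expanding the target objects \<open>x + \<delta> a\<close> produces operations
  with boundaries in several slots; \<open>homotopy_rules\<close> turns all of them into brackets,
  which then cancel. The coherence laws are \<open>E1\<close> to \<open>E4\<close> read off in the
  second component.\<close>

lemma lie2_algebra_Gamma_ob: "lie2_algebra K (Gamma_ob C)"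
proof -
  interpret G: linear_category K "Gamma_ob C" by (rule linear_category_Gamma_ob)
  note [simp] = Gamma_simps operations group_closed smult_simps
  note eqI = embedded_group.eq_from_eq[OF embedded1]
  show ?thesis
  proof (intro lie2_algebra.intro lie2_algebra_axioms.intro G.linear_category_axioms, goal_cases)
    case 1
    have lin: "bilinear_map K (ar (Gamma_ob C)) (ar (Gamma_ob C)) (ar (Gamma_ob C)) (br1 (Gamma_ob
        C))"
      by (rule bilinear_mapI; simp; elim direct_sumE; simp add: emb0 emb1)
    show ?case
      unfolding bilinear_functor_def is_arrow_def
    proof (intro conjI lin allI impI)
      show "bilinear_map K (ob (Gamma_ob C)) (ob (Gamma_ob C)) (ob (Gamma_ob C)) (br0 (Gamma_ob C))"
        by (rule bilinear_mapI) simp_all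
    next
      fix f x x' f' x'' g y y' g' y''
      assume "((f \<in> carrier (ar (Gamma_ob C)) \<and> src (Gamma_ob C) f = x \<and> tgt (Gamma_ob C) f = x') \<and>
        (f' \<in> carrier (ar (Gamma_ob C)) \<and> src (Gamma_ob C) f' = x' \<and> tgt (Gamma_ob C) f' = x'') \<and>
        (g \<in> carrier (ar (Gamma_ob C)) \<and> src (Gamma_ob C) g = y \<and> tgt (Gamma_ob C) g = y') \<and>
        (g' \<in> carrier (ar (Gamma_ob C)) \<and> src (Gamma_ob C) g' = y' \<and> tgt (Gamma_ob C) g' = y''))"
      \<comment> \<open>Here \<open>[\<delta> a, b] = [a, \<delta> b]\<close> is indispensable: the
        mixed terms of the left side are derived brackets, while on the right they come from the
        shifted sources of \<open>f'\<close> and \<open>g'\<close>.\<close>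
      then show "br1 (Gamma_ob C) (f' \<bullet>\<^bsub>Gamma_ob C\<^esub> f) (g' \<bullet>\<^bsub>Gamma_ob C\<^esub> g)
          = br1 (Gamma_ob C) f' g' \<bullet>\<^bsub>Gamma_ob C\<^esub> br1 (Gamma_ob C) f g"
        by (auto elim!: direct_sumE simp: brackets) (simp add: emb1 brackets)
    qed (auto elim!: direct_sumE simp: brackets, simp_all add: emb0 emb1 brackets)
  next
    case 2
    have "bilinear_map K (ob (Gamma_ob C)) (ob (Gamma_ob C)) (ar (Gamma_ob C)) \<S>\<^bsub>Gamma_ob C\<^esub>"
      by (rule bilinear_mapI) (simp_all add: emb0 emb1)
    then show ?case
      unfolding bilinear_transformation_def is_arrow_def
      by (auto elim!: direct_sumE simp: brackets) (simp_all add: emb0 emb1 brackets homotopy_rules)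
  next
    case 3
    have "trilinear_map K (ob (Gamma_ob C)) (ob (Gamma_ob C)) (ob (Gamma_ob C)) (ar (Gamma_ob C))
        \<J>\<^bsub>Gamma_ob C\<^esub>"
      by (intro trilinear_mapI bilinear_mapI) (simp_all add: emb0 emb1)
    then show ?case
      unfolding trilinear_transformation_def is_arrow_def
      by (auto elim!: direct_sumE simp: brackets) (simp_all add: emb0 emb1 brackets homotopy_rules)
  next
    case (4 x y z w)
    then have [simp]: "x \<in> carrier (deg0 C)" "y \<in> carrier (deg0 C)" "z \<in> carrier (deg0 C)" "w \<in>
        carrier (deg0 C)"
      by simp_all
    show ?case
      by simp (rule eqI[OF E1[of x y z w, symmetric]]; simp add: emb1_add)
  next
    case (5 x y z)
    then have [simp]: "x \<in> carrier (deg0 C)" "y \<in> carrier (deg0 C)" "z \<in> carrier (deg0 C)"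
      by simp_all
    \<comment> \<open>The first components need an argument too: the left side starts at
      \<open>[[x, y], z]\<close>, whereas the source of \<open>jacobiator_hat\<close> is computed
      from the target of \<open>\<J>\<close>. The Jacobi identity in degree 0 identifies
      them.\<close>
    show ?case
      by (simp add: jacobiator_hat_def G.arrow_inverse_eq) (intro conjI,
        simp add: emb0 jacobi000[symmetric], rule eqI[OF E2[of x y z, symmetric]]; simp add: emb1_add)
  next
    case (6 x y z)
    then have [simp]: "x \<in> carrier (deg0 C)" "y \<in> carrier (deg0 C)" "z \<in> carrier (deg0 C)"
      by simp_all
    show ?case
      by (simp add: jacobiator_hat_def G.arrow_inverse_eq) (rule eqI[OF E3[of x y z]]; simp add:
          emb1_add)
  next
    case (7 x y z)
    then have [simp]: "x \<in> carrier (deg0 C)" "y \<in> carrier (deg0 C)" "z \<in> carrier (deg0 C)"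
      by simp_all
    show ?case
      by (simp add: jacobiator_hat_def G.arrow_inverse_eq) (rule eqI[OF E4[of x y z, symmetric]];
          simp add: emb1_add)
  qed
qed

end

section \<open>Comparison of the normalization of \<open>\<Gamma>\<close> with the given
  algebra\<close>

definition counit :: "('k, 'u univ) el2 \<Rightarrow> ('k, 'u univ) el2_mor" where
  "counit C = \<lparr>mdom = N_ob (Gamma_ob C), mcod = C,
     m0 = restrict (\<lambda>x. x) (carrier (deg0 C)),
     m1 = restrict second (carrier (source_kernel (Gamma_ob C))),
     m2 = restrict2 (\<lambda>x y. \<zero>\<^bsub>degm1 C\<^esub>) (carrier (deg0 C))\<rparr>"

definition counit_inv :: "('k, 'u univ) el2 \<Rightarrow> ('k, 'u univ) el2_mor" where
  "counit_inv C = \<lparr>mdom = C, mcod = N_ob (Gamma_ob C),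
     m0 = restrict (\<lambda>x. x) (carrier (deg0 C)),
     m1 = restrict (\<lambda>a. Pair \<zero>\<^bsub>deg0 C\<^esub> a) (carrier (degm1 C)),
     m2 = restrict2 (\<lambda>x y. Pair \<zero>\<^bsub>deg0 C\<^esub> \<zero>\<^bsub>degm1 C\<^esub>) (carrier (deg0 C))\<rparr>"

lemma counit_simps:
  "mdom (counit C) = N_ob (Gamma_ob C)" "mcod (counit C) = C"
  "x \<in> carrier (deg0 C) \<Longrightarrow> m0 (counit C) x = x"
  "Pair x a \<in> carrier (source_kernel (Gamma_ob C)) \<Longrightarrow> m1 (counit C) (Pair x a) = a"
  "\<lbrakk>x \<in> carrier (deg0 C); y \<in> carrier (deg0 C)\<rbrakk> \<Longrightarrow> m2 (counit C) x y = \<zero>\<^bsub>degm1 C\<^esub>"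
  "mdom (counit_inv C) = C" "mcod (counit_inv C) = N_ob (Gamma_ob C)"
  "x \<in> carrier (deg0 C) \<Longrightarrow> m0 (counit_inv C) x = x"
  "a \<in> carrier (degm1 C) \<Longrightarrow> m1 (counit_inv C) a = Pair \<zero>\<^bsub>deg0 C\<^esub> a"
  "\<lbrakk>x \<in> carrier (deg0 C); y \<in> carrier (deg0 C)\<rbrakk> \<Longrightarrow> m2 (counit_inv C) x y = Pair \<zero>\<^bsub>deg0 C\<^esub> \<zero>\<^bsub>degm1 C\<^esub>"
  by (simp_all add: counit_def counit_inv_def restrict2_def)

context el2_univ
begin

lemma source_kernel_Gamma_ob:
  "p \<in> carrier (source_kernel (Gamma_ob C)) \<longleftrightarrow> (\<exists>a \<in> carrier (degm1 C). p = Pair \<zero>\<^bsub>deg0 C\<^esub> a)"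
  by (auto simp: source_kernel_simps Gamma_simps group_closed elim!: direct_sumE)

lemma ball_source_kernel_Gamma_ob:
  "(\<forall>p \<in> carrier (source_kernel (Gamma_ob C)). P p) \<longleftrightarrow> (\<forall>a \<in> carrier (degm1 C). P (Pair \<zero>\<^bsub>deg0 C\<^esub> a))"
  by (auto simp: source_kernel_Gamma_ob)

lemma el2_algebra_N_Gamma: "el2_algebra K (N_ob (Gamma_ob C))"
  by (intro lie2_algebra.el2_algebra_N_ob lie2_algebra_Gamma_ob)

text \<open>The first components are variables assumed to vanish, since kernel parts leave
  uncancelled expressions such as \<open>[x, y] \<ominus> [x, y]\<close> in that place.
  \<open>m1_counit\<close> has its form for the same reason.\<close>

lemma source_kernel_Gamma_minus:
  "\<lbrakk>y = \<zero>\<^bsub>deg0 C\<^esub>; x = \<zero>\<^bsub>deg0 C\<^esub>; a \<in> carrier (degm1 C); b \<in> carrier (degm1 C)\<rbrakk>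
    \<Longrightarrow> Pair y b \<ominus>\<^bsub>source_kernel (Gamma_ob C)\<^esub> Pair x a = Pair \<zero>\<^bsub>deg0 C\<^esub> (b \<ominus>\<^bsub>degm1 C\<^esub> a)"
  by (simp add: linear_category.source_kernel_minus[OF linear_category_Gamma_ob]
      source_kernel_Gamma_ob Gamma_simps
     group_closed emb0)

lemma m1_counit: "\<lbrakk>x = \<zero>\<^bsub>deg0 C\<^esub>; a \<in> carrier (degm1 C)\<rbrakk> \<Longrightarrow> m1 (counit C) (Pair x a) = a"
  by (rule counit_simps) (simp add: source_kernel_Gamma_ob)

text \<open>Dropping the zero first component respects all operations strictly, so the morphism has
  \<open>m2 = 0\<close>.\<close>

lemma el2_morphism_counit: "el2_morphism K (counit C)"
proof -
  interpret N: el2_algebra K "N_ob (Gamma_ob C)" by (rule el2_algebra_N_Gamma)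
  note [simp] = counit_simps(1-3,5-) N_ob_simps source_kernel_simps(2-4) Gamma_simps operations
      group_closed
    source_kernel_Gamma_ob kernel_part_def C1.smult_r_null C0.smult_r_null emb0 emb1 m1_counit
  show ?thesis
    unfolding el2_morphism_def counit_simps
  proof (intro el2_hom.intro el2_hom_axioms.intro N.el2_algebra_axioms el2_algebra_axioms, goal_cases)
    case 1 show ?case by (simp add: counit_def)
  next
    case 2 show ?case by (simp add: counit_def)
  next
    case 3 show ?case by (simp add: counit_def restrict2_extensional2)
  next
    case 4 show ?case
      by (simp add: chain_map_def linear_map_def ball_source_kernel_Gamma_ob) (auto simp del: emb0
          emb1)
  next
    case 5 show ?case by (rule bilinear_mapI) simp_all
  qed auto
qed

lemma el2_morphism_counit_inv: "el2_morphism K (counit_inv C)"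
proof -
  interpret N: el2_algebra K "N_ob (Gamma_ob C)" by (rule el2_algebra_N_Gamma)
  note [simp] = counit_simps(1-3,5-) N_ob_simps source_kernel_simps(2-4) Gamma_simps operations
      group_closed
    source_kernel_Gamma_ob kernel_part_def C1.smult_r_null C0.smult_r_null emb0 emb1
        source_kernel_Gamma_minus
  show ?thesis
    unfolding el2_morphism_def counit_simps
  proof (intro el2_hom.intro el2_hom_axioms.intro N.el2_algebra_axioms el2_algebra_axioms, goal_cases)
    case 1 show ?case by (simp add: counit_inv_def)
  next
    case 2 show ?case by (simp add: counit_inv_def)
  next
    case 3 show ?case by (simp add: counit_inv_def restrict2_extensional2)
  next
    case 4 show ?case by (auto simp: chain_map_def linear_map_def Pi_iff simp del: emb0 emb1)
  next
    case 5 show ?case by (rule bilinear_mapI) (auto simp del: emb0 emb1)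
  qed simp_all
qed

end

lemma el2_univ_iff: "el2_univ K C \<longleftrightarrow> el2_algebra K C"
  by (simp add: el2_univ_def)

lemma
  assumes "el2_algebra K C"
  shows counit_counit_inv: "el2_comp (counit C) (counit_inv C) = el2_id C"
    and counit_inv_counit: "el2_comp (counit_inv C) (counit C) = el2_id (N_ob (Gamma_ob C))"
proof -
  interpret el2_univ K C using assms by (simp add: el2_univ_iff)
  note [simp] = counit_simps(1-3,5-) m1_counit N_ob_simps source_kernel_simps(2-4) Gamma_simps
      operations group_closed
    el2_simps el2_closed el2_morphism_counit el2_morphism_counit_inv el2_algebra_axioms
        el2_algebra_N_Gamma
  show "el2_comp (counit C) (counit_inv C) = el2_id C"
    by (rule el2_morphism_eqI[of K]) simp_all
  show "el2_comp (counit_inv C) (counit C) = el2_id (N_ob (Gamma_ob C))"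
    by (rule el2_morphism_eqI[of K]) (auto simp: source_kernel_Gamma_ob)
qed

text \<open>Conjugation turns \<open>f1\<close> into the map of pairs \<open>(0, a)\<close> to
  \<open>(0, f1 a)\<close>, and lifting puts \<open>f0\<close> into the first component and the sign
  in front of \<open>f2\<close>, giving the explicit formulas of \<open>Gamma_mor\<close>. This and
  the analogue for 2-cells replace a direct check that \<open>\<Gamma>\<close> preserves morphisms,
  2-morphisms and composites.\<close>

lemma Gamma_mor_lift:
  assumes "el2_morphism K f"
  shows "Gamma_mor f = lift_mor (Gamma_ob (mdom f)) (Gamma_ob (mcod f))
    (el2_comp (counit_inv (mcod f)) (el2_comp f (counit (mdom f))))"
proof -
  interpret f: el2_hom K "mdom f" "mcod f" "m0 f" "m1 f" "m2 f"
    using assms by (simp add: el2_morphism_def)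
  interpret C: el2_univ K "mdom f" by (simp add: el2_univ_iff f.dom.el2_algebra_axioms)
  interpret D: el2_univ K "mcod f" by (simp add: el2_univ_iff f.cod.el2_algebra_axioms)
  note [simp] = counit_simps(1-3,5-) C.m1_counit N_ob_simps source_kernel_simps(2-4) C.Gamma_simps
      D.Gamma_simps
    f.rewrite_rules el2_simps C.source_kernel_Gamma_ob f.dom.C0.M.minus_cancel f.dom.C1.M.minus_cancel
    f.cod.C0.M.minus_cancel f.cod.C1.M.minus_cancel
  show ?thesis
    by (rule mor_eqI[of _ _ "carrier (deg0 (mdom f))" "carrier (direct_sum (deg0 (mdom f)) (degm1
        (mdom f)))"])
      (auto simp: Gamma_mor_def lift_mor_def f.extensional restrict2_extensional2 el2_comp_def,
       auto elim!: direct_sumE simp: kernel_part_def restrict2_def compose_def)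
qed

lemma Gamma_cell_lift:
  assumes "el2_cell K \<theta>"
  shows "Gamma_cell \<theta> = lift_cell (Gamma_mor (csrc \<theta>)) (Gamma_mor (ctrg \<theta>))
    (el2_hcomp (el2_id2 (counit_inv (mcod (csrc \<theta>)))) (el2_hcomp \<theta> (el2_id2 (counit (mdom (csrc
        \<theta>))))))"
proof -
  note D = el2_cellD[OF assms]
  interpret \<theta>: el2_homotopy K "mdom (csrc \<theta>)" "mcod (csrc \<theta>)" "m0 (csrc \<theta>)" "m1 (csrc \<theta>)"
    "m2 (csrc \<theta>)" "m0 (ctrg \<theta>)" "m1 (ctrg \<theta>)" "m2 (ctrg \<theta>)" "cmap \<theta>" by (fact D(5))
  interpret C: el2_univ K "mdom (csrc \<theta>)" by (simp add: el2_univ_iff \<theta>.f.dom.el2_algebra_axioms)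
  interpret D: el2_univ K "mcod (csrc \<theta>)" by (simp add: el2_univ_iff \<theta>.f.cod.el2_algebra_axioms)
  note [simp] = counit_simps(1-3,5-) C.m1_counit N_ob_simps source_kernel_simps(2-4) D.Gamma_simps
    \<theta>.f.rewrite_rules \<theta>.homotopy_simps el2_simps D(3,4) \<theta>.g.maps
    \<theta>.f.cod.C0.M.minus_cancel \<theta>.f.cod.C1.M.minus_cancel
  show ?thesis
    by (rule cell_eqI[of _ _ "carrier (deg0 (mdom (csrc \<theta>)))"])
      (simp_all add: Gamma_cell_def lift_cell_def Gamma_mor_def Gamma_ob_simps)
qed

lemma local_equivalence_normalization:
  "local_equivalence (TwoLie K) (TwoTermEL K) N_functor lift_mor lift_cell Gamma_functor counit
      counit_inv"
proof (intro local_equivalence.intro local_iso_normalization local_equivalence_axioms.intro)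
qed (simp_all add: TwoLie_def TwoTermEL_def N_functor_def Gamma_functor_def
    el2_univ.lie2_algebra_Gamma_ob el2_univ_iff
    el2_univ.el2_morphism_counit el2_univ.el2_morphism_counit_inv counit_simps counit_counit_inv
        counit_inv_counit
    Gamma_mor_lift Gamma_cell_lift flip: el2_cell_def)

theorem theorem2p21:
  fixes K :: "('k, 'r) ring_scheme"
  assumes "field K"
  shows "two_category (TwoTermEL K :: ('k, 'u univ) el2_cat)
    \<and> two_functor (TwoLie K :: ('k, 'u univ) lie2_cat) (TwoTermEL K) N_functor
    \<and> two_functor (TwoTermEL K) (TwoLie K :: ('k, 'u univ) lie2_cat) Gamma_functor
    \<and> two_equivalence (TwoLie K :: ('k, 'u univ) lie2_cat) (TwoTermEL K) N_functor Gamma_functor"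
proof -
  interpret local_equivalence "TwoLie K :: ('k, 'u univ) lie2_cat" "TwoTermEL K" N_functor
    lift_mor lift_cell Gamma_functor counit counit_inv
    by (rule local_equivalence_normalization)
  show ?thesis
    using D.two_category_axioms two_functor_N two_functor_G two_equivalence by blast
qed

end
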